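(* Let $\{\mu_{nk}:n\in\mathbb{N},1\le k\le k_n\}\subset\mathcal{M}_{\mathbb{T}}^{\times}$ be an infinitesimal array and let $\{\lambda_n\}_{n=1}^\infty\subset\mathbb{T}$ be a sequence. The following statements are equivalent: (1) The sequence $\delta_{\lambda_n}\uplus_\times\mu_{n1}\uplus_\times\mu_{n2}\uplus_\times\cdots\uplus_\times\mu_{nk_n}$ converges weakly to $m$ as $n\to\infty$. (2) The sequence $\delta_{\lambda_n}\boxtimes\mu_{n1}\boxtimes\mu_{n2}\boxtimes\cdots\boxtimes\mu_{nk_n}$ converges weakly to $m$ as $n\to\infty$. (3) $$\lim_{n\to\infty}\sum_{k=1}^{k_n}\int_{\mathbb{T}}(1-\Re\zeta)\,d\mu_{nk}^\circ(\zeta)=+\infty.$$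
   Context: $\mathbb{T}$ is the unit circle, $\mathbb{D}$ the open unit disk; $m$ is Haar measure (normalized arclength) on $\mathbb{T}$; $\mathcal{M}_{\mathbb{T}}^{\times}$ is the set of Borel probability measures $\mu$ on $\mathbb{T}$ with $\int_{\mathbb{T}}\zeta\,d\mu(\zeta)\ne0$; $\delta_\lambda$ is the point mass at $\lambda$. $\{k_n\}$ is a sequence of natural numbers. An array $\{\mu_{nk}\}_{n\in\mathbb{N},1\le k\le k_n}$ of probability measures on $\mathbb{T}$ is infinitesimal if $\lim_{n\to\infty}\max_{1\le k\le k_n}\mu_{nk}(\{\zeta\in\mathbb{T}:|\zeta-1|\ge\varepsilon\})=0$ for every $\varepsilon>0$. For a probability measure $\mu$ on $\mathbb{T}$ put $\psi_\mu(z)=\int_{\mathbb{T}}\frac{\zeta z}{1-\zeta z}\,d\mu(\zeta)$ and $B_\mu(z)=\frac1z\frac{\psi_\mu(z)}{1+\psi_\mu(z)}$, $z\in\mathbb{D}$ (with the singularity at $0$ removed). The map $\mu\mapsto B_\mu$ is a bijection from probability measures on $\mathbb{T}$ to analytic functions $\mathbb{D}\to\overline{\mathbb{D}}$. The multiplicative boolean convolution $\mu_1\uplus_\times\mu_2$ is the probability measure determined by $B_{\mu_1\uplus_\times\mu_2}(z)=B_{\mu_1}(z)B_{\mu_2}(z)$, $z\in\mathbb{D}$. $\boxtimes$ is the free multiplicative convolution of probability measures on $\mathbb{T}$ (the distribution of a product of two freely independent unitaries with the given distributions). For $\nu\in\mathcal{M}_{\mathbb{T}}^\times$ the function $\psi_\nu$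 has an inverse $\psi_\nu^{-1}$ near $0$; with $\Sigma_\nu(z)=\frac1z\psi_\nu^{-1}\left(\frac{z}{1-z}\right)$ one has $\Sigma_{\mu\boxtimes\nu}=\Sigma_\mu\Sigma_\nu$ near $0$ for $\mu,\nu\in\mathcal{M}_{\mathbb{T}}^\times$. $\arg$ is the principal value of the argument. Fix a constant $\tau\in(0,\pi)$, and set $b_{nk}=\exp\left(i\int_{|\arg\zeta|<\tau}\arg\zeta\,d\mu_{nk}(\zeta)\right)$ and $d\mu_{nk}^\circ(\zeta)=d\mu_{nk}(b_{nk}\zeta)$, i.e. $\mu_{nk}^\circ(A)=\mu_{nk}(b_{nk}A)$ for Borel $A\subset\mathbb{T}$. *)

theory Defs
  imports
    "HOL-Complex_Analysis.Complex_Analysis"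
    "HOL-Probability.Probability"
    "HOL-Algebra.Module"
begin

section \<open>Probability measures on the unit circle\<close>

abbreviation unit_circle :: "complex set" where
  "unit_circle \<equiv> sphere 0 1"

definition circle_borel :: "complex measure" where
  "circle_borel = restrict_space borel unit_circle"

definition circle_prob :: "complex measure set" where
  "circle_prob = {\<mu>. prob_space \<mu> \<and> sets \<mu> = sets circle_borel}"

definition circle_prob_nz :: "complex measure set" where
  "circle_prob_nz = {\<mu> \<in> circle_prob. (\<integral>\<zeta>. \<zeta> \<partial>\<mu>) \<noteq> 0}"

definition circle_dirac :: "complex \<Rightarrow> complex measure" where
  "circle_dirac a = return circle_borel a"

definition circle_haar :: "complex measure" where
  "circle_haar = distr (uniform_measure lborel {0..2 * pi}) circle_borel cis"

definition circle_weak_conv :: "(nat \<Rightarrow> complex measure) \<Rightarrow> complex measure \<Rightarrow> bool" where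
  "circle_weak_conv \<nu> \<mu> \<longleftrightarrow>
     (\<forall>f :: complex \<Rightarrow> real. continuous_on unit_circle f \<longrightarrow>
        (\<lambda>n. \<integral>\<zeta>. f \<zeta> \<partial>\<nu> n) \<longlonglongrightarrow> (\<integral>\<zeta>. f \<zeta> \<partial>\<mu>))"

text \<open>Rows are indexed by \<open>n\<close>, and row \<open>n\<close> has the entries \<open>\<mu> n 1, \<dots>, \<mu> n (K n)\<close>.\<close>

definition infinitesimal_array :: "(nat \<Rightarrow> nat) \<Rightarrow> (nat \<Rightarrow> nat \<Rightarrow> complex measure) \<Rightarrow> bool" where
  "infinitesimal_array K \<mu> \<longleftrightarrow>
     (\<forall>\<epsilon>>0. (\<lambda>n. Max ((\<lambda>k. measure (\<mu> n k) {\<zeta> \<in> unit_circle. norm (\<zeta> - 1) \<ge> \<epsilon>}) ` {1..K n}))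
        \<longlonglongrightarrow> 0)"

section \<open>Multiplicative boolean convolution\<close>

definition psi_transform :: "complex measure \<Rightarrow> complex \<Rightarrow> complex" where
  "psi_transform \<mu> z = (\<integral>\<zeta>. \<zeta> * z / (1 - \<zeta> * z) \<partial>\<mu>)"

definition B_transform :: "complex measure \<Rightarrow> complex \<Rightarrow> complex" where
  "B_transform \<mu> =
     remove_sings (\<lambda>z. 1 / z * (psi_transform \<mu> z / (1 + psi_transform \<mu> z)))"

definition bool_mconv :: "complex measure \<Rightarrow> complex measure \<Rightarrow> complex measure"
    (infixl \<open>\<uplus>\<^sub>\<times>\<close> 70) where
  "\<mu> \<uplus>\<^sub>\<times> \<nu> =
     (THE \<rho>. \<rho> \<in> circle_prob \<and>
        (\<forall>z \<in> ball 0 1. B_transform \<rho> z = B_transform \<mu> z * B_transform \<nu> z))"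

section \<open>Free independence and free multiplicative convolution\<close>

definition complex_ring :: "complex ring" where
  "complex_ring = \<lparr>carrier = UNIV, mult = (*), one = 1, zero = 0, add = (+)\<rparr>"

text \<open>
  A unital complex *-algebra with a positive unital linear functional.  The ring is not assumed
  to be commutative, which is why the locale \<open>algebra\<close> of the library is not used.
\<close>

locale star_probability_space =
  Module.module complex_ring A + Ring.ring A
  for A :: "(complex, 'a) module" (structure) +
  fixes star :: "'a \<Rightarrow> 'a" and \<phi> :: "'a \<Rightarrow> complex"
  assumes smult_mult_left:
      "\<lbrakk>x \<in> carrier A; y \<in> carrier A\<rbrakk> \<Longrightarrow> (c \<odot>\<^bsub>A\<^esub> x) \<otimes>\<^bsub>A\<^esub> y = c \<odot>\<^bsub>A\<^esub> (x \<otimes>\<^bsub>A\<^esub> y)"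
    and smult_mult_right:
      "\<lbrakk>x \<in> carrier A; y \<in> carrier A\<rbrakk> \<Longrightarrow> x \<otimes>\<^bsub>A\<^esub> (c \<odot>\<^bsub>A\<^esub> y) = c \<odot>\<^bsub>A\<^esub> (x \<otimes>\<^bsub>A\<^esub> y)"
    and star_closed: "x \<in> carrier A \<Longrightarrow> star x \<in> carrier A"
    and star_add: "\<lbrakk>x \<in> carrier A; y \<in> carrier A\<rbrakk> \<Longrightarrow> star (x \<oplus>\<^bsub>A\<^esub> y) = star x \<oplus>\<^bsub>A\<^esub> star y"
    and star_smult: "x \<in> carrier A \<Longrightarrow> star (c \<odot>\<^bsub>A\<^esub> x) = cnj c \<odot>\<^bsub>A\<^esub> star x"
    and star_mult: "\<lbrakk>x \<in> carrier A; y \<in> carrier A\<rbrakk> \<Longrightarrow> star (x \<otimes>\<^bsub>A\<^esub> y) = star y \<otimes>\<^bsub>A\<^esub> star x"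
    and star_star: "x \<in> carrier A \<Longrightarrow> star (star x) = x"
    and state_add: "\<lbrakk>x \<in> carrier A; y \<in> carrier A\<rbrakk> \<Longrightarrow> \<phi> (x \<oplus>\<^bsub>A\<^esub> y) = \<phi> x + \<phi> y"
    and state_smult: "x \<in> carrier A \<Longrightarrow> \<phi> (c \<odot>\<^bsub>A\<^esub> x) = c * \<phi> x"
    and state_one: "\<phi> \<one>\<^bsub>A\<^esub> = 1"
    and state_pos: "x \<in> carrier A \<Longrightarrow> \<phi> (star x \<otimes>\<^bsub>A\<^esub> x) \<in> \<real>\<^sub>\<ge>\<^sub>0"

definition unitary_elements :: "(complex, 'a) module \<Rightarrow> ('a \<Rightarrow> 'a) \<Rightarrow> 'a set" where
  "unitary_elements A star =
     {u \<in> carrier A. star u \<otimes>\<^bsub>A\<^esub> u = \<one>\<^bsub>A\<^esub> \<and> u \<otimes>\<^bsub>A\<^esub> star u = \<one>\<^bsub>A\<^esub>}"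

definition has_unitary_distribution ::
    "(complex, 'a) module \<Rightarrow> ('a \<Rightarrow> complex) \<Rightarrow> 'a \<Rightarrow> complex measure \<Rightarrow> bool" where
  "has_unitary_distribution A \<phi> u \<mu> \<longleftrightarrow>
     \<mu> \<in> circle_prob \<and> (\<forall>k::int. \<phi> (u [^]\<^bsub>A\<^esub> k) = (\<integral>\<zeta>. \<zeta> powi k \<partial>\<mu>))"

inductive_set generated_star_subalgebra ::
    "(complex, 'a) module \<Rightarrow> ('a \<Rightarrow> 'a) \<Rightarrow> 'a set \<Rightarrow> 'a set"
  for A :: "(complex, 'a) module" and star :: "'a \<Rightarrow> 'a" and S :: "'a set" where
  incl: "x \<in> S \<Longrightarrow> x \<in> generated_star_subalgebra A star S"
| one: "\<one>\<^bsub>A\<^esub> \<in> generated_star_subalgebra A star S"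
| add: "\<lbrakk>x \<in> generated_star_subalgebra A star S; y \<in> generated_star_subalgebra A star S\<rbrakk>
    \<Longrightarrow> x \<oplus>\<^bsub>A\<^esub> y \<in> generated_star_subalgebra A star S"
| smult: "x \<in> generated_star_subalgebra A star S
    \<Longrightarrow> c \<odot>\<^bsub>A\<^esub> x \<in> generated_star_subalgebra A star S"
| mult: "\<lbrakk>x \<in> generated_star_subalgebra A star S; y \<in> generated_star_subalgebra A star S\<rbrakk>
    \<Longrightarrow> x \<otimes>\<^bsub>A\<^esub> y \<in> generated_star_subalgebra A star S"
| star: "x \<in> generated_star_subalgebra A star S \<Longrightarrow> star x \<in> generated_star_subalgebra A star S"

text \<open>
  Freeness of a family \<open>(B i)\<close> of subalgebras: \<open>\<phi> (x\<^sub>1 \<cdots> x\<^sub>n) = 0\<close> for all \<open>n \<ge> 1\<close> whenever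
  \<open>x\<^sub>j \<in> B (i\<^sub>j)\<close>, \<open>\<phi> x\<^sub>j = 0\<close> and neighbouring indices \<open>i\<^sub>j\<close> are distinct.
\<close>

definition free_subalgebras ::
    "(complex, 'a) module \<Rightarrow> ('a \<Rightarrow> complex) \<Rightarrow> ('i \<Rightarrow> 'a set) \<Rightarrow> bool" where
  "free_subalgebras A \<phi> B \<longleftrightarrow>
     (\<forall>js xs. xs \<noteq> [] \<longrightarrow> list_all2 (\<lambda>j x. x \<in> B j \<and> \<phi> x = 0) js xs \<longrightarrow> distinct_adj js
        \<longrightarrow> \<phi> (foldr (\<otimes>\<^bsub>A\<^esub>) xs \<one>\<^bsub>A\<^esub>) = 0)"

definition freely_independent ::
    "(complex, 'a) module \<Rightarrow> ('a \<Rightarrow> 'a) \<Rightarrow> ('a \<Rightarrow> complex) \<Rightarrow> 'a \<Rightarrow> 'a \<Rightarrow> bool" where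
  "freely_independent A star \<phi> u v \<longleftrightarrow>
     free_subalgebras A \<phi> (\<lambda>b::bool. generated_star_subalgebra A star {if b then u else v})"

text \<open>
  The type \<open>nat \<Rightarrow> complex\<close> only serves as a supply of elements for the carrier of the
  *-algebra, whose operations are arbitrary.  A *-algebra generated by two elements has at most
  the cardinality of the continuum, so fixing this type excludes no pair of distributions.
\<close>

definition is_free_mconv :: "complex measure \<Rightarrow> complex measure \<Rightarrow> complex measure \<Rightarrow> bool" where
  "is_free_mconv \<mu> \<nu> \<rho> \<longleftrightarrow>
     (\<exists>(A :: (complex, nat \<Rightarrow> complex) module) star \<phi> u v.
        star_probability_space A star \<phi> \<and>
        u \<in> unitary_elements A star \<and> v \<in> unitary_elements A star \<and>
        freely_independent A star \<phi> u v \<and>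
        has_unitary_distribution A \<phi> u \<mu> \<and> has_unitary_distribution A \<phi> v \<nu> \<and>
        has_unitary_distribution A \<phi> (u \<otimes>\<^bsub>A\<^esub> v) \<rho>)"

definition free_mconv :: "complex measure \<Rightarrow> complex measure \<Rightarrow> complex measure"
    (infixl \<open>\<boxtimes>\<close> 70) where
  "\<mu> \<boxtimes> \<nu> = (THE \<rho>. is_free_mconv \<mu> \<nu> \<rho>)"

section \<open>Centering\<close>

definition centering_const :: "real \<Rightarrow> complex measure \<Rightarrow> complex" where
  "centering_const \<tau> \<mu> = exp (\<i> * of_real (LINT \<zeta>:{\<zeta>. \<bar>Arg \<zeta>\<bar> < \<tau>}|\<mu>. Arg \<zeta>))"

text \<open>The measure \<open>A \<mapsto> \<mu> (b A)\<close> with \<open>b\<close> the centering constant of \<open>\<mu>\<close>.\<close>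

definition centered :: "real \<Rightarrow> complex measure \<Rightarrow> complex measure" where
  "centered \<tau> \<mu> = distr \<mu> circle_borel (\<lambda>\<zeta>. \<zeta> / centering_const \<tau> \<mu>)"

end

theory Submission
  imports Defs "HOL-Library.Poly_Mapping"
begin

text \<open>
  Write \<open>m\<^sub>n\<^sub>k = \<integral> \<zeta> d\<mu>\<^sub>n\<^sub>k\<close> and \<open>P\<^sub>n = \<Prod>\<^sub>k \<bar>m\<^sub>n\<^sub>k\<bar>\<close>. Each of the three conditions is equivalent
  to \<open>P\<^sub>n \<longlonglongrightarrow> 0\<close>. By Stone--Weierstrass, weak convergence to Haar measure means that all moments of
  positive order tend to \<open>0\<close>. The first moment is multiplicative for both convolutions and
  therefore has modulus \<open>P\<^sub>n\<close>, so that \<open>P\<^sub>n \<longlonglongrightarrow> 0\<close> is necessary in both cases. The work is in the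
  converse, where one small moment has to control all of them.

  Boolean case: \<open>B(0) = \<integral> \<zeta> d\<mu>\<close>, and Harnack's inequality bounds \<open>1 - \<bar>B(z)\<bar>\<close> from below by a
  multiple of \<open>1 - \<bar>B(0)\<bar>\<close> that depends on \<open>\<bar>z\<bar>\<close> only (\<open>one_minus_norm_schur_ge\<close>). Hence the
  product of the functions \<open>B\<close> of a row tends to \<open>0\<close> on a circle of positive radius, and Cauchy's
  estimates give the moments.

  Free case: because all factors \<open>\<bar>m\<^sub>n\<^sub>k\<bar>\<close> are close to \<open>1\<close>, a row whose product is small can be
  cut into a prefix and a suffix whose products are both at most \<open>2 sqrt P\<^sub>n\<close> (\<open>split_product\<close>).
  Let \<open>u\<close> and \<open>v\<close> be the products of the free unitaries of the two parts. They are free, and if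
  their means vanished, then so would all moments of \<open>u v\<close>, by the definition of freeness.
  Expanding the centered letters of \<open>(u v)\<^sup>k\<close> shows that in general the \<open>k\<close>-th moment is at most
  \<open>4\<^sup>k\<close> times the larger of the two means (\<open>norm_state_power_free_le\<close>).

  Condition on the sums: with \<open>s = \<integral> (1 - Re \<zeta>)\<close> for the centered measure,
  \<open>\<bar>m\<bar>\<^sup>2 = (1 - s)\<^sup>2 + y\<^sup>2\<close>, and the choice of the centering constant makes \<open>y = O(s)\<close>
  (\<open>centered_imaginary_part_le\<close>). So \<open>1 - \<bar>m\<bar> \<le> s \<le> 2 (1 - \<bar>m\<bar>)\<close> once the measure is concentrated
  near \<open>1\<close>, and \<open>\<Sum>\<^sub>k (1 - \<bar>m\<^sub>n\<^sub>k\<bar>) \<longlonglongrightarrow> \<infinity>\<close> is the same as \<open>P\<^sub>n \<longlonglongrightarrow> 0\<close>.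

  Both convolutions are defined by descriptions, so that existence and uniqueness of the described
  measures have to be proved. Existence rests on two forms of Herglotz' theorem
  (\<open>herglotz_positive_definite\<close>, \<open>herglotz_psi_transform\<close>), which follow from compactness of the
  set of probability measures on the circle. For the free convolution a whole row is realized in
  one *-algebra: operators on the vector space spanned by words, with the inner product of the
  free product of the spaces \<open>L\<^sup>2(\<mu>\<^sub>i)\<close>. An element over an index set \<open>I\<close> acts only on the front
  part of a word that is spelled in \<open>I\<close> (\<open>acts_on_front\<close>), and this gives freeness for disjoint
  index sets, hence also for the products of the prefix and the suffix (\<open>free_front_algebras\<close>).
\<close>

section \<open>Probability measures on the circle and their moments\<close>

definition circle_moment :: "complex measure \<Rightarrow> int \<Rightarrow> complex" where
  "circle_moment \<mu> k = (\<integral>\<zeta>. \<zeta> powi k \<partial>\<mu>)"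

lemma space_circle_borel [simp]: "space circle_borel = unit_circle"
  by (simp add: circle_borel_def space_restrict_space)

lemma sets_circle_prob: "\<mu> \<in> circle_prob \<Longrightarrow> sets \<mu> = sets circle_borel"
  by (simp add: circle_prob_def)

lemma space_circle_prob: "\<mu> \<in> circle_prob \<Longrightarrow> space \<mu> = unit_circle"
  using sets_eq_imp_space_eq[OF sets_circle_prob] by simp

lemma prob_space_circle_prob: "\<mu> \<in> circle_prob \<Longrightarrow> prob_space \<mu>"
  by (simp add: circle_prob_def)

lemma measurable_circle_borel_iff:
  "f \<in> measurable M circle_borel \<longleftrightarrow> f \<in> borel_measurable M \<and> f \<in> space M \<rightarrow> unit_circle"
  unfolding circle_borel_def by (auto simp: measurable_restrict_space2_iff)

lemma borel_measurable_circle_prob: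
  assumes "\<mu> \<in> circle_prob" "f \<in> borel_measurable borel"
  shows "f \<in> borel_measurable \<mu>"
proof -
  have "f \<in> borel_measurable circle_borel"
    unfolding circle_borel_def using assms(2) by (rule measurable_restrict_space1)
  thus ?thesis using measurable_cong_sets[OF sets_circle_prob[OF assms(1)] refl] by blast
qed

lemma integrable_circle_prob:
  fixes f :: "complex \<Rightarrow> 'b::{banach, second_countable_topology}"
  assumes \<mu>: "\<mu> \<in> circle_prob" and f: "continuous_on unit_circle f"
  shows "integrable \<mu> f"
proof -
  interpret prob_space \<mu> using \<mu> by (rule prob_space_circle_prob)
  have "compact (f ` unit_circle)" by (intro compact_continuous_image f) simp
  then obtain B where B: "\<And>x. x \<in> unit_circle \<Longrightarrow> norm (f x) \<le> B"
    by (meson compact_imp_bounded bounded_iff imageI)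
  have "f \<in> borel_measurable circle_borel"
    unfolding circle_borel_def by (rule borel_measurable_continuous_on_restrict[OF f])
  hence "f \<in> borel_measurable \<mu>"
    using measurable_cong_sets[OF sets_circle_prob[OF \<mu>] refl] by blast
  thus ?thesis
    by (intro integrable_const_bound[where B = B] AE_I2) (auto simp: space_circle_prob[OF \<mu>] intro: B)
qed

lemma integrable_circle_prob_bounded:
  fixes f :: "complex \<Rightarrow> 'b::{banach, second_countable_topology}"
  assumes \<mu>: "\<mu> \<in> circle_prob" and f: "f \<in> borel_measurable borel"
    and B: "\<And>x. x \<in> unit_circle \<Longrightarrow> norm (f x) \<le> B"
  shows "integrable \<mu> f"
proof -
  interpret prob_space \<mu> using \<mu> by (rule prob_space_circle_prob)
  show ?thesis
    using borel_measurable_circle_prob[OF \<mu> f] 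
    by (intro integrable_const_bound[where B = B] AE_I2) (auto simp: space_circle_prob[OF \<mu>] intro: B)
qed

lemma continuous_on_powi_circle [continuous_intros]:
  "continuous_on unit_circle (\<lambda>\<zeta>::complex. \<zeta> powi k)"
  by (cases k rule: int_cases2) (auto simp: power_int_minus intro!: continuous_intros)

lemma integrable_powi: "\<mu> \<in> circle_prob \<Longrightarrow> integrable \<mu> (\<lambda>\<zeta>. \<zeta> powi k)"
  by (intro integrable_circle_prob continuous_intros)

lemma cnj_unit_circle: "\<zeta> \<in> unit_circle \<Longrightarrow> cnj \<zeta> = inverse \<zeta>"
  by (simp add: inverse_complex_def complex_eq_iff cmod_def)

lemma circle_moment_uminus:
  assumes "\<mu> \<in> circle_prob"
  shows "circle_moment \<mu> (- k) = cnj (circle_moment \<mu> k)"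
proof -
  have "cnj (circle_moment \<mu> k) = (\<integral>\<zeta>. cnj (\<zeta> powi k) \<partial>\<mu>)"
    unfolding circle_moment_def by (rule Bochner_Integration.integral_cnj[symmetric])
  also have "\<dots> = circle_moment \<mu> (- k)" unfolding circle_moment_def
    by (intro Bochner_Integration.integral_cong refl)
       (auto simp: space_circle_prob[OF assms] cnj_unit_circle power_int_minus power_int_inverse
           complex_cnj_power_int)
  finally show ?thesis ..
qed

lemma circle_moment_0: "\<mu> \<in> circle_prob \<Longrightarrow> circle_moment \<mu> 0 = 1"
  unfolding circle_moment_def using prob_space.prob_space[OF prob_space_circle_prob] by simp

lemma norm_circle_moment_le_1:
  assumes "\<mu> \<in> circle_prob"
  shows "norm (circle_moment \<mu> k) \<le> 1"
proof -
  interpret prob_space \<mu> using assms by (rule prob_space_circle_prob)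
  have "norm (circle_moment \<mu> k) \<le> (\<integral>\<zeta>. norm (\<zeta> powi k) \<partial>\<mu>)"
    unfolding circle_moment_def by (rule integral_norm_bound)
  also have "\<dots> = (\<integral>\<zeta>. 1 \<partial>\<mu>)"
    by (intro Bochner_Integration.integral_cong refl)
       (auto simp: space_circle_prob[OF assms] norm_power_int)
  finally show ?thesis by (simp add: prob_space)
qed

section \<open>Moments determine measures and weak convergence\<close>

inductive trig_poly :: "(complex \<Rightarrow> complex) \<Rightarrow> bool" where
  monomial: "trig_poly (\<lambda>\<zeta>. c * \<zeta> powi k)"
| add: "trig_poly f \<Longrightarrow> trig_poly g \<Longrightarrow> trig_poly (\<lambda>\<zeta>. f \<zeta> + g \<zeta>)"

lemma trig_poly_continuous_on: "trig_poly f \<Longrightarrow> continuous_on unit_circle f"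
  by (induction rule: trig_poly.induct) (auto intro!: continuous_intros)

lemma trig_poly_mult:
  assumes "trig_poly f" "trig_poly g"
  shows "\<exists>h. trig_poly h \<and> (\<forall>\<zeta> \<in> unit_circle. h \<zeta> = f \<zeta> * g \<zeta>)"
  using assms
proof (induction arbitrary: g rule: trig_poly.induct)
  case (monomial c k)
  from monomial.prems show ?case
  proof (induction rule: trig_poly.induct)
    case (monomial d l)
    have "trig_poly (\<lambda>\<zeta>. (c * d) * \<zeta> powi (k + l))" by (rule trig_poly.monomial)
    moreover have "\<zeta> powi (k + l) = \<zeta> powi k * \<zeta> powi l" if "\<zeta> \<in> unit_circle" for \<zeta> :: complex
      using that by (intro power_int_add) auto
    ultimately show ?case
      by (intro exI[of _ "\<lambda>\<zeta>. (c * d) * \<zeta> powi (k + l)"]) auto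
  next
    case (add f g)
    then obtain h1 h2 where "trig_poly h1" "trig_poly h2"
      "\<forall>\<zeta>\<in>unit_circle. h1 \<zeta> = c * \<zeta> powi k * f \<zeta>" "\<forall>\<zeta>\<in>unit_circle. h2 \<zeta> = c * \<zeta> powi k * g \<zeta>" by blast
    thus ?case
      by (intro exI[of _ "\<lambda>\<zeta>. h1 \<zeta> + h2 \<zeta>"]) (simp add: ring_distribs trig_poly.add)
  qed
next
  case (add f f')
  obtain h1 where "trig_poly h1" "\<forall>\<zeta>\<in>unit_circle. h1 \<zeta> = f \<zeta> * g \<zeta>"
    using add.IH(1)[OF add.prems] by blast
  moreover obtain h2 where "trig_poly h2" "\<forall>\<zeta>\<in>unit_circle. h2 \<zeta> = f' \<zeta> * g \<zeta>"
    using add.IH(2)[OF add.prems] by blast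
  ultimately show ?case
    by (intro exI[of _ "\<lambda>\<zeta>. h1 \<zeta> + h2 \<zeta>"]) (simp add: ring_distribs trig_poly.add)
qed

text \<open>On the circle \<open>Re \<zeta> = (\<zeta> + 1/\<zeta>) / 2\<close> and \<open>Im \<zeta> = (\<zeta> - 1/\<zeta>) / 2\<i>\<close>, so that Stone--Weierstrass
  for polynomials in two real variables becomes density of the trigonometric polynomials.\<close>

lemma real_polynomial_function_trig_poly:
  assumes "real_polynomial_function p"
  shows "\<exists>h. trig_poly h \<and> (\<forall>\<zeta> \<in> unit_circle. h \<zeta> = of_real (p \<zeta>))"
  using assms
proof (induction rule: real_polynomial_function.induct)
  case (linear f)
  interpret bounded_linear f by fact
  define a b where "a = complex_of_real (f 1) / 2" and "b = complex_of_real (f \<i>) / (2 * \<i>)"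
  let ?h = "\<lambda>\<zeta>. (a + b) * \<zeta> powi 1 + (a - b) * \<zeta> powi (-1)"
  have "?h \<zeta> = of_real (f \<zeta>)" if "\<zeta> \<in> unit_circle" for \<zeta>
  proof -
    have "\<zeta> = Re \<zeta> *\<^sub>R 1 + Im \<zeta> *\<^sub>R \<i>" by (simp add: complex_eq_iff)
    hence *: "f \<zeta> = Re \<zeta> * f 1 + Im \<zeta> * f \<i>" by (metis add scaleR real_scaleR_def)
    have "\<zeta> powi (- 1) = cnj \<zeta>" using cnj_unit_circle[OF that] by (simp add: power_int_minus)
    hence "?h \<zeta> = a * (\<zeta> + cnj \<zeta>) + b * (\<zeta> - cnj \<zeta>)" by (simp add: algebra_simps)
    also have "\<dots> = of_real (f \<zeta>)"
      unfolding complex_add_cnj complex_diff_cnj by (simp add: a_def b_def * field_simps)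
    finally show ?thesis .
  qed
  moreover have "trig_poly ?h" by (intro trig_poly.intros)
  ultimately show ?case by blast
next
  case (const c)
  have "trig_poly (\<lambda>\<zeta>. of_real c * \<zeta> powi 0)" by (rule trig_poly.monomial)
  thus ?case by (intro exI[of _ "\<lambda>\<zeta>. of_real c * \<zeta> powi 0"]) auto
next
  case (add f g)
  then obtain h1 h2 where "trig_poly h1" "trig_poly h2"
     "\<forall>\<zeta>\<in>unit_circle. h1 \<zeta> = of_real (f \<zeta>)" "\<forall>\<zeta>\<in>unit_circle. h2 \<zeta> = of_real (g \<zeta>)" by blast
  thus ?case by (intro exI[of _ "\<lambda>\<zeta>. h1 \<zeta> + h2 \<zeta>"]) (auto intro: trig_poly.add)
next
  case (mult f g)
  then obtain h1 h2 where h: "trig_poly h1" "trig_poly h2"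
     "\<forall>\<zeta>\<in>unit_circle. h1 \<zeta> = of_real (f \<zeta>)" "\<forall>\<zeta>\<in>unit_circle. h2 \<zeta> = of_real (g \<zeta>)" by blast
  from trig_poly_mult[OF h(1,2)] h(3,4) show ?case by auto
qed

lemma trig_poly_dense:
  fixes f :: "complex \<Rightarrow> real"
  assumes f: "continuous_on unit_circle f" and e: "e > 0"
  shows "\<exists>h. trig_poly h \<and> (\<forall>\<zeta> \<in> unit_circle. \<bar>Re (h \<zeta>) - f \<zeta>\<bar> < e)"
proof -
  obtain p where p: "real_polynomial_function p" "\<And>x. x \<in> unit_circle \<Longrightarrow> \<bar>f x - p x\<bar> < e"
    using Stone_Weierstrass_real_polynomial_function[OF _ f e] by auto
  obtain h where h: "trig_poly h" "\<forall>\<zeta> \<in> unit_circle. h \<zeta> = of_real (p \<zeta>)"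
    using real_polynomial_function_trig_poly[OF p(1)] by blast
  have "\<bar>Re (h \<zeta>) - f \<zeta>\<bar> < e" if "\<zeta> \<in> unit_circle" for \<zeta>
    using p(2)[OF that] h(2) that by (simp add: abs_minus_commute)
  thus ?thesis using h(1) by blast
qed

lemma trig_poly_integral_tendsto:
  assumes \<nu>: "\<forall>\<^sub>F n in sequentially. \<nu> n \<in> circle_prob" and \<mu>: "\<mu> \<in> circle_prob"
    and lim: "\<And>k. (\<lambda>n. circle_moment (\<nu> n) k) \<longlonglongrightarrow> circle_moment \<mu> k"
    and h: "trig_poly h"
  shows "(\<lambda>n. \<integral>\<zeta>. h \<zeta> \<partial>\<nu> n) \<longlonglongrightarrow> (\<integral>\<zeta>. h \<zeta> \<partial>\<mu>)"
  using h
proof (induction rule: trig_poly.induct)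
  case (monomial c k)
  have "(\<lambda>n. c * circle_moment (\<nu> n) k) \<longlonglongrightarrow> c * circle_moment \<mu> k"
    by (intro tendsto_intros lim)
  thus ?case by (simp add: circle_moment_def)
next
  case (add f g)
  have *: "(\<integral>\<zeta>. f \<zeta> + g \<zeta> \<partial>\<rho>) = (\<integral>\<zeta>. f \<zeta> \<partial>\<rho>) + (\<integral>\<zeta>. g \<zeta> \<partial>\<rho>)" if "\<rho> \<in> circle_prob" for \<rho>
    using that add.hyps by (intro Bochner_Integration.integral_add integrable_circle_prob
        trig_poly_continuous_on)
  have "\<forall>\<^sub>F n in sequentially. (\<integral>\<zeta>. f \<zeta> \<partial>\<nu> n) + (\<integral>\<zeta>. g \<zeta> \<partial>\<nu> n) = (\<integral>\<zeta>. f \<zeta> + g \<zeta> \<partial>\<nu> n)"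
    using \<nu> by eventually_elim (simp add: *)
  moreover have "(\<lambda>n. (\<integral>\<zeta>. f \<zeta> \<partial>\<nu> n) + (\<integral>\<zeta>. g \<zeta> \<partial>\<nu> n)) \<longlonglongrightarrow> (\<integral>\<zeta>. f \<zeta> + g \<zeta> \<partial>\<mu>)"
    unfolding *[OF \<mu>] by (intro tendsto_add add.IH)
  ultimately show ?case by (rule Lim_transform_eventually[rotated])
qed

lemma circle_weak_conv_if_moments:
  assumes \<nu>: "\<forall>\<^sub>F n in sequentially. \<nu> n \<in> circle_prob" and \<mu>: "\<mu> \<in> circle_prob"
    and lim: "\<And>k. (\<lambda>n. circle_moment (\<nu> n) k) \<longlonglongrightarrow> circle_moment \<mu> k"
  shows "circle_weak_conv \<nu> \<mu>"
  unfolding circle_weak_conv_def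
proof (intro allI impI)
  fix f :: "complex \<Rightarrow> real" assume f: "continuous_on unit_circle f"
  show "(\<lambda>n. \<integral>\<zeta>. f \<zeta> \<partial>\<nu> n) \<longlonglongrightarrow> (\<integral>\<zeta>. f \<zeta> \<partial>\<mu>)"
  proof (rule LIMSEQ_I)
    fix e :: real assume e: "e > 0"
    obtain h where h: "trig_poly h" "\<And>\<zeta>. \<zeta> \<in> unit_circle \<Longrightarrow> \<bar>Re (h \<zeta>) - f \<zeta>\<bar> < e / 3"
      using trig_poly_dense[OF f, of "e / 3"] e by auto
    have approx: "\<bar>(\<integral>\<zeta>. f \<zeta> \<partial>\<rho>) - Re (\<integral>\<zeta>. h \<zeta> \<partial>\<rho>)\<bar> \<le> e / 3" if \<rho>: "\<rho> \<in> circle_prob" for \<rho>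
    proof -
      interpret prob_space \<rho> using \<rho> by (rule prob_space_circle_prob)
      have ih: "integrable \<rho> h" by (intro integrable_circle_prob trig_poly_continuous_on h \<rho>)
      have if': "integrable \<rho> f" by (intro integrable_circle_prob f \<rho>)
      have "\<bar>(\<integral>\<zeta>. f \<zeta> \<partial>\<rho>) - Re (\<integral>\<zeta>. h \<zeta> \<partial>\<rho>)\<bar> = \<bar>\<integral>\<zeta>. f \<zeta> - Re (h \<zeta>) \<partial>\<rho>\<bar>"
        using ih if' by (simp add: integral_Re)
      also have "\<dots> \<le> (\<integral>\<zeta>. \<bar>f \<zeta> - Re (h \<zeta>)\<bar> \<partial>\<rho>)" by (rule integral_abs_bound)
      also have "\<dots> \<le> (\<integral>\<zeta>. e / 3 \<partial>\<rho>)"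
        using ih if' by (intro integral_mono_AE AE_I2) (use h(2) space_circle_prob[OF \<rho>] in \<open>auto
            simp: abs_minus_commute intro: less_imp_le\<close>)
      finally show ?thesis by (simp add: prob_space)
    qed
    have "(\<lambda>n. Re (\<integral>\<zeta>. h \<zeta> \<partial>\<nu> n)) \<longlonglongrightarrow> Re (\<integral>\<zeta>. h \<zeta> \<partial>\<mu>)"
      by (intro tendsto_Re trig_poly_integral_tendsto[OF \<nu> \<mu> lim h(1)])
    hence "\<forall>\<^sub>F n in sequentially. \<bar>Re (\<integral>\<zeta>. h \<zeta> \<partial>\<nu> n) - Re (\<integral>\<zeta>. h \<zeta> \<partial>\<mu>)\<bar> < e / 3"
      using e by (auto simp: dist_real_def dest: tendstoD[of _ _ _ "e / 3"])
    hence "\<forall>\<^sub>F n in sequentially. \<bar>(\<integral>\<zeta>. f \<zeta> \<partial>\<nu> n) - (\<integral>\<zeta>. f \<zeta> \<partial>\<mu>)\<bar> < e"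
      using \<nu>
    proof eventually_elim
      case (elim n)
      from approx[OF elim(2)] approx[OF \<mu>] elim(1) show ?case by linarith
    qed
    thus "\<exists>no. \<forall>n\<ge>no. norm ((\<integral>\<zeta>. f \<zeta> \<partial>\<nu> n) - (\<integral>\<zeta>. f \<zeta> \<partial>\<mu>)) < e"
      by (simp add: eventually_sequentially)
  qed
qed

lemma circle_weak_conv_imp_moments:
  assumes \<nu>: "\<forall>\<^sub>F n in sequentially. \<nu> n \<in> circle_prob" and \<mu>: "\<mu> \<in> circle_prob"
    and conv: "circle_weak_conv \<nu> \<mu>"
  shows "(\<lambda>n. circle_moment (\<nu> n) k) \<longlonglongrightarrow> circle_moment \<mu> k"
proof -
  have "(\<lambda>n. \<integral>\<zeta>. Re (\<zeta> powi k) \<partial>\<nu> n) \<longlonglongrightarrow> (\<integral>\<zeta>. Re (\<zeta> powi k) \<partial>\<mu>)"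
       "(\<lambda>n. \<integral>\<zeta>. Im (\<zeta> powi k) \<partial>\<nu> n) \<longlonglongrightarrow> (\<integral>\<zeta>. Im (\<zeta> powi k) \<partial>\<mu>)"
    using conv unfolding circle_weak_conv_def by (auto intro!: continuous_intros)
  hence "(\<lambda>n. Complex (\<integral>\<zeta>. Re (\<zeta> powi k) \<partial>\<nu> n) (\<integral>\<zeta>. Im (\<zeta> powi k) \<partial>\<nu> n))
     \<longlonglongrightarrow> Complex (\<integral>\<zeta>. Re (\<zeta> powi k) \<partial>\<mu>) (\<integral>\<zeta>. Im (\<zeta> powi k) \<partial>\<mu>)"
    by (rule tendsto_Complex)
  moreover have *: "Complex (\<integral>\<zeta>. Re (\<zeta> powi k) \<partial>\<rho>) (\<integral>\<zeta>. Im (\<zeta> powi k) \<partial>\<rho>) = circle_moment \<rho> k"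
    if "\<rho> \<in> circle_prob" for \<rho>
    using integrable_powi[OF that] by (simp add: complex_eq_iff circle_moment_def)
  have "\<forall>\<^sub>F n in sequentially. Complex (\<integral>\<zeta>. Re (\<zeta> powi k) \<partial>\<nu> n) (\<integral>\<zeta>. Im (\<zeta> powi k) \<partial>\<nu> n) =
      circle_moment (\<nu> n) k"
    using \<nu> by eventually_elim (rule *)
  ultimately show ?thesis unfolding *[OF \<mu>] by (rule Lim_transform_eventually)
qed

lemma integral_eq_if_moments_eq:
  fixes f :: "complex \<Rightarrow> real"
  assumes \<mu>: "\<mu> \<in> circle_prob" and \<nu>: "\<nu> \<in> circle_prob"
    and eq: "\<And>k. circle_moment \<mu> k = circle_moment \<nu> k" and f: "continuous_on unit_circle f"
  shows "(\<integral>\<zeta>. f \<zeta> \<partial>\<mu>) = (\<integral>\<zeta>. f \<zeta> \<partial>\<nu>)"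
proof -
  have "circle_weak_conv (\<lambda>_. \<mu>) \<nu>"
    by (rule circle_weak_conv_if_moments) (auto simp: \<mu> \<nu> eq)
  thus ?thesis using f by (auto simp: circle_weak_conv_def dest: LIMSEQ_unique[OF tendsto_const])
qed

text \<open>The indicator of a closed set is a decreasing limit of continuous functions, and closed sets
  form an intersection stable generator of the Borel sets.\<close>

lemma circle_prob_eqI:
  assumes \<mu>: "\<mu> \<in> circle_prob" and \<nu>: "\<nu> \<in> circle_prob"
    and eq: "\<And>k::nat. circle_moment \<mu> (int k) = circle_moment \<nu> (int k)"
  shows "\<mu> = \<nu>"
proof -
  interpret M: prob_space \<mu> using \<mu> by (rule prob_space_circle_prob)
  interpret N: prob_space \<nu> using \<nu> by (rule prob_space_circle_prob)
  have eq': "circle_moment \<mu> k = circle_moment \<nu> k" for k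
    using eq[of "nat k"] eq[of "nat (-k)"] circle_moment_uminus[OF \<mu>, of "-k"]
        circle_moment_uminus[OF \<nu>, of "-k"]
    by (cases "k \<ge> 0") auto
  have closed_eq: "emeasure \<mu> C = emeasure \<nu> C" if C: "closed C" "C \<subseteq> unit_circle" for C
  proof (cases "C = {}")
    case False
    define f where "f n \<zeta> = max 0 (1 - real n * infdist \<zeta> C)" for n \<zeta>
    have fc: "continuous_on unit_circle (f n)" for n
      unfolding f_def by (intro continuous_intros)
    have lim: "(\<lambda>n. f n \<zeta>) \<longlonglongrightarrow> indicator C \<zeta>" for \<zeta>
    proof (cases "\<zeta> \<in> C")
      case True thus ?thesis by (simp add: f_def)
    next
      case notin: False
      hence pos: "infdist \<zeta> C > 0"
        using C(1) False by (metis in_closed_iff_infdist_zero infdist_nonneg less_eq_real_def)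
      obtain N :: nat where N: "1 < real N * infdist \<zeta> C" using pos reals_Archimedean3 by blast
      have "\<forall>\<^sub>F n in sequentially. f n \<zeta> = 0"
        using eventually_ge_at_top[of N]
      proof eventually_elim
        case (elim n)
        have "real N * infdist \<zeta> C \<le> real n * infdist \<zeta> C" using elim pos by simp
        thus ?case using N by (simp add: f_def)
      qed
      thus ?thesis using notin by (simp add: tendsto_eventually)
    qed
    have conv: "(\<lambda>n. \<integral>\<zeta>. f n \<zeta> \<partial>\<rho>) \<longlonglongrightarrow> measure \<rho> C" if \<rho>: "\<rho> \<in> circle_prob" for \<rho>
    proof -
      interpret R: prob_space \<rho> using \<rho> by (rule prob_space_circle_prob)
      have Cs: "C \<in> sets \<rho>"
        using C by (auto simp: sets_circle_prob[OF \<rho>] circle_borel_def sets_restrict_space_iff)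
      have "(\<lambda>n. \<integral>\<zeta>. f n \<zeta> \<partial>\<rho>) \<longlonglongrightarrow> (\<integral>\<zeta>. indicator C \<zeta> \<partial>\<rho>)"
      proof (rule integral_dominated_convergence[where w = "\<lambda>_. 1"])
        show "f n \<in> borel_measurable \<rho>" for n
          using integrable_circle_prob[OF \<rho> fc] by (rule borel_measurable_integrable)
        show "AE x in \<rho>. norm (f n x) \<le> 1" for n
          by (intro AE_I2) (auto simp: f_def infdist_nonneg)
        show "AE x in \<rho>. (\<lambda>n. f n x) \<longlonglongrightarrow> indicator C x" using lim by simp
      qed (use Cs in auto)
      thus ?thesis using Cs by simp
    qed
    have "measure \<mu> C = measure \<nu> C"
      using conv[OF \<mu>] conv[OF \<nu>] integral_eq_if_moments_eq[OF \<mu> \<nu> eq' fc]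
      by (simp add: LIMSEQ_unique)
    thus ?thesis by (simp add: M.emeasure_eq_measure N.emeasure_eq_measure)
  qed auto
  have id: "(\<lambda>x. x) \<in> borel_measurable \<mu>" "(\<lambda>x. x) \<in> borel_measurable \<nu>"
    using \<mu> \<nu> by (auto intro: borel_measurable_circle_prob)
  have *: "emeasure (distr \<rho> borel (\<lambda>x. x)) B = emeasure \<rho> (unit_circle \<inter> B)"
    if "\<rho> \<in> circle_prob" "B \<in> sets borel" for \<rho> B
    using that by (subst emeasure_distr) (auto simp: borel_measurable_circle_prob space_circle_prob
        Int_commute)
  have distr_eq: "distr \<mu> borel (\<lambda>x. x) = distr \<nu> borel (\<lambda>x. x)"
  proof (rule measure_eqI_generator_eq[where E = "Collect closed" and \<Omega> = UNIV and A = "\<lambda>_. UNIV"])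
    show "Int_stable (Collect closed :: complex set set)" by (auto simp: Int_stable_def)
    show "emeasure (distr \<mu> borel (\<lambda>x. x)) C = emeasure (distr \<nu> borel (\<lambda>x. x)) C"
      if "C \<in> Collect closed" for C
      using that by (auto simp: * \<mu> \<nu> intro!: closed_eq closed_Int)
    show "emeasure (distr \<mu> borel (\<lambda>x. x)) UNIV \<noteq> \<infinity>" for i :: nat
      by (simp add: * \<mu> M.emeasure_eq_measure)
  qed (auto simp: borel_eq_closed sets_measure_of)
  show ?thesis
  proof (rule measure_eqI)
    show "sets \<mu> = sets \<nu>" using \<mu> \<nu> by (simp add: sets_circle_prob)
    fix A assume "A \<in> sets \<mu>"
    then obtain B where B: "B \<in> sets borel" "A = unit_circle \<inter> B"
      by (auto simp: sets_circle_prob[OF \<mu>] circle_borel_def sets_restrict_space)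
    show "emeasure \<mu> A = emeasure \<nu> A"
      using distr_eq *[OF \<mu> B(1)] *[OF \<nu> B(1)] B(2) by simp
  qed
qed

section \<open>Existence of measures with prescribed moments\<close>

lemma borel_measurable_Arg [measurable]: "Arg \<in> borel_measurable borel"
proof -
  have "Arg = (\<lambda>z. if z \<in> {0} then 0 else if z \<in> \<real>\<^sub>\<le>\<^sub>0 then pi else Arg z)"
    by (auto simp: fun_eq_iff complex_nonpos_Reals_iff Arg_eq_pi Arg_zero complex_eq_iff)
       (metis Arg_zero complex_eqI zero_complex.simps)
  also have "\<dots> \<in> borel_measurable borel"
  proof (rule measurable_If_set)
    show "(\<lambda>z. if z \<in> \<real>\<^sub>\<le>\<^sub>0 then pi else Arg z) \<in> borel_measurable borel"
      by (intro borel_measurable_continuous_on_if continuous_on_const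
            continuous_at_imp_continuous_on ballI continuous_within_Arg)
         (auto intro: borel_closed)
  qed auto
  finally show ?thesis .
qed

lemma distr_circle_borel_circle_prob:
  assumes "prob_space M" "f \<in> measurable M circle_borel"
  shows "distr M circle_borel f \<in> circle_prob"
  using prob_space.prob_space_distr[OF assms] by (simp add: circle_prob_def)

lemma cis_measurable_circle_borel [measurable]: "cis \<in> measurable borel circle_borel"
  unfolding measurable_circle_borel_iff
  by (auto intro!: borel_measurable_continuous_onI continuous_intros)

lemma circle_moment_distr:
  assumes "f \<in> measurable M circle_borel"
  shows "circle_moment (distr M circle_borel f) k = (\<integral>x. f x powi k \<partial>M)"
proof -
  have "(\<lambda>\<zeta>. \<zeta> powi k) \<in> borel_measurable circle_borel"
    unfolding circle_borel_def by (rule borel_measurable_continuous_on_restrict[OF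
        continuous_on_powi_circle])
  thus ?thesis unfolding circle_moment_def using assms by (subst integral_distr) auto
qed

lemma cis_powi: "cis x powi k = cis (of_int k * x)"
  by (cases k rule: int_cases2) (auto simp: power_int_minus Complex.DeMoivre cis_inverse mult.commute)

text \<open>Compactness of the circle: arguments turn measures on the circle into a tight sequence of
  measures on the line, and a weak limit of the latter is wrapped around the circle again. The
  wrapping map is continuous, so that it does not matter where the argument jumps.\<close>

lemma circle_moment_limit:
  assumes \<nu>: "\<And>N. \<nu> N \<in> circle_prob"
    and lim: "\<And>k::nat. (\<lambda>N. circle_moment (\<nu> N) (int k)) \<longlonglongrightarrow> a k"
  shows "\<exists>\<rho>\<in>circle_prob. \<forall>k::nat. circle_moment \<rho> (int k) = a k"
proof -
  have Arg_m: "Arg \<in> borel_measurable (\<nu> N)" for N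
    by (rule borel_measurable_circle_prob[OF \<nu> borel_measurable_Arg])
  define M where "M N = distr (\<nu> N) borel Arg" for N
  have rd: "real_distribution (M N)" for N
    unfolding M_def by (rule prob_space.real_distribution_distr[OF prob_space_circle_prob[OF \<nu>] Arg_m])
  have "measure (M N) {-pi<..pi} = 1" for N
  proof -
    interpret prob_space "\<nu> N" using \<nu> by (rule prob_space_circle_prob)
    have "Arg -` {-pi<..pi} \<inter> space (\<nu> N) = space (\<nu> N)" using Arg_bounded by auto
    thus ?thesis unfolding M_def by (subst measure_distr[OF Arg_m]) (auto simp: prob_space)
  qed
  hence "tight M" unfolding tight_def using rd
    by (intro conjI allI impI exI[of _ "-pi"] exI[of _ pi]) auto
  then obtain r M' where r: "strict_mono (r :: nat \<Rightarrow> nat)" "real_distribution M'" "weak_conv_m (M \<circ>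
      id \<circ> r) M'"
    using tight_imp_convergent_subsubsequence[of M id] by (auto simp: strict_mono_def)
  interpret M': real_distribution M' by fact
  have cis_m: "cis \<in> measurable M' circle_borel" using M'.events_eq_borel by measurable
  have "circle_moment (distr M' circle_borel cis) (int k) = a k" for k
  proof -
    have "(\<lambda>n. \<integral>x. cis (int k * x) \<partial>(M \<circ> id \<circ> r) n) \<longlonglongrightarrow> (\<integral>x. cis (int k * x) \<partial>M')"
      using r(2,3) rd
      by (intro weak_conv_imp_integral_bdd_continuous_conv[where B = 1] allI)
         (auto simp: comp_def cis_conv_exp intro!: continuous_intros)
    moreover have "(\<integral>x. cis (int k * x) \<partial>(M \<circ> id \<circ> r) n) = circle_moment (\<nu> (r n)) (int k)" for n
    proof -
      have "(\<integral>x. cis (int k * x) \<partial>(M \<circ> id \<circ> r) n) = (\<integral>\<zeta>. cis (int k * Arg \<zeta>) \<partial>\<nu> (r n))"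
        unfolding M_def comp_def id_def using Arg_m
        by (intro integral_distr) (auto intro!: borel_measurable_continuous_onI continuous_intros)
      also have "\<dots> = circle_moment (\<nu> (r n)) (int k)" unfolding circle_moment_def
        by (intro Bochner_Integration.integral_cong refl, subst cis_powi[symmetric], subst cis_Arg)
           (auto simp: space_circle_prob[OF \<nu>] sgn_eq)
      finally show ?thesis .
    qed
    moreover have "(\<integral>x. cis (int k * x) \<partial>M') = circle_moment (distr M' circle_borel cis) (int k)"
      by (subst circle_moment_distr[OF cis_m]) (simp only: cis_powi of_int_of_nat_eq)
    ultimately have "(\<lambda>n. circle_moment (\<nu> (r n)) (int k)) \<longlonglongrightarrow> circle_moment (distr M' circle_borel
        cis) (int k)"
      by simp
    moreover have "(\<lambda>n. circle_moment (\<nu> (r n)) (int k)) \<longlonglongrightarrow> a k"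
      using LIMSEQ_subseq_LIMSEQ[OF lim r(1), of k] by (simp add: comp_def)
    ultimately show ?thesis by (rule LIMSEQ_unique)
  qed
  moreover have "distr M' circle_borel cis \<in> circle_prob"
    by (rule distr_circle_borel_circle_prob[OF _ cis_m]) unfold_locales
  ultimately show ?thesis by blast
qed

text \<open>The parametrization \<open>cis (- x)\<close> makes the \<open>k\<close>-th moment equal to the \<open>k\<close>-th Fourier
  coefficient of the density.\<close>

lemma circle_prob_of_density:
  fixes g :: "real \<Rightarrow> real"
  assumes g: "continuous_on {0..2*pi} g" "\<And>x. x \<in> {0..2*pi} \<Longrightarrow> g x \<ge> 0"
    and int: "(g has_integral 2 * pi) {0..2*pi}"
  shows "\<exists>\<nu>\<in>circle_prob. \<forall>k. circle_moment \<nu> k = integral {0..2*pi} (\<lambda>x. of_real (g x) * cis (-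
      (of_int k * x))) / (2 * pi)"
proof -
  define d where "d x = indicator {0..2*pi} x * g x / (2 * pi)" for x
  define P where "P = density lborel (\<lambda>x. ennreal (d x))"
  have gi: "set_integrable lborel {0..2*pi} g" using g(1) by (rule borel_integrable_atLeastAtMost')
  have d0: "d x \<ge> 0" for x using g(2) by (auto simp: d_def indicator_def)
  have di: "integrable lborel d"
    using gi unfolding set_integrable_def d_def by (auto simp: mult.assoc intro!: integrable_divide)
  have "(LINT x|lborel. d x) = (LINT x:{0..2*pi}|lborel. g x) / (2 * pi)"
    by (simp add: set_lebesgue_integral_def d_def)
  also have "\<dots> = 1"
    using set_borel_integral_eq_integral(2)[OF gi] int by (simp add: integral_unique)
  finally have d1: "(LINT x|lborel. d x) = 1" .
  have P: "prob_space P"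
  proof (rule prob_spaceI)
    have "emeasure P (space P) = (\<integral>\<^sup>+ x. ennreal (d x) \<partial>lborel)"
      using di by (simp add: P_def emeasure_density nn_integral_set_ennreal)
    also have "\<dots> = ennreal (LINT x|lborel. d x)"
      by (rule nn_integral_eq_integral[OF di]) (use d0 in auto)
    finally show "emeasure P (space P) = 1" using d1 by simp
  qed
  have m: "(\<lambda>x. cis (- x)) \<in> measurable P circle_borel"
    unfolding measurable_circle_borel_iff P_def
    by (auto intro!: borel_measurable_continuous_onI continuous_intros)
  have "circle_moment (distr P circle_borel (\<lambda>x. cis (- x))) k
      = integral {0..2*pi} (\<lambda>x. of_real (g x) * cis (- (of_int k * x))) / (2 * pi)" for k
  proof -
    have c: "continuous_on {0..2*pi} (\<lambda>x. complex_of_real (g x) * cis (- (of_int k * x)))"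
      by (intro continuous_intros g)
    have "circle_moment (distr P circle_borel (\<lambda>x. cis (- x))) k = (\<integral>x. cis (- (of_int k * x)) \<partial>P)"
      by (subst circle_moment_distr[OF m]) (simp add: cis_powi)
    also have "\<dots> = (\<integral>x. d x *\<^sub>R cis (- (of_int k * x)) \<partial>lborel)"
      unfolding P_def using d0 di
      by (intro integral_density) (auto intro!: borel_measurable_continuous_onI continuous_intros)
    also have "\<dots> = (\<integral>x. (indicator {0..2*pi} x *\<^sub>R (complex_of_real (g x) * cis (- (of_int k * x))))
        / (2 * pi) \<partial>lborel)"
      by (intro Bochner_Integration.integral_cong refl) (auto simp: d_def indicator_def
          scaleR_conv_of_real)
    also have "\<dots> = (LINT x:{0..2*pi}|lborel. complex_of_real (g x) * cis (- (of_int k * x))) / (2 * pi)"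
      by (simp add: set_lebesgue_integral_def)
    also have "\<dots> = integral {0..2*pi} (\<lambda>x. of_real (g x) * cis (- (of_int k * x))) / (2 * pi)"
      using set_borel_integral_eq_integral(2)[OF borel_integrable_atLeastAtMost'[OF c]] by simp
    finally show ?thesis .
  qed
  thus ?thesis using distr_circle_borel_circle_prob[OF P m] by blast
qed

lemma has_integral_cis_int:
  "((\<lambda>x. cis (of_int n * x)) has_integral (if n = 0 then 2 * pi else 0)) {0..2*pi}"
proof (cases "n = 0")
  case True
  have "((\<lambda>x::real. 1 :: complex) has_integral ((2 * pi - 0) *\<^sub>R 1)) {0..2*pi}"
    using has_integral_const_real[of "1::complex" 0 "2*pi"] by simp
  thus ?thesis using True by (simp add: scaleR_conv_of_real)
next
  case False
  have "((\<lambda>x. cis (of_int n * x)) has_integral (cis (of_int n * (2 * pi)) / (\<i> * of_int n) - cis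
      (of_int n * 0) / (\<i> * of_int n))) {0..2*pi}"
  proof (intro fundamental_theorem_of_calculus)
    fix x assume "x \<in> {0..2*pi}"
    have "((\<lambda>x. cis (of_int n * x) / (\<i> * of_int n)) has_vector_derivative (of_int n *\<^sub>R (\<i> * cis
        (of_int n * x)) / (\<i> * of_int n))) (at x within {0..2*pi})"
      unfolding cis_conv_exp
      by (auto intro!: derivative_eq_intros has_vector_derivative_real_field simp:
          scaleR_conv_of_real) (simp add: algebra_simps)
    thus "((\<lambda>x. cis (of_int n * x) / (\<i> * of_int n)) has_vector_derivative cis (of_int n * x)) (at x
        within {0..2*pi})"
      using False by (simp add: scaleR_conv_of_real)
  qed auto
  moreover have "cis (of_int n * (2 * pi)) = 1"
    using cis_multiple_2pi[of "of_int n"] by (simp add: mult.commute)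
  ultimately show ?thesis using False by simp
qed

text \<open>The number of pairs that contribute to the \<open>m\<close>-th coefficient of a Cesaro mean.\<close>

lemma card_shifted_diagonal:
  "card {p \<in> {..<N} \<times> {..<N}. fst p = snd p + m} = N - (m::nat)"
proof -
  have "{p \<in> {..<N} \<times> {..<N}. fst p = snd p + m} = (\<lambda>j. (j + m, j)) ` {..<N - m}"
    by (auto simp: image_iff)
  thus ?thesis by (simp add: card_image inj_on_def)
qed

text \<open>The Cesaro means of the Fourier series with coefficients \<open>a\<close> are nonnegative by positive
  definiteness. The measure whose density is the mean of order \<open>N\<close> has moments \<open>(1 - k/N) a\<^sub>k\<close> for
  \<open>0 \<le> k \<le> N\<close>, and \<open>N \<longlonglongrightarrow> \<infinity>\<close>.\<close>

lemma herglotz_positive_definite: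
  fixes a :: "int \<Rightarrow> complex"
  assumes pos: "\<And>N c. (\<Sum>j<N. \<Sum>k<N. a (int j - int k) * c j * cnj (c k)) \<in> \<real>\<^sub>\<ge>\<^sub>0"
    and a0: "a 0 = 1"
  shows "\<exists>\<rho>\<in>circle_prob. \<forall>k::nat. circle_moment \<rho> (int k) = a (int k)"
proof -
  define f where "f N x = (\<Sum>j<Suc N. \<Sum>k<Suc N. a (int j - int k) * cis (real j * x) * cnj (cis (real
      k * x)))" for N x
  have f_pos: "f N x \<in> \<real>\<^sub>\<ge>\<^sub>0" for N x
    unfolding f_def using pos[where N = "Suc N" and c = "\<lambda>j. cis (real j * x)"] by simp
  define g where "g N x = Re (f N x) / real (Suc N)" for N x
  have g_eq: "complex_of_real (g N x) = f N x / of_nat (Suc N)" for N x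
    using f_pos[of N x] by (auto simp: g_def nonneg_Reals_def)
  have integral_g: "((\<lambda>x. complex_of_real (g N x) * cis (- (of_int (int m) * x))) has_integral
        (2 * pi * of_nat (Suc N - m) / of_nat (Suc N) * a (int m))) {0..2*pi}" for N m
  proof -
    let ?I = "\<lambda>j k. (if int j - int k - int m = 0 then 2 * pi else 0) :: complex"
    have "((\<lambda>x. (\<Sum>j<Suc N. \<Sum>k<Suc N. a (int j - int k) * cis (of_int (int j - int k - int m) * x)) /
        of_nat (Suc N))
      has_integral ((\<Sum>j<Suc N. \<Sum>k<Suc N. a (int j - int k) * ?I j k) / of_nat (Suc N))) {0..2*pi}"
      by (intro has_integral_divide has_integral_sum has_integral_mult_right has_integral_cis_int
          finite_lessThan)
    also have "(\<lambda>x. (\<Sum>j<Suc N. \<Sum>k<Suc N. a (int j - int k) * cis (of_int (int j - int k - int m) *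
        x)) / of_nat (Suc N))
       = (\<lambda>x. complex_of_real (g N x) * cis (- (of_int (int m) * x)))"
    proof
      fix x
      have "a (int j - int k) * cis (of_int (int j - int k - int m) * x)
        = a (int j - int k) * cis (real j * x) * cnj (cis (real k * x)) * cis (- (of_int (int m) *
            x))" for j k
      proof -
        have "cis (of_int (int j - int k - int m) * x) = cis (real j * x + (- (real k * x)) + (-
            (real m * x)))"
          by (simp add: algebra_simps)
        also have "\<dots> = cis (real j * x) * cis (- (real k * x)) * cis (- (real m * x))"
          by (simp only: cis_mult)
        finally show ?thesis by (simp add: cis_cnj)
      qed
      hence "(\<Sum>j<Suc N. \<Sum>k<Suc N. a (int j - int k) * cis (of_int (int j - int k - int m) * x))
        = f N x * cis (- (of_int (int m) * x))"
        unfolding f_def sum_distrib_right by (intro sum.cong refl)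
      thus "(\<Sum>j<Suc N. \<Sum>k<Suc N. a (int j - int k) * cis (of_int (int j - int k - int m) * x)) /
          of_nat (Suc N)
        = complex_of_real (g N x) * cis (- (of_int (int m) * x))"
        by (simp only: g_eq times_divide_eq_left)
    qed
    also have "(\<Sum>j<Suc N. \<Sum>k<Suc N. a (int j - int k) * ?I j k) = (\<Sum>p\<in>{..<Suc N} \<times> {..<Suc N}. if
        fst p = snd p + m then 2 * pi * a (int m) else 0)"
      by (subst sum.cartesian_product, intro sum.cong refl) (auto simp: algebra_simps)
    also have "\<dots> = of_nat (Suc N - m) * (2 * pi * a (int m))"
      by (subst sum.inter_filter[symmetric]) (simp_all only: sum_constant card_shifted_diagonal
          finite_cartesian_product finite_lessThan)
    finally show ?thesis by (simp add: mult_ac)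
  qed
  have "\<exists>\<nu>\<in>circle_prob. \<forall>k. circle_moment \<nu> k = integral {0..2*pi} (\<lambda>x. of_real (g N x) * cis (-
      (of_int k * x))) / (2 * pi)" for N
  proof (rule circle_prob_of_density)
    show "continuous_on {0..2 * pi} (g N)"
      unfolding g_def f_def by (intro continuous_intros) auto
    show "g N x \<ge> 0" for x using f_pos[of N x] by (auto simp: g_def nonneg_Reals_def)
    have "((\<lambda>x. complex_of_real (g N x)) has_integral complex_of_real (2 * pi)) {0..2*pi}"
      using integral_g[of N 0] by (simp add: a0 del: of_nat_Suc)
    from has_integral_Re[OF this] show "(g N has_integral 2 * pi) {0..2 * pi}" by simp
  qed
  then obtain \<nu> where \<nu>: "\<And>N. \<nu> N \<in> circle_prob"
    "\<And>N k. circle_moment (\<nu> N) k = integral {0..2*pi} (\<lambda>x. of_real (g N x) * cis (- (of_int k * x)))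
        / (2 * pi)"
    by metis
  have mom: "circle_moment (\<nu> N) (int m) = of_nat (Suc N - m) / of_nat (Suc N) * a (int m)" for N m
    by (simp only: \<nu>(2) integral_unique[OF integral_g]) simp
  show ?thesis
  proof (rule circle_moment_limit[OF \<nu>(1)])
    fix m :: nat
    have "(\<lambda>N. real (Suc N - m) / real (Suc N)) \<longlonglongrightarrow> 1"
    proof (rule Lim_transform_eventually)
      show "(\<lambda>N. 1 - real m * inverse (real (Suc N))) \<longlonglongrightarrow> 1"
        by (rule tendsto_eq_intros LIMSEQ_inverse_real_of_nat refl | simp)+
      show "\<forall>\<^sub>F N in sequentially. 1 - real m * inverse (real (Suc N)) = real (Suc N - m) / real
          (Suc N)"
        using eventually_ge_at_top[of m] by eventually_elim (auto simp: field_simps of_nat_diff)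
    qed
    hence "(\<lambda>N. complex_of_real (real (Suc N - m) / real (Suc N)) * a (int m)) \<longlonglongrightarrow> complex_of_real 1 *
        a (int m)"
      by (intro tendsto_intros)
    thus "(\<lambda>N. circle_moment (\<nu> N) (int m)) \<longlonglongrightarrow> a (int m)"
      by (simp add: mom del: of_nat_Suc)
  qed
qed

section \<open>The transforms of boolean convolution\<close>

text \<open>This is \<open>\<psi>(z) / z\<close> with the singularity at \<open>0\<close> removed, so that \<open>B(z)\<close> becomes the quotient
  of this function by \<open>1 + \<psi>(z)\<close>, without a division by \<open>z\<close>.\<close>

definition eta_quotient :: "complex measure \<Rightarrow> complex \<Rightarrow> complex" where
  "eta_quotient \<mu> z = (\<integral>\<zeta>. \<zeta> / (1 - \<zeta> * z) \<partial>\<mu>)"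

lemma one_minus_circle_nonzero:
  assumes "norm z < 1" "\<zeta> \<in> unit_circle"
  shows "1 - \<zeta> * z \<noteq> (0::complex)"
  using assms by (metis dist_0_norm eq_iff_diff_eq_0 less_irrefl mem_sphere mult.left_neutral
      norm_mult norm_one)

lemma continuous_on_resolvent:
  assumes "norm z < 1"
  shows "continuous_on unit_circle (\<lambda>\<zeta>::complex. \<zeta> / (1 - \<zeta> * z))"
  using one_minus_circle_nonzero[OF assms] by (intro continuous_intros) auto

lemma psi_transform_eq:
  "psi_transform \<mu> z = z * eta_quotient \<mu> z"
  unfolding psi_transform_def eta_quotient_def
  by (subst integral_mult_right_zero[symmetric]) (simp add: mult.commute)

text \<open>Summing a finite geometric progression leaves, up to sign, the remainder
  \<open>\<integral> \<zeta> (\<zeta> z)\<^sup>N / (1 - \<zeta> z) d\<mu>\<close>, which is at most \<open>\<bar>z\<bar>\<^sup>N / (1 - \<bar>z\<bar>)\<close>.\<close>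

lemma eta_quotient_sums:
  assumes \<mu>: "\<mu> \<in> circle_prob" and z: "norm z < 1"
  shows "(\<lambda>k. circle_moment \<mu> (int (Suc k)) * z ^ k) sums eta_quotient \<mu> z"
proof -
  interpret prob_space \<mu> using \<mu> by (rule prob_space_circle_prob)
  note nz = one_minus_circle_nonzero[OF z]
  have bound: "norm ((\<Sum>k<N. circle_moment \<mu> (int (Suc k)) * z ^ k) - eta_quotient \<mu> z) \<le> norm z ^ N
      / (1 - norm z)" for N
  proof -
    have i1: "integrable \<mu> (\<lambda>\<zeta>. \<zeta> / (1 - \<zeta> * z))"
      by (rule integrable_circle_prob[OF \<mu> continuous_on_resolvent[OF z]])
    have i2: "integrable \<mu> (\<lambda>\<zeta>. (\<zeta> powi (int (Suc k))) * z ^ k)" for k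
      by (intro integrable_mult_left integrable_powi \<mu>)
    have "(\<Sum>k<N. circle_moment \<mu> (int (Suc k)) * z ^ k) - eta_quotient \<mu> z
      = (\<integral>\<zeta>. (\<Sum>k<N. (\<zeta> powi (int (Suc k))) * z ^ k) - \<zeta> / (1 - \<zeta> * z) \<partial>\<mu>)"
      unfolding circle_moment_def eta_quotient_def
      by (subst Bochner_Integration.integral_diff, intro Bochner_Integration.integrable_sum i2, rule i1,
          subst Bochner_Integration.integral_sum, rule i2) simp
    also have "\<dots> = (\<integral>\<zeta>. - (\<zeta> * (\<zeta> * z) ^ N / (1 - \<zeta> * z)) \<partial>\<mu>)"
    proof (intro Bochner_Integration.integral_cong refl)
      fix \<zeta> assume "\<zeta> \<in> space \<mu>"
      hence "1 - \<zeta> * z \<noteq> 0" using nz by (simp add: space_circle_prob[OF \<mu>])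
      hence "\<zeta> * S - \<zeta> / (1 - \<zeta> * z) = - (\<zeta> * (1 - (1 - \<zeta> * z) * S) / (1 - \<zeta> * z))" for S
        by (simp add: diff_divide_distrib right_diff_distrib)
      moreover have "(\<Sum>k<N. (\<zeta> powi (int (Suc k))) * z ^ k) = \<zeta> * (\<Sum>k<N. (\<zeta> * z) ^ k)"
        by (simp add: sum_distrib_left power_mult_distrib power_int_def nat_add_distrib mult.assoc)
      moreover have "(\<zeta> * z) ^ N = 1 - (1 - \<zeta> * z) * (\<Sum>k<N. (\<zeta> * z) ^ k)"
        using one_diff_power_eq[of "\<zeta> * z" N] by (simp add: algebra_simps)
      ultimately show "(\<Sum>k<N. (\<zeta> powi (int (Suc k))) * z ^ k) - \<zeta> / (1 - \<zeta> * z) = - (\<zeta> * (\<zeta> * z) ^ N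
          / (1 - \<zeta> * z))"
        by simp
    qed
    also have "norm \<dots> \<le> (\<integral>\<zeta>. norm z ^ N / (1 - norm z) \<partial>\<mu>)"
    proof (rule order_trans[OF integral_norm_bound], rule integral_mono_AE)
      have "continuous_on unit_circle (\<lambda>\<zeta>. \<zeta> * (\<zeta> * z) ^ N / (1 - \<zeta> * z))"
        using nz by (intro continuous_intros) auto
      thus "integrable \<mu> (\<lambda>\<zeta>. norm (- (\<zeta> * (\<zeta> * z) ^ N / (1 - \<zeta> * z))))"
        by (intro integrable_norm integrable_minus integrable_circle_prob[OF \<mu>])
      show "AE \<zeta> in \<mu>. norm (- (\<zeta> * (\<zeta> * z) ^ N / (1 - \<zeta> * z))) \<le> norm z ^ N / (1 - norm z)"
      proof (rule AE_I2)
        fix \<zeta> assume "\<zeta> \<in> space \<mu>"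
        hence \<zeta>: "norm \<zeta> = 1" by (simp add: space_circle_prob[OF \<mu>])
        have "1 - norm z \<le> norm (1 - \<zeta> * z)"
          using norm_triangle_ineq2[of 1 "\<zeta> * z"] \<zeta> by (simp add: norm_mult)
        thus "norm (- (\<zeta> * (\<zeta> * z) ^ N / (1 - \<zeta> * z))) \<le> norm z ^ N / (1 - norm z)"
          using z \<zeta> by (simp add: norm_divide norm_mult norm_power frac_le)
      qed
    qed auto
    also have "\<dots> = norm z ^ N / (1 - norm z)" by (simp add: prob_space)
    finally show ?thesis .
  qed
  have lim: "(\<lambda>N. norm z ^ N / (1 - norm z)) \<longlonglongrightarrow> 0"
    using tendsto_divide[OF LIMSEQ_power_zero[of "norm z"] tendsto_const[of "1 - norm z"]] z by simp
  have "(\<lambda>N. (\<Sum>k<N. circle_moment \<mu> (int (Suc k)) * z ^ k) - eta_quotient \<mu> z) \<longlonglongrightarrow> 0"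
    by (rule Lim_null_comparison[OF always_eventually[OF allI[OF bound]] lim])
  thus ?thesis unfolding sums_def by (rule LIM_zero_cancel)
qed

lemma eta_quotient_has_fps_expansion:
  assumes "\<mu> \<in> circle_prob"
  shows "eta_quotient \<mu> has_fps_expansion Abs_fps (\<lambda>k. circle_moment \<mu> (int (Suc k)))"
proof (rule has_fps_expansionI)
  have "\<forall>\<^sub>F u in nhds 0. u \<in> ball (0::complex) 1"
    by (intro eventually_nhds_in_open) auto
  thus "\<forall>\<^sub>F u in nhds 0. (\<lambda>n. fps_nth (Abs_fps (\<lambda>k. circle_moment \<mu> (int (Suc k)))) n * u ^ n) sums
      eta_quotient \<mu> u"
    by eventually_elim (use eta_quotient_sums[OF assms] in auto)
qed

lemma eta_quotient_taylor:
  assumes "\<mu> \<in> circle_prob"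
  shows "(deriv ^^ k) (eta_quotient \<mu>) 0 / fact k = circle_moment \<mu> (int (Suc k))"
  using fps_nth_fps_expansion[OF eta_quotient_has_fps_expansion[OF assms], of k] by simp

lemma eta_quotient_0: "eta_quotient \<mu> 0 = circle_moment \<mu> 1"
  by (simp add: eta_quotient_def circle_moment_def)

lemma holomorphic_on_eta_quotient:
  assumes "\<mu> \<in> circle_prob"
  shows "eta_quotient \<mu> holomorphic_on ball 0 1"
  unfolding holomorphic_iff_power_series eta_quotient_taylor[OF assms]
  using eta_quotient_sums[OF assms] by auto



text \<open>Identities that are obtained after a division by \<open>z\<close> extend to \<open>0\<close> by continuity.\<close>

lemma eq_at_0_if_eq_off_0:
  fixes f g :: "complex \<Rightarrow> complex"
  assumes "f holomorphic_on ball 0 1" "g holomorphic_on ball 0 1"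
    and eq: "\<And>z. norm z < 1 \<Longrightarrow> z \<noteq> 0 \<Longrightarrow> f z = g z" and "norm z < 1"
  shows "f z = g z"
proof (cases "z = 0")
  case True
  have "isCont f 0" "isCont g 0"
    using assms(1,2) by (auto intro!: continuous_on_interior[of "ball 0 1"]
        holomorphic_on_imp_continuous_on)
  hence lim: "f \<midarrow>0\<rightarrow> f 0" "g \<midarrow>0\<rightarrow> g 0" by (auto simp: isCont_def)
  have "\<forall>\<^sub>F u in at 0. u \<in> ball (0::complex) 1 \<and> u \<noteq> 0"
    using eventually_at_in_open[of "ball (0::complex) 1" 0] by (auto elim: eventually_mono)
  hence "\<forall>\<^sub>F u in at 0. g u = f u" by eventually_elim (auto simp: eq)
  from Lim_transform_eventually[OF lim(2) this] lim(1) show ?thesis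
    using True by (auto dest: LIM_unique)
qed (use assms in auto)

lemma circle_prob_eq_if_psi_eq:
  assumes \<mu>: "\<mu> \<in> circle_prob" and \<nu>: "\<nu> \<in> circle_prob"
    and eq: "\<And>z. norm z < 1 \<Longrightarrow> psi_transform \<mu> z = psi_transform \<nu> z"
  shows "\<mu> = \<nu>"
proof (rule circle_prob_eqI[OF \<mu> \<nu>])
  have "eta_quotient \<mu> z = eta_quotient \<nu> z" if "norm z < 1" for z
    by (rule eq_at_0_if_eq_off_0[OF holomorphic_on_eta_quotient[OF \<mu>] holomorphic_on_eta_quotient[OF
        \<nu>] _ that])
       (use eq in \<open>auto simp: psi_transform_eq\<close>)
  moreover have "\<forall>\<^sub>F u in nhds 0. u \<in> ball (0::complex) 1"
    by (intro eventually_nhds_in_open) auto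
  ultimately have "\<forall>\<^sub>F u in nhds 0. eta_quotient \<mu> u = eta_quotient \<nu> u"
    by (auto elim!: eventually_mono)
  hence "(deriv ^^ k) (eta_quotient \<mu>) 0 = (deriv ^^ k) (eta_quotient \<nu>) 0" for k
    by (intro higher_deriv_cong_ev refl)
  hence *: "circle_moment \<mu> (int (Suc k)) = circle_moment \<nu> (int (Suc k))" for k
    using eta_quotient_taylor[OF \<mu>, of k] eta_quotient_taylor[OF \<nu>, of k] by simp
  show "circle_moment \<mu> (int k) = circle_moment \<nu> (int k)" for k
    using *[of "k - 1"] by (cases k) (simp_all add: circle_moment_0 \<mu> \<nu>)
qed

text \<open>The minimum of \<open>Re (w / (1 - w))\<close> on the circle of radius \<open>r\<close> is attained at \<open>w = - r\<close>.\<close>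

lemma Re_div_one_minus_ge:
  assumes "norm w < 1"
  shows "Re (w / (1 - w)) \<ge> - (norm w / (1 + norm w))"
proof -
  define r x y where "r = norm w" and "x = Re w" and "y = Im w"
  have r: "r^2 = x^2 + y^2" "r \<ge> 0" "r < 1" using assms by (auto simp: r_def x_def y_def cmod_power2)
  have xr: "x + r \<ge> 0" using abs_Re_le_cmod[of w] by (simp add: r_def x_def)
  have "Re (w / (1 - w)) = (x * (1 - x) - y * y) / ((1 - x)^2 + y^2)"
    by (simp add: Re_divide x_def y_def)
  also have "x * (1 - x) - y * y = x - r^2" using r by (simp add: power2_eq_square algebra_simps)
  also have "(1 - x)^2 + y^2 = 1 - 2 * x + r^2" using r by (simp add: power2_eq_square algebra_simps)
  finally have *: "Re (w / (1 - w)) = (x - r^2) / (1 - 2 * x + r^2)" .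
  have "x \<le> r" using complex_Re_le_cmod[of w] by (simp add: r_def x_def)
  moreover have "(1 - r)^2 > 0" using r by simp
  ultimately have D: "1 - 2 * x + r^2 > 0" by (simp add: power2_eq_square algebra_simps)
  have r1: "1 + r > 0" using r by simp
  have "0 \<le> (x + r) * (1 - r)" using xr r by simp
  also have "\<dots> = (x - r^2) * (1 + r) - (- r) * (1 - 2 * x + r^2)"
    by (simp add: power2_eq_square algebra_simps)
  finally have "(- r) / (1 + r) \<le> (x - r^2) / (1 - 2 * x + r^2)"
    unfolding pos_le_divide_eq[OF D] times_divide_eq_left pos_divide_le_eq[OF r1] by simp
  thus ?thesis using * by (simp add: r_def)
qed

text \<open>This is Harnack's lower bound for \<open>1 + 2 \<psi>\<close>, which has positive real part and the value \<open>1\<close>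
  at \<open>0\<close>.\<close>

lemma Re_psi_transform_ge:
  assumes \<mu>: "\<mu> \<in> circle_prob" and z: "norm z < 1"
  shows "Re (psi_transform \<mu> z) \<ge> - (norm z / (1 + norm z))"
proof -
  interpret prob_space \<mu> using \<mu> by (rule prob_space_circle_prob)
  have c: "continuous_on unit_circle (\<lambda>\<zeta>. \<zeta> * z / (1 - \<zeta> * z))"
    using one_minus_circle_nonzero[OF z] by (intro continuous_intros) auto
  note i = integrable_circle_prob[OF \<mu> c]
  have "- (norm z / (1 + norm z)) = (\<integral>\<zeta>. - (norm z / (1 + norm z)) \<partial>\<mu>)" by (simp add: prob_space)
  also have "\<dots> \<le> (\<integral>\<zeta>. Re (\<zeta> * z / (1 - \<zeta> * z)) \<partial>\<mu>)"
  proof (rule integral_mono_AE)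
    show "AE \<zeta> in \<mu>. - (norm z / (1 + norm z)) \<le> Re (\<zeta> * z / (1 - \<zeta> * z))"
    proof (rule AE_I2)
      fix \<zeta> assume "\<zeta> \<in> space \<mu>"
      hence "norm (\<zeta> * z) = norm z" by (simp add: space_circle_prob[OF \<mu>] norm_mult)
      thus "- (norm z / (1 + norm z)) \<le> Re (\<zeta> * z / (1 - \<zeta> * z))"
        using Re_div_one_minus_ge[of "\<zeta> * z"] z by simp
    qed
    show "integrable \<mu> (\<lambda>\<zeta>. Re (\<zeta> * z / (1 - \<zeta> * z)))" using i by (rule integrable_Re)
  qed simp
  also have "\<dots> = Re (psi_transform \<mu> z)" unfolding psi_transform_def by (rule
      Bochner_Integration.integral_Re[OF i])
  finally show ?thesis .
qed

lemma Re_psi_transform_gt: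
  assumes "\<mu> \<in> circle_prob" "norm z < 1"
  shows "Re (psi_transform \<mu> z) > - 1 / 2"
proof -
  have "norm z / (1 + norm z) < 1 / 2" using assms(2)
    by (subst pos_divide_less_eq) (auto intro: add_pos_nonneg)
  thus ?thesis using Re_psi_transform_ge[OF assms] by linarith
qed

lemma one_plus_psi_nonzero:
  assumes "\<mu> \<in> circle_prob" "norm z < 1"
  shows "1 + psi_transform \<mu> z \<noteq> 0"
proof
  assume "1 + psi_transform \<mu> z = 0"
  hence "Re (1 + psi_transform \<mu> z) = 0" by simp
  thus False using Re_psi_transform_gt[OF assms] by simp
qed

lemma psi_transform_holomorphic:
  assumes "\<mu> \<in> circle_prob"
  shows "psi_transform \<mu> holomorphic_on ball 0 1"
proof -
  have "(\<lambda>z. z * eta_quotient \<mu> z) holomorphic_on ball 0 1"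
    by (intro holomorphic_intros holomorphic_on_eta_quotient assms)
  thus ?thesis by (simp add: psi_transform_eq[abs_def])
qed

lemma B_transform_quotient_holomorphic:
  assumes "\<mu> \<in> circle_prob"
  shows "(\<lambda>z. eta_quotient \<mu> z / (1 + psi_transform \<mu> z)) holomorphic_on ball 0 1"
  using one_plus_psi_nonzero[OF assms]
  by (intro holomorphic_intros holomorphic_on_eta_quotient psi_transform_holomorphic assms) auto

lemma B_transform_eq:
  assumes \<mu>: "\<mu> \<in> circle_prob" and z: "norm z < 1"
  shows "B_transform \<mu> z = eta_quotient \<mu> z / (1 + psi_transform \<mu> z)"
  unfolding B_transform_def
proof (rule remove_sings_eqI, rule Lim_transform_eventually)
  have "isCont (\<lambda>z. eta_quotient \<mu> z / (1 + psi_transform \<mu> z)) z"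
    using z by (auto intro!: continuous_on_interior[of "ball 0 1"] holomorphic_on_imp_continuous_on
      B_transform_quotient_holomorphic[OF \<mu>])
  thus "(\<lambda>z. eta_quotient \<mu> z / (1 + psi_transform \<mu> z)) \<midarrow>z\<rightarrow> eta_quotient \<mu> z / (1 + psi_transform \<mu> z)"
    by (simp add: isCont_def)
  have "\<forall>\<^sub>F u in at z. u \<noteq> 0" by (rule eventually_neq_at_within)
  thus "\<forall>\<^sub>F u in at z. eta_quotient \<mu> u / (1 + psi_transform \<mu> u) = 1 / u * (psi_transform \<mu> u / (1
      + psi_transform \<mu> u))"
    by eventually_elim (simp add: psi_transform_eq)
qed

lemma B_transform_holomorphic:
  assumes "\<mu> \<in> circle_prob"
  shows "B_transform \<mu> holomorphic_on ball 0 1"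
  using B_transform_quotient_holomorphic[OF assms]
  by (rule holomorphic_transform) (simp add: B_transform_eq assms)

lemma B_transform_0: "\<mu> \<in> circle_prob \<Longrightarrow> B_transform \<mu> 0 = circle_moment \<mu> 1"
  by (simp add: B_transform_eq eta_quotient_0 psi_transform_eq)

lemma psi_transform_via_B:
  assumes "\<mu> \<in> circle_prob" "norm z < 1"
  shows "psi_transform \<mu> z = z * B_transform \<mu> z / (1 - z * B_transform \<mu> z)"
    and "1 - z * B_transform \<mu> z = 1 / (1 + psi_transform \<mu> z)"
proof -
  have w: "z * B_transform \<mu> z = psi_transform \<mu> z / (1 + psi_transform \<mu> z)"
    using B_transform_eq[OF assms] by (simp add: psi_transform_eq)
  have "1 - psi_transform \<mu> z / (1 + psi_transform \<mu> z) = 1 / (1 + psi_transform \<mu> z)"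
    using one_plus_psi_nonzero[OF assms] by (simp add: diff_divide_eq_iff)
  thus "1 - z * B_transform \<mu> z = 1 / (1 + psi_transform \<mu> z)"
       "psi_transform \<mu> z = z * B_transform \<mu> z / (1 - z * B_transform \<mu> z)"
    using one_plus_psi_nonzero[OF assms] by (simp_all add: w)
qed

lemma norm_less_norm_one_plus_iff: "norm w < norm (1 + w) \<longleftrightarrow> Re w > - 1 / 2"
proof -
  have "norm w < norm (1 + w) \<longleftrightarrow> (norm w)\<^sup>2 < (norm (1 + w))\<^sup>2" by (auto simp: power_strict_mono
      dest: power_less_imp_less_base)
  also have "\<dots> \<longleftrightarrow> Re w > - 1 / 2" by (auto simp: cmod_power2 power2_sum)
  finally show ?thesis .
qed

text \<open>\<open>z B(z) = \<psi>(z) / (1 + \<psi>(z))\<close> maps the disk to itself because \<open>Re \<psi> > -1/2\<close>, and the Schwarz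
  lemma divides by \<open>z\<close>.\<close>

lemma norm_B_transform_le_1:
  assumes \<mu>: "\<mu> \<in> circle_prob" and z: "norm z < 1"
  shows "norm (B_transform \<mu> z) \<le> 1"
proof (cases "z = 0")
  case True thus ?thesis using \<mu> by (simp add: B_transform_0 norm_circle_moment_le_1)
next
  case False
  have "norm (z * B_transform \<mu> z) \<le> norm z"
  proof (rule Schwarz_Lemma(1)[OF _ _ _ z])
    show "(\<lambda>z. z * B_transform \<mu> z) holomorphic_on ball 0 1"
      by (intro holomorphic_intros B_transform_holomorphic \<mu>)
    fix w :: complex assume w: "norm w < 1"
    have "w * B_transform \<mu> w = psi_transform \<mu> w / (1 + psi_transform \<mu> w)"
      using B_transform_eq[OF \<mu> w] by (simp add: psi_transform_eq)
    thus "norm (w * B_transform \<mu> w) < 1"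
      using Re_psi_transform_gt[OF \<mu> w] one_plus_psi_nonzero[OF \<mu> w]
      by (simp add: norm_divide norm_less_norm_one_plus_iff)
  qed simp
  thus ?thesis using False by (simp add: norm_mult)
qed


section \<open>Boolean convolution exists\<close>

text \<open>Herglotz: the Fourier coefficients of the density \<open>1 + 2 Re h\<close> on the circle of radius \<open>r\<close>
  are the Taylor coefficients of \<open>h\<close>, damped by \<open>r\<^sup>k\<close>.\<close>

lemma herglotz_psi_transform:
  assumes h: "h holomorphic_on ball 0 1" "h 0 = 0" and pos: "\<And>z. norm z < 1 \<Longrightarrow> Re (h z) \<ge> - 1 / 2"
  shows "\<exists>\<rho>\<in>circle_prob. \<forall>z\<in>ball 0 1. psi_transform \<rho> z = h z"
proof -
  define a where "a k = (deriv ^^ k) h 0 / fact k" for k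
  \<comment> \<open>radii in \<open>(0, 1)\<close> that tend to 1\<close>
  define r where "r N = 1 - inverse (real (Suc (Suc N)))" for N
  have r: "0 < r N" "r N < 1" for N by (auto simp: r_def divide_simps)
  define H where "H N x = h (of_real (r N) * cis x)" for N x
  define g where "g N x = 1 + 2 * Re (H N x)" for N x
  have sub: "cball 0 (r N) \<subseteq> ball (0::complex) 1" for N using r[of N] by auto
  have hc: "h holomorphic_on cball 0 (r N)" for N using holomorphic_on_subset[OF h(1) sub] .
  have i_neg: "((\<lambda>x. H N x * cis (- (of_int (int k) * x))) has_integral (2 * pi * of_real (r N) ^ k
      * a k)) {0..2*pi}" for N k
  proof -
    let ?u = "\<lambda>t. of_real (r N) * cis t"
    let ?F = "\<lambda>t. h (0 + ?u t) / (0 + ?u t - 0) ^ Suc k * of_real (r N) * \<i> * cis t"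
    have "((\<lambda>u. h u / (u - 0) ^ Suc k) has_contour_integral (2 * pi * \<i> / fact k * (deriv ^^ k)
        h 0)) (circlepath 0 (r N))"
      using r[of N] by (intro Cauchy_has_contour_integral_higher_derivative_circlepath
          holomorphic_on_imp_continuous_on
            holomorphic_on_subset[OF hc[of N]] hc[of N]) auto
    hence "((?F)
        has_integral (2 * pi * \<i> / fact k * (deriv ^^ k) h 0)) {0..2*pi}"
      unfolding circlepath_def by (subst (asm) has_contour_integral_part_circlepath_iff) auto
    hence "((\<lambda>t. (of_real (r N) ^ k / \<i>) * ?F t)
        has_integral (of_real (r N) ^ k / \<i>) * (2 * pi * \<i> / fact k * (deriv ^^ k) h 0)) {0..2*pi}"
      by (rule has_integral_mult_right)
    also have "(\<lambda>t. (of_real (r N) ^ k / \<i>) * ?F t)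
      = (\<lambda>t. H N t * cis (- (of_int (int k) * t)))"
    proof
      fix t
      have "cis (- (of_int (int k) * t)) = inverse (cis t ^ k)"
        by (simp add: Complex.DeMoivre cis_inverse)
      thus "(of_real (r N) ^ k / \<i>) * ?F t
         = H N t * cis (- (of_int (int k) * t))"
        using r(1)[of N] by (simp add: H_def power_mult_distrib field_simps)
    qed
    also have "(of_real (r N) ^ k / \<i>) * (2 * pi * \<i> / fact k * (deriv ^^ k) h 0) = 2 * pi * of_real
        (r N) ^ k * a k"
      by (simp add: a_def field_simps)
    finally show ?thesis .
  qed
  have i_pos: "((\<lambda>x. H N x * cis (of_int (int k) * x)) has_integral 0) {0..2*pi}" for N k
  proof -
    let ?u = "\<lambda>t. of_real (r N) * cis t"
    let ?F = "\<lambda>t. h (0 + ?u t) * (0 + ?u t) ^ k / (0 + ?u t - 0) * of_real (r N) * \<i> * cis t"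
    have "((\<lambda>u. (h u * u ^ k) / (u - 0)) has_contour_integral (2 * of_real pi * \<i> * (h 0 * 0 ^ k)))
        (circlepath 0 (r N))"
      using r[of N] by (intro Cauchy_integral_circlepath_simple holomorphic_intros hc) auto
    hence "((\<lambda>u. (h u * u ^ k) / (u - 0)) has_contour_integral 0) (circlepath 0 (r N))" by (simp
        add: h(2))
    hence "((?F)
        has_integral 0) {0..2*pi}"
      unfolding circlepath_def by (subst (asm) has_contour_integral_part_circlepath_iff) auto
    from has_integral_mult_right[OF this, of "1 / (\<i> * of_real (r N) ^ k)"]
    have "((\<lambda>t. 1 / (\<i> * of_real (r N) ^ k) * ?F t)
        has_integral 0) {0..2*pi}" by simp
    also have "(\<lambda>t. 1 / (\<i> * of_real (r N) ^ k) * ?F t)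
      = (\<lambda>t. H N t * cis (of_int (int k) * t))"
    proof
      fix t
      have "cis (of_int (int k) * t) = cis t ^ k" by (simp add: Complex.DeMoivre)
      thus "1 / (\<i> * of_real (r N) ^ k) * ?F t
        = H N t * cis (of_int (int k) * t)"
        using r(1)[of N] by (simp add: H_def power_mult_distrib field_simps)
    qed
    finally show ?thesis .
  qed
  have g_eq: "complex_of_real (g N x) = 1 + H N x + cnj (H N x)" for N x
    by (simp add: g_def complex_eq_iff)
  have g_int: "((\<lambda>x. complex_of_real (g N x) * cis (- (of_int (int k) * x))) has_integral
      (2 * pi * (if k = 0 then 1 else of_real (r N) ^ k * a k))) {0..2*pi}" for N k
  proof -
    have "((\<lambda>x. cnj (H N x * cis (of_int (int k) * x))) has_integral cnj 0) {0..2*pi}"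
      using has_integral_linear[OF i_pos bounded_linear_cnj] by (simp only: comp_def)
    from has_integral_add[OF has_integral_add[OF has_integral_cis_int[of "- int k"] i_neg[of N k]] this]
    have "((\<lambda>x. cis (of_int (- int k) * x) + H N x * cis (- (of_int (int k) * x)) + cnj (H N x * cis
        (of_int (int k) * x))) has_integral
       ((if - int k = 0 then 2 * pi else 0) + 2 * pi * of_real (r N) ^ k * a k + cnj 0)) {0..2*pi}" .
    also have "(\<lambda>x. cis (of_int (- int k) * x) + H N x * cis (- (of_int (int k) * x)) + cnj (H N x *
        cis (of_int (int k) * x)))
      = (\<lambda>x. complex_of_real (g N x) * cis (- (of_int (int k) * x)))"
      by (simp add: fun_eq_iff g_eq algebra_simps cis_cnj)
    also have "((if - int k = 0 then 2 * pi else 0) + 2 * pi * of_real (r N) ^ k * a k + cnj 0)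
       = (2 * pi * (if k = 0 then 1 else of_real (r N) ^ k * a k) :: complex)"
      by (simp add: a_def h(2))
    finally show ?thesis .
  qed
  have "\<exists>\<nu>\<in>circle_prob. \<forall>k. circle_moment \<nu> k = integral {0..2*pi} (\<lambda>x. of_real (g N x) * cis (-
      (of_int k * x))) / (2 * pi)" for N
  proof (rule circle_prob_of_density)
    have "continuous_on {0..2 * pi} (\<lambda>x. H N x)" unfolding H_def
      by (rule continuous_on_compose2[OF holomorphic_on_imp_continuous_on[OF h(1)]])
         (use r[of N] in \<open>auto intro!: continuous_intros simp: norm_mult\<close>)
    thus "continuous_on {0..2 * pi} (g N)"
      unfolding g_def by (intro continuous_intros)
    show "g N x \<ge> 0" for x
      using pos[of "of_real (r N) * cis x"] r[of N] by (simp add: g_def H_def norm_mult)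
    have "((\<lambda>x. complex_of_real (g N x)) has_integral complex_of_real (2 * pi)) {0..2*pi}"
      using g_int[of N 0] by simp
    from has_integral_Re[OF this] show "(g N has_integral 2 * pi) {0..2 * pi}" by simp
  qed
  then obtain \<nu> where \<nu>: "\<And>N. \<nu> N \<in> circle_prob"
    "\<And>N k. circle_moment (\<nu> N) k = integral {0..2*pi} (\<lambda>x. of_real (g N x) * cis (- (of_int k * x)))
        / (2 * pi)"
    by metis
  have mom: "circle_moment (\<nu> N) (int m) = (if m = 0 then 1 else of_real (r N) ^ m * a m)" for N m
    by (simp only: \<nu>(2) integral_unique[OF g_int]) simp
  have r1: "r \<longlonglongrightarrow> 1"
    unfolding r_def using tendsto_diff[OF tendsto_const LIMSEQ_Suc[OF LIMSEQ_inverse_real_of_nat],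
        of 1] by simp
  have "\<exists>\<rho>\<in>circle_prob. \<forall>k::nat. circle_moment \<rho> (int k) = (if k = 0 then 1 else a k)"
  proof (rule circle_moment_limit[OF \<nu>(1)])
    fix m :: nat
    have "(\<lambda>N. if m = 0 then 1 else complex_of_real (r N) ^ m * a m) \<longlonglongrightarrow> (if m = 0 then 1 else
        complex_of_real 1 ^ m * a m)"
      by (cases "m = 0") (auto intro!: tendsto_intros tendsto_eq_intros r1)
    thus "(\<lambda>N. circle_moment (\<nu> N) (int m)) \<longlonglongrightarrow> (if m = 0 then 1 else a m)"
      unfolding mom by (cases "m = 0") simp_all
  qed
  then obtain \<rho> where \<rho>: "\<rho> \<in> circle_prob" "\<And>k::nat. circle_moment \<rho> (int k) = (if k = 0 then 1 else
      a k)" by blast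
  have "psi_transform \<rho> z = h z" if "z \<in> ball 0 1" for z
  proof -
    have "(\<lambda>k. a k * (z - 0) ^ k) sums h z"
      unfolding a_def using holomorphic_power_series[OF h(1) that] .
    hence 1: "(\<lambda>k. a (Suc k) * z ^ Suc k) sums h z"
      using sums_Suc_iff[of "\<lambda>k. a k * z ^ k" "h z"] by (simp add: a_def h(2))
    have "(\<lambda>k. circle_moment \<rho> (int (Suc k)) * z ^ k) sums eta_quotient \<rho> z"
      using that by (intro eta_quotient_sums \<rho>) auto
    from sums_mult[OF this, of z] have "(\<lambda>k. a (Suc k) * z ^ Suc k) sums psi_transform \<rho> z"
      unfolding \<rho>(2) by (simp add: psi_transform_eq mult_ac)
    thus ?thesis using 1 by (rule sums_unique2)
  qed
  thus ?thesis using \<rho>(1) by blast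
qed

text \<open>Solving for \<open>\<psi>\<close> gives \<open>\<psi> = z B / (1 - z B)\<close>, and \<open>\<bar>z B\<bar> < 1\<close> turns into \<open>Re \<psi> > -1/2\<close>.\<close>

lemma circle_prob_with_B_transform:
  assumes G: "G holomorphic_on ball 0 1" "\<And>z. norm z < 1 \<Longrightarrow> norm (G z) \<le> 1"
  shows "\<exists>\<rho>\<in>circle_prob. \<forall>z\<in>ball 0 1. B_transform \<rho> z = G z"
proof -
  have lt: "norm (z * G z) < 1" if "norm z < 1" for z
    using mult_left_mono[OF G(2)[OF that], of "norm z"] that by (simp add: norm_mult)
  hence nz: "1 - z * G z \<noteq> 0" if "norm z < 1" for z
    using that by fastforce
  have "\<exists>\<rho>\<in>circle_prob. \<forall>z\<in>ball 0 1. psi_transform \<rho> z = z * G z / (1 - z * G z)"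
  proof (rule herglotz_psi_transform)
    show "(\<lambda>z. z * G z / (1 - z * G z)) holomorphic_on ball 0 1"
      using nz by (intro holomorphic_intros G) auto
    fix z :: complex assume z: "norm z < 1"
    have "norm (z * G z) / (1 + norm (z * G z)) \<le> 1 / 2"
      using lt[OF z] by (subst pos_divide_le_eq) (auto intro: add_pos_nonneg)
    thus "- 1 / 2 \<le> Re (z * G z / (1 - z * G z))"
      using Re_div_one_minus_ge[OF lt[OF z]] by linarith
  qed simp
  then obtain \<rho> where \<rho>: "\<rho> \<in> circle_prob" "\<And>z. norm z < 1 \<Longrightarrow> psi_transform \<rho> z = z * G z / (1 - z *
      G z)"
    by auto
  have "B_transform \<rho> z = G z" if "norm z < 1" for z
  proof (rule eq_at_0_if_eq_off_0[OF B_transform_holomorphic[OF \<rho>(1)] G(1) _ that])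
    fix z :: complex assume z: "norm z < 1" "z \<noteq> 0"
    have "z * B_transform \<rho> z = psi_transform \<rho> z / (1 + psi_transform \<rho> z)"
      using B_transform_eq[OF \<rho>(1) z(1)] by (simp add: psi_transform_eq)
    also have "1 + psi_transform \<rho> z = 1 / (1 - z * G z)"
      using nz[OF z(1)] \<rho>(2)[OF z(1)] by (simp add: add_divide_eq_iff)
    also have "psi_transform \<rho> z / (1 / (1 - z * G z)) = z * G z"
      using nz[OF z(1)] \<rho>(2)[OF z(1)] by simp
    finally show "B_transform \<rho> z = G z" using z(2) by simp
  qed
  thus ?thesis by (intro bexI[OF _ \<rho>(1)] ballI) simp
qed

lemma bool_mconv:
  assumes \<mu>: "\<mu> \<in> circle_prob" and \<nu>: "\<nu> \<in> circle_prob"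
  shows "\<mu> \<uplus>\<^sub>\<times> \<nu> \<in> circle_prob"
    and "norm z < 1 \<Longrightarrow> B_transform (\<mu> \<uplus>\<^sub>\<times> \<nu>) z = B_transform \<mu> z * B_transform \<nu> z"
proof -
  have "\<exists>!\<rho>. \<rho> \<in> circle_prob \<and> (\<forall>z\<in>ball 0 1. B_transform \<rho> z = B_transform \<mu> z * B_transform \<nu> z)"
  proof (rule ex_ex1I)
    show "\<exists>\<rho>. \<rho> \<in> circle_prob \<and> (\<forall>z\<in>ball 0 1. B_transform \<rho> z = B_transform \<mu> z * B_transform \<nu> z)"
    proof -
      have "norm (B_transform \<mu> z * B_transform \<nu> z) \<le> 1" if "norm z < 1" for z
        using norm_B_transform_le_1[OF \<mu> that] norm_B_transform_le_1[OF \<nu> that] by (simp add: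
            norm_mult mult_le_one)
      thus ?thesis
        using circle_prob_with_B_transform[of "\<lambda>z. B_transform \<mu> z * B_transform \<nu> z"] \<mu> \<nu>
        by (auto intro!: holomorphic_intros B_transform_holomorphic)
    qed
    fix \<rho> \<rho>' assume *: "\<rho> \<in> circle_prob \<and> (\<forall>z\<in>ball 0 1. B_transform \<rho> z = B_transform \<mu> z *
        B_transform \<nu> z)"
       "\<rho>' \<in> circle_prob \<and> (\<forall>z\<in>ball 0 1. B_transform \<rho>' z = B_transform \<mu> z * B_transform \<nu> z)"
    show "\<rho> = \<rho>'" using * by (intro circle_prob_eq_if_psi_eq) (auto simp: psi_transform_via_B(1))
  qed
  from theI'[OF this] show "\<mu> \<uplus>\<^sub>\<times> \<nu> \<in> circle_prob"
    and "norm z < 1 \<Longrightarrow> B_transform (\<mu> \<uplus>\<^sub>\<times> \<nu>) z = B_transform \<mu> z * B_transform \<nu> z"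
    unfolding bool_mconv_def by auto
qed

lemma circle_dirac:
  assumes l: "l \<in> unit_circle"
  shows "circle_dirac l \<in> circle_prob"
    and "circle_moment (circle_dirac l) k = l powi k"
    and "norm z < 1 \<Longrightarrow> B_transform (circle_dirac l) z = l"
proof -
  show c: "circle_dirac l \<in> circle_prob"
    using l by (simp add: circle_prob_def circle_dirac_def prob_space_return)
  have int: "(\<integral>\<zeta>. f \<zeta> \<partial>circle_dirac l) = f l" if "continuous_on unit_circle f" for f :: "complex \<Rightarrow>
      complex"
    unfolding circle_dirac_def using l
    by (intro integral_return) (auto simp: circle_borel_def intro:
        borel_measurable_continuous_on_restrict[OF that])
  show "circle_moment (circle_dirac l) k = l powi k"
    unfolding circle_moment_def by (intro int continuous_intros)
  assume z: "norm z < 1"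
  have "eta_quotient (circle_dirac l) z = l / (1 - l * z)"
    unfolding eta_quotient_def by (intro int continuous_on_resolvent z)
  moreover have "1 - l * z \<noteq> 0" using one_minus_circle_nonzero[OF z l] .
  ultimately show "B_transform (circle_dirac l) z = l"
    using B_transform_eq[OF c z] add_divide_eq_iff[of "1 - l * z" 1 "z * l"]
    by (simp add: psi_transform_eq mult.commute)
qed

lemma bool_mconv_foldl:
  assumes "\<rho> \<in> circle_prob" "set ms \<subseteq> circle_prob"
  shows "foldl (\<uplus>\<^sub>\<times>) \<rho> ms \<in> circle_prob \<and>
     (\<forall>z. norm z < 1 \<longrightarrow> B_transform (foldl (\<uplus>\<^sub>\<times>) \<rho> ms) z = B_transform \<rho> z * (\<Prod>\<mu>\<leftarrow>ms. B_transform \<mu> z))"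
  using assms
  by (induction ms arbitrary: \<rho>) (auto simp: bool_mconv mult.assoc)

section \<open>Boolean products that vanish at the origin\<close>

text \<open>A Harnack inequality for \<open>1 - u B\<close>, where \<open>u\<close> rotates \<open>B(z)\<close> to the positive axis. The
  Harnack inequality itself is the lower bound for \<open>Re \<psi>\<close> in the Herglotz representation.\<close>

lemma one_minus_norm_schur_ge:
  assumes f: "f holomorphic_on ball 0 1" "\<And>w. norm w < 1 \<Longrightarrow> norm (f w) \<le> 1" and z: "norm z < 1"
  shows "1 - norm (f z) \<ge> (1 - norm z) / (1 + norm z) * (1 - norm (f 0))"
proof -
  define u where "u = cnj (sgn (f z))"
  have "cnj (f z) * f z = of_real (norm (f z)) * of_real (norm (f z))"
    using complex_norm_square[of "f z"] by (simp add: power2_eq_square mult.commute)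
  hence "u * f z = of_real (norm (f z))"
    by (cases "f z = 0") (simp_all add: u_def sgn_div_norm scaleR_conv_of_real field_simps)
  moreover have "norm u \<le> 1" by (simp add: u_def norm_sgn)
  ultimately have u: "norm u \<le> 1" "u * f z = of_real (norm (f z))" by simp_all
  define p where "p w = 1 - u * f w" for w
  have uf: "norm (u * f w) \<le> norm (f w)" for w
    using mult_right_mono[OF u(1), of "norm (f w)"] by (simp add: norm_mult)
  have pos: "Re (p w) \<ge> 1 - norm (f w)" for w
    using complex_Re_le_cmod[of "u * f w"] uf[of w] by (simp add: p_def)
  show ?thesis
  proof (cases "Re (p 0) = 0")
    case True
    hence "(1 - norm z) / (1 + norm z) * (1 - norm (f 0)) \<le> 0"
      using pos[of 0] z by (intro mult_nonneg_nonpos) (auto intro!: divide_nonneg_nonneg)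
    also have "0 \<le> 1 - norm (f z)" using f(2)[OF z] by simp
    finally show ?thesis .
  next
    case False
    define s where "s = Re (p 0)"
    have s: "s > 0" using False pos[of 0] f(2)[of 0] by (simp add: s_def)
    \<comment> \<open>\<open>1 + 2 h\<close> is \<open>p\<close> normalized to the value 1 at 0\<close>
    define h where "h w = ((p w - \<i> * of_real (Im (p 0))) / of_real s - 1) / 2" for w
    have Re_h: "Re (h w) = (Re (p w) / s - 1) / 2" for w by (simp add: h_def)
    have "\<exists>\<rho>\<in>circle_prob. \<forall>z\<in>ball 0 1. psi_transform \<rho> z = h z"
    proof (rule herglotz_psi_transform)
      show "h holomorphic_on ball 0 1" unfolding h_def p_def using s by (intro holomorphic_intros f)
          auto
      show "h 0 = 0" using s by (simp add: h_def s_def complex_eq_iff)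
      show "Re (h w) \<ge> - 1 / 2" if "norm w < 1" for w
      proof -
        have "Re (p w) / s \<ge> 0" using pos[of w] f(2)[OF that] s by simp
        moreover have "- 1 / 2 \<le> (x - 1) / 2" if "0 \<le> x" for x :: real using that by simp
        ultimately show ?thesis unfolding Re_h by blast
      qed
    qed
    then obtain \<rho> where \<rho>: "\<rho> \<in> circle_prob" "psi_transform \<rho> z = h z" using z by auto
    have "- (norm z / (1 + norm z)) \<le> (Re (p z) / s - 1) / 2"
      using Re_psi_transform_ge[OF \<rho>(1) z] \<rho>(2) Re_h by simp
    moreover have "1 - 2 * (norm z / (1 + norm z)) = (1 - norm z) / (1 + norm z)"
      by (simp add: diff_divide_eq_iff add_nonneg_eq_0_iff)
    moreover have "R \<le> X" if "- t \<le> (X - 1) / 2" "1 - 2 * t = R" for t X R :: real using that by simp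
    ultimately have "(1 - norm z) / (1 + norm z) \<le> Re (p z) / s" by blast
    hence "(1 - norm z) / (1 + norm z) * s \<le> Re (p z)" using s by (simp add: pos_le_divide_eq)
    moreover have "Re (p z) = 1 - norm (f z)" by (simp add: p_def u(2))
    moreover have "(1 - norm z) / (1 + norm z) * (1 - norm (f 0)) \<le> (1 - norm z) / (1 + norm z) * s"
      using pos[of 0] z by (intro mult_left_mono) (auto simp: s_def intro!: divide_nonneg_nonneg)
    ultimately show ?thesis by linarith
  qed
qed

text \<open>Cauchy's estimate for \<open>\<psi>(z) / z = B(z) / (1 - z B(z))\<close> on the circle of radius \<open>1/2\<close>, where
  the denominator is at least \<open>1/2\<close> in modulus.\<close>

lemma norm_circle_moment_le_B_bound:
  assumes \<rho>: "\<rho> \<in> circle_prob" and e: "\<And>z. norm z = 1 / 2 \<Longrightarrow> norm (B_transform \<rho> z) \<le> e"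
  shows "norm (circle_moment \<rho> (int (Suc k))) \<le> 2 ^ (Suc k) * e"
proof -
  have bound: "norm (eta_quotient \<rho> z) \<le> 2 * e" if z: "norm z = 1 / 2" for z
  proof -
    have z1: "norm z < 1" using z by simp
    let ?B = "B_transform \<rho> z"
    have "norm (z * ?B) \<le> 1 / 2" using norm_B_transform_le_1[OF \<rho> z1] z by (simp only: norm_mult)
    hence d: "norm (1 - z * ?B) \<ge> 1 / 2" using norm_triangle_ineq2[of 1 "z * ?B"] by simp
    have "z * eta_quotient \<rho> z = z * (?B / (1 - z * ?B))"
      using psi_transform_via_B(1)[OF \<rho> z1] by (simp add: psi_transform_eq)
    moreover have "z \<noteq> 0" using z by auto
    ultimately have "eta_quotient \<rho> z = ?B / (1 - z * ?B)"
      by (simp only: mult_cancel_left) simp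
    hence "norm (eta_quotient \<rho> z) = norm ?B / norm (1 - z * ?B)" by (simp add: norm_divide)
    also have "\<dots> \<le> e / (1 / 2)" using d e[OF z] by (intro frac_le) (auto intro: order_trans[OF
        norm_ge_zero])
    finally show ?thesis by simp
  qed
  have "norm ((deriv ^^ k) (eta_quotient \<rho>) 0) \<le> fact k * (2 * e) / (1 / 2) ^ k"
  proof (rule Cauchy_inequality)
    show "eta_quotient \<rho> holomorphic_on ball 0 (1 / 2)"
      by (rule holomorphic_on_subset[OF holomorphic_on_eta_quotient[OF \<rho>]]) auto
    show "continuous_on (cball 0 (1 / 2)) (eta_quotient \<rho>)"
      by (rule holomorphic_on_imp_continuous_on, rule holomorphic_on_subset[OF
          holomorphic_on_eta_quotient[OF \<rho>]]) auto
  qed (use bound in auto)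
  hence "norm ((deriv ^^ k) (eta_quotient \<rho>) 0 / fact k) \<le> 2 * e * 2 ^ k"
    by (simp add: norm_divide power_one_over divide_simps mult_ac)
  thus ?thesis unfolding eta_quotient_taylor[OF \<rho>] by (simp add: mult_ac)
qed

section \<open>Freeness determines the moments of words\<close>

lemma (in monoid) int_pow_units_of:
  assumes x: "x \<in> Units G"
  shows "x [^]\<^bsub>units_of G\<^esub> (k::int) = x [^] k"
proof -
  interpret U: group "units_of G" by (rule units_group)
  have "x [^]\<^bsub>units_of G\<^esub> n \<in> Units G" for n :: nat
    using U.nat_pow_closed[of x n] x by (simp add: units_of_carrier)
  thus ?thesis
    using x by (simp add: int_pow_def2 units_of_pow units_of_inv del: pow_nat)
qed

lemma (in monoid) int_pow_closed_Units:
  assumes "x \<in> Units G"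
  shows "x [^] (k::int) \<in> carrier G"
  using group.int_pow_closed[OF units_group, of x k] assms
  by (simp add: int_pow_units_of units_of_carrier Units_closed)

lemma (in monoid) int_pow_add_Units:
  assumes x: "x \<in> Units G"
  shows "x [^] (i + j :: int) = x [^] i \<otimes> x [^] j"
  using group.int_pow_mult[OF units_group, of x i j] x
  by (simp add: int_pow_units_of units_of_carrier units_of_mult)

text \<open>If \<open>F\<close> gives the values of a state on words and \<open>p\<close> its values on letters, then this is the
  value of the state on \<open>pre\<close> followed by the product of the centered letters \<open>x - p x\<close> of \<open>post\<close>.\<close>

fun centered_value :: "('x list \<Rightarrow> complex) \<Rightarrow> ('x \<Rightarrow> complex) \<Rightarrow> 'x list \<Rightarrow> 'x list \<Rightarrow> complex" where
  "centered_value F p pre [] = F pre"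
| "centered_value F p pre (x # post) = centered_value F p (pre @ [x]) post - p x * centered_value F
    p pre post"

text \<open>Only the leading term of the expansion has full length; the values of all shorter words
  agree and cancel.\<close>

lemma centered_value_diff:
  assumes "\<And>ws. length ws < n \<Longrightarrow> F ws = F' ws" and "length pre + length post \<le> n"
  shows "centered_value F p pre post - centered_value F' p pre post = F (pre @ post) - F' (pre @ post)"
  using assms(2)
proof (induction post arbitrary: pre)
  case (Cons x post)
  have "F (pre @ post) = F' (pre @ post)" using assms(1) Cons.prems by simp
  hence "centered_value F p pre post = centered_value F' p pre post"
    using Cons.IH[of pre] Cons.prems by simp
  thus ?case using Cons.IH[of "pre @ [x]"] Cons.prems by simp
qed simp

text \<open>Expanding a vanishing product of centered letters expresses the value of an alternating word
  through shorter words, and a word that is not alternating can be shortened.\<close>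

lemma free_values_unique:
  fixes F F' :: "('i \<times> int) list \<Rightarrow> complex"
  assumes one: "F [] = F' []"
    and merge: "\<And>xs i k l ys. F (xs @ (i, k) # (i, l) # ys) = F (xs @ (i, k + l) # ys)"
    and merge': "\<And>xs i k l ys. F' (xs @ (i, k) # (i, l) # ys) = F' (xs @ (i, k + l) # ys)"
    and free: "\<And>ws. ws \<noteq> [] \<Longrightarrow> distinct_adj (map fst ws) \<Longrightarrow> centered_value F p [] ws = 0"
    and free': "\<And>ws. ws \<noteq> [] \<Longrightarrow> distinct_adj (map fst ws) \<Longrightarrow> centered_value F' p [] ws = 0"
  shows "F ws = F' ws"
proof (induction "length ws" arbitrary: ws rule: less_induct)
  case less
  show ?case
  proof (cases "distinct_adj (map fst ws)")
    case True
    show ?thesis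
    proof (cases "ws = []")
      case False
      have "centered_value F p [] ws - centered_value F' p [] ws = F ([] @ ws) - F' ([] @ ws)"
        by (rule centered_value_diff[where n = "length ws"]) (use less in auto)
      thus ?thesis using free[OF False True] free'[OF False True] by simp
    qed (simp add: one)
  next
    case False
    then obtain xs i k l ys where ws: "ws = xs @ (i, k) # (i, l) # ys"
    proof (induction ws arbitrary: thesis rule: induct_list012)
      case (3 x y zs)
      show ?case
      proof (cases "fst x = fst y")
        case True
        thus ?thesis using "3.prems"(1)[of "[]" "fst x" "snd x" "snd y" zs] by (cases x; cases y) auto
      next
        case False
        hence "\<not> distinct_adj (map fst (y # zs))" using "3.prems"(2) by simp
        from "3.IH"(2)[OF _ this] obtain xs i k l ys where "y # zs = xs @ (i, k) # (i, l) # ys" by blast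
        thus ?thesis using "3.prems"(1)[of "x # xs"] by simp
      qed
    qed auto
    show ?thesis unfolding ws merge merge' by (rule less) (simp add: ws)
  qed
qed

text \<open>Each centering step adds a term that carries a factor \<open>p x\<close>, and fewer than \<open>2\<^sup>n\<close> such terms
  arise from \<open>n\<close> letters.\<close>

lemma norm_centered_value_diff_le:
  assumes F: "\<And>ws. norm (F ws) \<le> 1" and p: "\<And>x. x \<in> set post \<Longrightarrow> norm (p x) \<le> e" and e: "e \<le> 1" "0 \<le> e"
  shows "norm (centered_value F p pre post) \<le> 2 ^ length post \<and>
         norm (centered_value F p pre post - F (pre @ post)) \<le> e * 2 ^ length post"
  using p
proof (induction post arbitrary: pre)
  case (Cons x post)
  let ?N = "2 ^ length post :: real"
  have px: "norm (p x) \<le> e" using Cons.prems by simp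
  have IH: "norm (centered_value F p q post) \<le> ?N" "norm (centered_value F p q post - F (q @ post))
      \<le> e * ?N" for q
    using Cons by auto
  have "norm (p x * centered_value F p pre post) \<le> e * ?N"
    using mult_mono[OF px IH(1)[of pre]] e by (simp add: norm_mult)
  moreover have "e * ?N \<le> 1 * ?N" using e by (intro mult_right_mono) auto
  ultimately have px_le: "norm (p x * centered_value F p pre post) \<le> e * ?N"
    "norm (p x * centered_value F p pre post) \<le> ?N" by linarith+
  have "norm (centered_value F p pre (x # post)) \<le> ?N + ?N"
    using norm_triangle_ineq4[of "centered_value F p (pre @ [x]) post" "p x * centered_value F p pre
        post"]
      IH(1)[of "pre @ [x]"] px_le(2) by simp
  moreover have "norm (centered_value F p pre (x # post) - F (pre @ x # post)) \<le> e * ?N + e * ?N"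
    using norm_triangle_ineq4[of "centered_value F p (pre @ [x]) post - F (pre @ x # post)" "p x *
        centered_value F p pre post"]
      IH(2)[of "pre @ [x]"] px_le(1) by (simp add: algebra_simps)
  ultimately show ?case by (simp add: algebra_simps)
qed (use F e in auto)

lemma carrier_complex_ring [simp]: "c \<in> carrier complex_ring"
  by (simp add: complex_ring_def)

section \<open>Words in unitaries\<close>

context star_probability_space
begin

lemma unitary_in_Units:
  assumes "u \<in> unitary_elements A star"
  shows "u \<in> Units A" "inv u = star u"
proof -
  have u: "u \<in> carrier A" "star u \<in> carrier A" "star u \<otimes> u = \<one>" "u \<otimes> star u = \<one>"
    using assms star_closed by (auto simp: unitary_elements_def)
  thus "u \<in> Units A" by (auto simp: Units_def)
  show "inv u = star u" using u by (intro inv_unique'[symmetric]) auto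
qed

lemma state_centered_mult:
  assumes "a \<in> carrier A" "x \<in> carrier A" "b \<in> carrier A"
  shows "\<phi> (a \<otimes> ((x \<oplus> (- c) \<odot> \<one>) \<otimes> b)) = \<phi> (a \<otimes> (x \<otimes> b)) - c * \<phi> (a \<otimes> b)"
  using assms by (simp add: l_distr r_distr smult_mult_left smult_mult_right state_add state_smult)

definition word_prod :: "('i \<Rightarrow> 'a) \<Rightarrow> ('i \<times> int) list \<Rightarrow> 'a" where
  "word_prod U ws = foldr (\<otimes>) (map (\<lambda>(i, k). U i [^] k) ws) \<one>"

lemma word_prod_Nil [simp]: "word_prod U [] = \<one>"
  and word_prod_Cons [simp]: "word_prod U ((i, k) # ws) = U i [^] k \<otimes> word_prod U ws"
  by (simp_all add: word_prod_def)

lemma word_prod_closed [simp]: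
  assumes "\<And>i. U i \<in> unitary_elements A star"
  shows "word_prod U ws \<in> carrier A"
proof (induction ws)
  case (Cons w ws)
  thus ?case using assms by (cases w) (auto intro!: int_pow_closed_Units unitary_in_Units)
qed simp

lemma word_prod_append:
  assumes U: "\<And>i. U i \<in> unitary_elements A star"
  shows "word_prod U (xs @ ys) = word_prod U xs \<otimes> word_prod U ys"
proof (induction xs)
  case (Cons w xs)
  obtain i k where "w = (i, k)" by (cases w)
  moreover have "U i [^] k \<in> carrier A" using U by (auto intro!: int_pow_closed_Units unitary_in_Units)
  ultimately show ?case using Cons U by (simp add: m_assoc)
qed (use U in simp)

lemma word_prod_merge:
  assumes U: "\<And>i. U i \<in> unitary_elements A star"
  shows "word_prod U (xs @ (i, k) # (i, l) # ys) = word_prod U (xs @ (i, k + l) # ys)"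
proof -
  have "U i [^] n \<in> carrier A" for n :: int using U by (auto intro!: int_pow_closed_Units
      unitary_in_Units)
  thus ?thesis
    using U by (simp add: word_prod_append int_pow_add_Units unitary_in_Units m_assoc)
qed

definition centered_prod :: "('i \<Rightarrow> 'a) \<Rightarrow> ('i \<times> int) list \<Rightarrow> 'a" where
  "centered_prod U ws = foldr (\<otimes>) (map (\<lambda>(i, k). U i [^] k \<oplus> (- \<phi> (U i [^] k)) \<odot> \<one>) ws) \<one>"

lemma centered_value_eq:
  assumes U: "\<And>i. U i \<in> unitary_elements A star"
  shows "centered_value (\<lambda>ws. \<phi> (word_prod U ws)) (\<lambda>(i, k). \<phi> (U i [^] k)) pre post
     = \<phi> (word_prod U pre \<otimes> centered_prod U post) \<and> centered_prod U post \<in> carrier A"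
proof (induction post arbitrary: pre)
  case Nil
  thus ?case using U by (simp add: centered_prod_def)
next
  case (Cons w post)
  obtain i k where w: "w = (i, k)" by (cases w)
  have c: "U i [^] k \<in> carrier A" using U by (auto intro!: int_pow_closed_Units unitary_in_Units)
  have d: "centered_prod U post \<in> carrier A" using Cons by blast
  have *: "centered_prod U (w # post) = (U i [^] k \<oplus> (- \<phi> (U i [^] k)) \<odot> \<one>) \<otimes> centered_prod U post"
    by (simp add: centered_prod_def w)
  show ?case
    unfolding * using c d U Cons
    by (simp add: w state_centered_mult word_prod_append m_assoc)
qed

text \<open>Negative powers belong to the generated *-subalgebra because the inverse of a unitary is its
  adjoint.\<close>

lemma int_pow_in_generated:
  assumes u: "u \<in> unitary_elements A star"
  shows "u [^] (k::int) \<in> generated_star_subalgebra A star {u}"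
proof -
  have nat: "u [^] (n::nat) \<in> generated_star_subalgebra A star {u}" for n
    by (induction n) (auto intro: generated_star_subalgebra.intros)
  have nat': "star u [^] (n::nat) \<in> generated_star_subalgebra A star {u}" for n
    by (induction n) (auto intro: generated_star_subalgebra.intros)
  have "inv (u [^] n) = star u [^] n" for n :: nat
  proof -
    have U: "u \<in> Units A" using unitary_in_Units u by auto
    interpret U: group "units_of A" by (rule units_group)
    have "inv\<^bsub>units_of A\<^esub> (u [^]\<^bsub>units_of A\<^esub> n) = (inv\<^bsub>units_of A\<^esub> u) [^]\<^bsub>units_of A\<^esub> n"
      using U by (simp add: U.nat_pow_inv units_of_carrier)
    thus ?thesis
      using U unitary_in_Units(2)[OF u] U.nat_pow_closed[of u n] Units_inv_Units[OF U]
      by (simp add: units_of_pow units_of_inv units_of_carrier)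
  qed
  thus ?thesis using nat nat' by (simp add: int_pow_def2 del: pow_nat)
qed

lemma free_centered_value_0:
  assumes U: "\<And>i. U i \<in> unitary_elements A star"
    and free: "free_subalgebras A \<phi> (\<lambda>i. generated_star_subalgebra A star {U i})"
    and ws: "ws \<noteq> []" "distinct_adj (map fst ws)"
  shows "centered_value (\<lambda>ws. \<phi> (word_prod U ws)) (\<lambda>(i, k). \<phi> (U i [^] k)) [] ws = 0"
proof -
  let ?xs = "map (\<lambda>(i, k). U i [^] k \<oplus> (- \<phi> (U i [^] k)) \<odot> \<one>) ws"
  have c: "U i [^] k \<in> carrier A" for i and k :: int
    using U by (auto intro!: int_pow_closed_Units unitary_in_Units)
  have "list_all2 (\<lambda>j x. x \<in> generated_star_subalgebra A star {U j} \<and> \<phi> x = 0) (map fst ws) ?xs"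
    unfolding list_all2_map1 list_all2_map2
  proof (rule list_all2_refl)
    fix w :: "'b \<times> int"
    obtain i k where w: "w = (i, k)" by (cases w)
    have "U i [^] k \<oplus> (- \<phi> (U i [^] k)) \<odot> \<one> \<in> generated_star_subalgebra A star {U i}"
      by (intro generated_star_subalgebra.add generated_star_subalgebra.smult
            generated_star_subalgebra.one int_pow_in_generated U)
    thus "(case w of (i, k) \<Rightarrow> U i [^] k \<oplus> (- \<phi> (U i [^] k)) \<odot> \<one>) \<in> generated_star_subalgebra A star
        {U (fst w)}
       \<and> \<phi> (case w of (i, k) \<Rightarrow> U i [^] k \<oplus> (- \<phi> (U i [^] k)) \<odot> \<one>) = 0"
      using c by (simp add: w state_add state_smult state_one)
  qed
  hence "\<phi> (centered_prod U ws) = 0"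
    using free ws unfolding free_subalgebras_def centered_prod_def by blast
  thus ?thesis using centered_value_eq[OF U, where pre = "[]" and post = ws] by simp
qed

lemma word_prod_replicate_pair:
  assumes U: "\<And>i. U i \<in> unitary_elements A star"
  shows "word_prod U (concat (replicate k [(True, 1), (False, 1)])) = (U True \<otimes> U False) [^] k"
proof (induction k)
  case (Suc k)
  have c: "U i \<in> carrier A" for i using U by (simp add: unitary_elements_def)
  have 1: "U i [^] (1::int) = U i" for i using c by (simp add: int_pow_def2 del: pow_nat)
  have "word_prod U (concat (replicate (Suc k) [(True, 1), (False, 1)]))
      = (U True \<otimes> U False) \<otimes> (U True \<otimes> U False) [^] k"
    using Suc U c by (simp add: 1 m_assoc)
  also have "\<dots> = (U True \<otimes> U False) [^] Suc k"
    by (rule nat_pow_Suc2[symmetric]) (simp add: c)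
  finally show ?case .
qed simp

end

text \<open>The moments of \<open>u v\<close> are the values of the words \<open>(u v)\<^sup>k\<close>, and freeness determines the
  values of all words from the moments of \<open>u\<close> and of \<open>v\<close>.\<close>

lemma is_free_mconv_unique:
  assumes "is_free_mconv \<mu> \<nu> \<rho>" "is_free_mconv \<mu> \<nu> \<rho>'"
  shows "\<rho> = \<rho>'"
proof -
  define p where "p = (\<lambda>(b, k). circle_moment (if b then \<mu> else \<nu>) k)"
  let ?R = "\<lambda>F r. F [] = 1 \<and> (\<forall>xs i k l ys. F (xs @ (i, k) # (i, l) # ys) = F (xs @ (i, k + l) # ys)) \<and>
     (\<forall>ws. ws \<noteq> [] \<longrightarrow> distinct_adj (map fst ws) \<longrightarrow> centered_value F p [] ws = 0) \<and> r \<in> circle_prob \<and>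
     (\<forall>k::nat. circle_moment r (int k) = F (concat (replicate k [(True, 1), (False, 1)])))"
  have *: "\<exists>F. ?R F r" if r: "is_free_mconv \<mu> \<nu> r" for r
  proof -
    obtain A :: "(complex, nat \<Rightarrow> complex) module" and star \<phi> u v where
      A: "star_probability_space A star \<phi>" and
      uv: "u \<in> unitary_elements A star" "v \<in> unitary_elements A star" and
      free: "freely_independent A star \<phi> u v" and
      dist: "has_unitary_distribution A \<phi> u \<mu>" "has_unitary_distribution A \<phi> v \<nu>"
        "has_unitary_distribution A \<phi> (u \<otimes>\<^bsub>A\<^esub> v) r"
      using r unfolding is_free_mconv_def by blast
    interpret star_probability_space A star \<phi> by (rule A)
    define U where "U b = (if b then u else v)" for b
    have U: "U b \<in> unitary_elements A star" for b using uv by (simp add: U_def)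
    have p: "p = (\<lambda>(b, k). \<phi> (U b [^]\<^bsub>A\<^esub> k))"
      using dist by (auto simp: p_def U_def has_unitary_distribution_def circle_moment_def)
    have fr: "free_subalgebras A \<phi> (\<lambda>i. generated_star_subalgebra A star {U i})"
      using free by (simp add: freely_independent_def U_def)
    have pow: "(u \<otimes>\<^bsub>A\<^esub> v) [^]\<^bsub>A\<^esub> (int k) = word_prod U (concat (replicate k [(True, 1),
        (False, 1)]))" for k
      unfolding word_prod_replicate_pair[OF U] int_pow_int by (simp add: U_def)
    have "?R (\<lambda>ws. \<phi> (word_prod U ws)) r"
    proof (intro conjI allI impI)
      show "\<phi> (word_prod U []) = 1" by (simp add: state_one)
      show "\<phi> (word_prod U (xs @ (i, k) # (i, l) # ys)) = \<phi> (word_prod U (xs @ (i, k + l) # ys))"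
          for xs i k l ys
        by (simp only: word_prod_merge[OF U])
      show "centered_value (\<lambda>ws. \<phi> (word_prod U ws)) p [] ws = 0" if "ws \<noteq> []" "distinct_adj (map
          fst ws)" for ws
        unfolding p by (rule free_centered_value_0[OF U fr that])
      show "r \<in> circle_prob" using dist(3) by (simp add: has_unitary_distribution_def)
      show "circle_moment r (int k) = \<phi> (word_prod U (concat (replicate k [(True, 1),
          (False, 1)])))" for k
        using dist(3) unfolding has_unitary_distribution_def circle_moment_def pow[symmetric] by simp
    qed
    thus ?thesis by (rule exI[of _ "\<lambda>ws. \<phi> (word_prod U ws)"])
  qed
  from *[OF assms(1)] obtain F where F: "?R F \<rho>" by (rule exE)
  from *[OF assms(2)] obtain F' where F': "?R F' \<rho>'" by (rule exE)
  have "F ws = F' ws" for ws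
  proof (rule free_values_unique[where p = p])
    show "F [] = F' []" using F[THEN conjunct1] F'[THEN conjunct1] by simp
  qed (fact F[THEN conjunct2, THEN conjunct1, rule_format]
            F'[THEN conjunct2, THEN conjunct1, rule_format]
            F[THEN conjunct2, THEN conjunct2, THEN conjunct1, rule_format]
            F'[THEN conjunct2, THEN conjunct2, THEN conjunct1, rule_format])+
  moreover note F[THEN conjunct2, THEN conjunct2, THEN conjunct2] F'[THEN conjunct2, THEN conjunct2,
      THEN conjunct2]
  ultimately show ?thesis by (intro circle_prob_eqI) simp_all
qed

lemma free_mconv_eqI: "is_free_mconv \<mu> \<nu> \<rho> \<Longrightarrow> \<mu> \<boxtimes> \<nu> = \<rho>"
  unfolding free_mconv_def using is_free_mconv_unique by blast

section \<open>Moments of unitaries\<close>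

context star_probability_space
begin

lemma unitary_closed: "u \<in> unitary_elements A star \<Longrightarrow> u \<in> carrier A"
  by (simp add: unitary_elements_def)

lemma star_one: "star \<one> = \<one>"
proof -
  have "\<one> = star (\<one> \<otimes> star \<one>)" using star_closed[OF one_closed] star_star by simp
  also have "\<dots> = star (star \<one>) \<otimes> star \<one>" using star_closed[OF one_closed] by (intro star_mult) auto
  also have "\<dots> = star \<one>" using star_closed[OF one_closed] star_star by simp
  finally show ?thesis ..
qed

text \<open>Positivity of this value for all \<open>c\<close> makes the state hermitian (\<open>c = 1\<close> and \<open>c = \<i>\<close>) and,
  for \<open>c = - \<phi> x\<close>, gives the Cauchy--Schwarz inequality for \<open>x\<close> and the unit.\<close>

lemma state_affine_square:
  assumes "x \<in> carrier A"
  shows "\<phi> (star (x \<oplus> c \<odot> \<one>) \<otimes> (x \<oplus> c \<odot> \<one>)) = \<phi> (star x \<otimes> x) + c * \<phi> (star x) + cnj c * \<phi> x + c * cnj c"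
proof -
  have c: "star x \<in> carrier A" using assms by (rule star_closed)
  have "star (x \<oplus> c \<odot> \<one>) = star x \<oplus> cnj c \<odot> \<one>"
    using assms by (simp add: star_add star_smult star_one)
  thus ?thesis
    using assms c by (simp add: l_distr r_distr smult_mult_left smult_mult_right state_add
        state_smult state_one
          algebra_simps)
qed

lemma state_star:
  assumes "x \<in> carrier A"
  shows "\<phi> (star x) = cnj (\<phi> x)"
proof -
  have real: "Im (\<phi> (star x \<otimes> x) + c * \<phi> (star x) + cnj c * \<phi> x + c * cnj c) = 0" for c
    using state_pos[of "x \<oplus> c \<odot> \<one>"] assms
    unfolding state_affine_square[OF assms, symmetric] by (auto simp: nonneg_Reals_def)
  have "Im (\<phi> (star x \<otimes> x)) = 0" using real[of 0] by simp
  with real[of 1] real[of \<i>] show ?thesis by (simp add: complex_eq_iff)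
qed

lemma norm_state_unitary_le_1:
  assumes u: "u \<in> unitary_elements A star"
  shows "norm (\<phi> u) \<le> 1"
proof -
  have c: "u \<in> carrier A" using u by (rule unitary_closed)
  have "\<phi> (star u \<otimes> u) = 1" using u state_one by (simp add: unitary_elements_def)
  hence "\<phi> (star (u \<oplus> (- \<phi> u) \<odot> \<one>) \<otimes> (u \<oplus> (- \<phi> u) \<odot> \<one>)) = 1 - \<phi> u * cnj (\<phi> u)"
    unfolding state_affine_square[OF c] state_star[OF c] by simp
  moreover have "\<phi> (star (u \<oplus> (- \<phi> u) \<odot> \<one>) \<otimes> (u \<oplus> (- \<phi> u) \<odot> \<one>)) \<in> \<real>\<^sub>\<ge>\<^sub>0"
    using c by (intro state_pos) auto
  ultimately have "1 - \<phi> u * cnj (\<phi> u) \<in> \<real>\<^sub>\<ge>\<^sub>0" by simp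
  also have "1 - \<phi> u * cnj (\<phi> u) = of_real (1 - (norm (\<phi> u))\<^sup>2)"
    by (simp flip: complex_norm_square)
  finally have "(norm (\<phi> u))\<^sup>2 \<le> 1" by (simp only: nonneg_Reals_of_real_iff)
  thus ?thesis by (simp add: abs_square_le_1)
qed

lemma unitary_mult:
  assumes "u \<in> unitary_elements A star" "v \<in> unitary_elements A star"
  shows "u \<otimes> v \<in> unitary_elements A star"
proof -
  have c: "u \<in> carrier A" "v \<in> carrier A" "star u \<in> carrier A" "star v \<in> carrier A"
    and e: "star u \<otimes> u = \<one>" "u \<otimes> star u = \<one>" "star v \<otimes> v = \<one>" "v \<otimes> star v = \<one>"
    using assms by (auto simp: unitary_elements_def star_closed)
  have "(star v \<otimes> star u) \<otimes> (u \<otimes> v) = star v \<otimes> (star u \<otimes> u) \<otimes> v"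
    using c by (simp only: m_assoc m_closed)
  moreover have "(u \<otimes> v) \<otimes> (star v \<otimes> star u) = u \<otimes> (v \<otimes> star v) \<otimes> star u"
    using c by (simp only: m_assoc m_closed)
  ultimately show ?thesis
    using c e by (simp add: unitary_elements_def star_mult)
qed

lemma unitary_star: "u \<in> unitary_elements A star \<Longrightarrow> star u \<in> unitary_elements A star"
  by (auto simp: unitary_elements_def star_closed star_star)

lemma unitary_one: "\<one> \<in> unitary_elements A star"
  by (simp add: unitary_elements_def star_one)

lemma unitary_nat_pow: "u \<in> unitary_elements A star \<Longrightarrow> u [^] (n::nat) \<in> unitary_elements A star"
  by (induction n) (auto intro: unitary_one unitary_mult)

lemma star_nat_pow:
  assumes "u \<in> carrier A"
  shows "star (u [^] (n::nat)) = star u [^] n"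
proof (induction n)
  case (Suc n)
  have "star (u [^] Suc n) = star u \<otimes> star u [^] n"
    using assms Suc by (simp add: star_mult)
  thus ?case using assms star_closed nat_pow_Suc2[of "star u" n] by simp
qed (simp add: star_one)

lemma unitary_int_pow:
  assumes u: "u \<in> unitary_elements A star"
  shows "u [^] (- int n) = star u [^] n"
proof -
  have "u [^] (- int n) = inv (u [^] n)" by (cases "n = 0") (simp_all add: int_pow_def2 del: pow_nat)
  also have "\<dots> = star (u [^] n)" by (rule unitary_in_Units(2)[OF unitary_nat_pow[OF u]])
  finally show ?thesis using u by (simp add: star_nat_pow unitary_closed)
qed

lemma unitary_int_pow_unitary: "u \<in> unitary_elements A star \<Longrightarrow> u [^] (k::int) \<in> unitary_elements A star"
  by (cases k rule: int_cases2) (auto simp: unitary_int_pow int_pow_int intro: unitary_nat_pow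
      unitary_star)

lemma word_prod_unitary:
  assumes U: "\<And>i. U i \<in> unitary_elements A star"
  shows "word_prod U ws \<in> unitary_elements A star"
proof (induction ws)
  case (Cons w ws)
  thus ?case using U by (cases w) (auto intro: unitary_mult unitary_int_pow_unitary)
qed (simp add: unitary_one)

primrec power_sum :: "'a \<Rightarrow> (nat \<Rightarrow> complex) \<Rightarrow> nat \<Rightarrow> 'a" where
  "power_sum u c 0 = \<zero>"
| "power_sum u c (Suc n) = power_sum u c n \<oplus> c n \<odot> u [^] n"

lemma power_sum_closed [simp]: "u \<in> carrier A \<Longrightarrow> power_sum u c n \<in> carrier A"
  by (induction n) auto

lemma state_zero: "\<phi> \<zero> = 0"
  using state_add[of \<zero> \<zero>] by simp

lemma state_mult_power_sum:
  assumes "u \<in> carrier A" "z \<in> carrier A"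
  shows "\<phi> (z \<otimes> power_sum u c n) = (\<Sum>j<n. c j * \<phi> (z \<otimes> u [^] j))"
  using assms by (induction n) (auto simp: state_zero r_distr smult_mult_right state_add state_smult)

lemma star_zero: "star \<zero> = \<zero>"
  using star_add[of \<zero> \<zero>] star_closed[of \<zero>] add.r_cancel_one[of "star \<zero>" "star \<zero>"] by simp

lemma state_star_power_sum_mult:
  assumes "u \<in> carrier A" "z \<in> carrier A"
  shows "\<phi> (star (power_sum u c n) \<otimes> z) = (\<Sum>j<n. cnj (c j) * \<phi> (star (u [^] j) \<otimes> z))"
  using assms
  by (induction n)
     (auto simp: state_zero star_zero star_add star_smult star_closed l_distr smult_mult_left
         state_add state_smult)

text \<open>Positivity of the state on \<open>(\<Sum> c\<^sub>j u\<^sup>j)\<^sup>* (\<Sum> c\<^sub>j u\<^sup>j)\<close> is positive definiteness of the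
  moments.\<close>

lemma unitary_has_distribution:
  assumes u: "u \<in> unitary_elements A star"
  shows "\<exists>\<rho>. has_unitary_distribution A \<phi> u \<rho>"
proof -
  have c: "u \<in> carrier A" using u by (rule unitary_closed)
  have U: "u \<in> Units A" using unitary_in_Units u by blast
  have "(\<Sum>j<N. \<Sum>k<N. \<phi> (u [^] (int j - int k)) * c j * cnj (c k)) \<in> \<real>\<^sub>\<ge>\<^sub>0" for N c
  proof -
    have "\<phi> (star (u [^] k) \<otimes> u [^] j) = \<phi> (u [^] (int j - int k))" for j k
      using int_pow_add_Units[OF U, of "- int k" "int j"] c
      by (simp add: unitary_int_pow[OF u] star_nat_pow int_pow_int)
    hence "(\<Sum>j<N. \<Sum>k<N. \<phi> (u [^] (int j - int k)) * c j * cnj (c k))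
        = \<phi> (star (power_sum u c N) \<otimes> power_sum u c N)"
      using c by (simp add: state_mult_power_sum star_closed state_star_power_sum_mult
          sum_distrib_left mult_ac)
    also have "\<dots> \<in> \<real>\<^sub>\<ge>\<^sub>0" using c by (intro state_pos) simp
    finally show ?thesis .
  qed
  moreover have "\<phi> (u [^] (0::int)) = 1" by (simp add: state_one)
  ultimately obtain \<rho> where \<rho>: "\<rho> \<in> circle_prob" "\<And>k::nat. circle_moment \<rho> (int k) = \<phi> (u [^] (int k))"
    using herglotz_positive_definite[of "\<lambda>k. \<phi> (u [^] k)"] by blast
  have "circle_moment \<rho> k = \<phi> (u [^] k)" for k
  proof (cases k rule: int_cases2)
    case (nonneg n)
    thus ?thesis using \<rho>(2) by simp
  next
    case (nonpos n)
    have "\<phi> (u [^] (- int n)) = cnj (\<phi> (u [^] (int n)))"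
      using c by (simp add: unitary_int_pow[OF u] int_pow_int star_nat_pow[symmetric] state_star)
    thus ?thesis using \<rho> nonpos by (simp add: circle_moment_uminus)
  qed
  thus ?thesis using \<rho>(1) unfolding has_unitary_distribution_def circle_moment_def by auto
qed

lemma state_mult_free:
  assumes U: "\<And>b. U b \<in> unitary_elements A star"
    and free: "free_subalgebras A \<phi> (\<lambda>b::bool. generated_star_subalgebra A star {U b})"
  shows "\<phi> (U True \<otimes> U False) = \<phi> (U True) * \<phi> (U False)"
proof -
  have c: "U b \<in> carrier A" for b using U by (rule unitary_closed)
  have 1: "U b [^] (1::int) = U b" for b using c by (simp add: int_pow_def2 del: pow_nat)
  show ?thesis
    using free_centered_value_0[OF U free, of "[(True, 1), (False, 1)]"] c
    by (simp add: 1 state_one algebra_simps)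
qed

text \<open>Centering the letters of the alternating word \<open>(u v)\<^sup>k\<close> changes its value by little if \<open>u\<close>
  and \<open>v\<close> are almost centered, and the product of the centered letters has value zero.\<close>

lemma norm_state_power_free_le:
  assumes U: "\<And>b. U b \<in> unitary_elements A star"
    and free: "free_subalgebras A \<phi> (\<lambda>b::bool. generated_star_subalgebra A star {U b})"
    and e: "\<And>b. norm (\<phi> (U b)) \<le> e" "e \<le> 1" and k: "k > 0"
  shows "norm (\<phi> ((U True \<otimes> U False) [^] (k::nat))) \<le> e * 4 ^ k"
proof -
  let ?ws = "concat (replicate k [(True, 1::int), (False, 1)])"
  have 1: "U b [^] (1::int) = U b" for b using unitary_closed[OF U] by (simp add: int_pow_def2 del:
      pow_nat)
  have set: "set ?ws \<subseteq> {(True, 1), (False, 1)}" by auto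
  have len: "length ?ws = 2 * k" by (simp add: length_concat sum_list_replicate)
  have adj: "distinct_adj (map fst (concat (replicate j [(True, 1::int), (False, 1)]))) \<and>
     (j > 0 \<longrightarrow> map fst (concat (replicate j [(True, 1::int), (False, 1)])) \<noteq> [] \<and> hd (map fst (concat
         (replicate j [(True, 1::int), (False, 1)])))) " for j
    by (induction j) (auto simp: distinct_adj_Cons)
  have "?ws \<noteq> []" using k by (cases k) auto
  hence "centered_value (\<lambda>ws. \<phi> (word_prod U ws)) (\<lambda>(i, k). \<phi> (U i [^] k)) [] ?ws = 0"
    using adj by (intro free_centered_value_0[OF U free]) auto
  moreover have "norm (centered_value (\<lambda>ws. \<phi> (word_prod U ws)) (\<lambda>(i, k). \<phi> (U i [^] k)) [] ?ws - \<phi>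
      (word_prod U ([] @ ?ws))) \<le> e * 2 ^ length ?ws"
  proof (intro norm_centered_value_diff_le[THEN conjunct2])
    show "norm (\<phi> (word_prod U ws)) \<le> 1" for ws by (intro norm_state_unitary_le_1 word_prod_unitary U)
    show "norm (case x of (i, k) \<Rightarrow> \<phi> (U i [^] k)) \<le> e" if "x \<in> set ?ws" for x
      using that set e(1) by (auto simp: 1)
    show "0 \<le> e" using e(1)[of True] norm_ge_zero order_trans by blast
  qed (rule e(2))
  ultimately have "norm (\<phi> (word_prod U ?ws)) \<le> e * 2 ^ (2 * k)" by (simp add: len)
  thus ?thesis unfolding word_prod_replicate_pair[OF U] by (simp add: power_mult)
qed

end

section \<open>Free vector spaces and hermitian kernels\<close>

abbreviation lookup :: "('k \<Rightarrow>\<^sub>0 complex) \<Rightarrow> 'k \<Rightarrow> complex" where "lookup \<equiv> Poly_Mapping.lookup"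

abbreviation keys :: "('k \<Rightarrow>\<^sub>0 complex) \<Rightarrow> 'k set" where "keys \<equiv> Poly_Mapping.keys"

definition scal :: "complex \<Rightarrow> ('k \<Rightarrow>\<^sub>0 complex) \<Rightarrow> 'k \<Rightarrow>\<^sub>0 complex" where
  "scal c x = Poly_Mapping.map ((*) c) x"

abbreviation basis :: "'k \<Rightarrow> 'k \<Rightarrow>\<^sub>0 complex" where
  "basis k \<equiv> Poly_Mapping.single k 1"

lemma lookup_scal [simp]: "lookup (scal c x) k = c * lookup x k"
  by (simp add: scal_def Poly_Mapping.map.rep_eq when_def)

lemma scal_add_right: "scal c (x + y) = scal c x + scal c y"
  and scal_add_left: "scal (c + d) x = scal c x + scal d x"
  and scal_scal [simp]: "scal c (scal d x) = scal (c * d) x"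
  and scal_one [simp]: "scal 1 x = x"
  and scal_zero_left [simp]: "scal 0 x = 0"
  and scal_zero_right [simp]: "scal c (0 :: 'k \<Rightarrow>\<^sub>0 complex) = 0"
  by (auto intro!: poly_mapping_eqI simp: lookup_add lookup_minus algebra_simps)

lemma keys_scal: "keys (scal c x) \<subseteq> keys x"
  by (auto simp: in_keys_iff)

definition lin_ext :: "('k \<Rightarrow> 'l \<Rightarrow>\<^sub>0 complex) \<Rightarrow> ('k \<Rightarrow>\<^sub>0 complex) \<Rightarrow> 'l \<Rightarrow>\<^sub>0 complex" where
  "lin_ext f x = (\<Sum>k\<in>keys x. scal (lookup x k) (f k))"

lemma lin_ext_superset:
  assumes "finite X" "keys x \<subseteq> X"
  shows "lin_ext f x = (\<Sum>k\<in>X. scal (lookup x k) (f k))"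
  unfolding lin_ext_def using assms
  by (intro sum.mono_neutral_left) (auto simp: not_in_keys_iff_lookup_eq_zero)

definition vec_linear :: "(('k \<Rightarrow>\<^sub>0 complex) \<Rightarrow> ('l \<Rightarrow>\<^sub>0 complex)) \<Rightarrow> bool" where
  "vec_linear T \<longleftrightarrow> (\<forall>x y. T (x + y) = T x + T y) \<and> (\<forall>c x. T (scal c x) = scal c (T x))"

lemma vec_linear_lin_ext:
  fixes f :: "'a \<Rightarrow> 'b \<Rightarrow>\<^sub>0 complex"
  shows "vec_linear (lin_ext f)"
  unfolding vec_linear_def
proof (intro conjI allI)
  fix x y :: "'a \<Rightarrow>\<^sub>0 complex" and c :: complex
  have fin: "finite (keys x \<union> keys y)" by simp
  have "lin_ext f (x + y) = (\<Sum>k\<in>keys x \<union> keys y. scal (lookup (x + y) k) (f k))"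
    by (rule lin_ext_superset[OF fin keys_add])
  also have "\<dots> = lin_ext f x + lin_ext f y"
    unfolding lin_ext_superset[OF fin Un_upper1] lin_ext_superset[OF fin Un_upper2]
    by (simp add: lookup_add scal_add_left sum.distrib)
  finally show "lin_ext f (x + y) = lin_ext f x + lin_ext f y" .
  have sum: "scal c (sum g X) = (\<Sum>k\<in>X. scal c (g k))" if "finite X" for X :: "'a set" and g :: "'a \<Rightarrow>
      'b \<Rightarrow>\<^sub>0 complex"
    using that by (induction X) (auto simp: scal_add_right)
  show "lin_ext f (scal c x) = scal c (lin_ext f x)"
    unfolding lin_ext_superset[OF finite_keys keys_scal] by (simp add: lin_ext_def sum)
qed

lemma lin_ext_basis [simp]: "lin_ext f (basis k) = f k"
  by (simp add: lin_ext_def)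

lemma vec_linear_zero: "vec_linear T \<Longrightarrow> T 0 = 0"
  using scal_zero_left by (metis vec_linear_def)

lemma vec_linear_diff:
  assumes "vec_linear T" shows "T (x - y) = T x - T y"
proof -
  have "T x = T ((x - y) + y)" by simp
  also have "\<dots> = T (x - y) + T y" using assms unfolding vec_linear_def by blast
  finally show ?thesis by simp
qed

lemma basis_expansion: "x = (\<Sum>k\<in>keys x. scal (lookup x k) (basis k))"
  by (auto intro!: poly_mapping_eqI simp: lookup_sum lookup_single when_def if_distrib[of "(*) _"]
      sum.delta'
        not_in_keys_iff_lookup_eq_zero cong: if_cong)

lemma span_induct [consumes 1, case_names basis zero scal add]:
  assumes keys: "keys x \<subseteq> S"
    and basis: "\<And>k. k \<in> S \<Longrightarrow> P (basis k)" and zero: "P 0"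
    and scal: "\<And>c x. P x \<Longrightarrow> P (scal c x)" and add: "\<And>x y. P x \<Longrightarrow> P y \<Longrightarrow> P (x + y)"
  shows "P x"
proof -
  have *: "P (\<Sum>k\<in>X. scal (lookup x k) (basis k))" if "finite X" "X \<subseteq> S" for X
    using that
  proof (induction X)
    case (insert k X)
    thus ?case by (auto intro!: add scal basis)
  qed (simp add: zero)
  show ?thesis by (subst basis_expansion) (rule *[OF finite_keys keys])
qed

lemma basis_induct [case_names basis zero scal add]:
  assumes "\<And>k. P (basis k)" "P 0" "\<And>c x. P x \<Longrightarrow> P (scal c x)" "\<And>x y. P x \<Longrightarrow> P y \<Longrightarrow> P (x + y)"
  shows "P x"
  by (rule span_induct[of x UNIV]) (use assms in auto)

lemma vec_linear_eqI:
  assumes "vec_linear S" "vec_linear T" "\<And>k. S (basis k) = T (basis k)"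
  shows "S x = T x"
  using assms by (induction x rule: basis_induct) (auto simp: vec_linear_def vec_linear_zero[OF
      assms(1)] vec_linear_zero[OF assms(2)])

definition kernel_form :: "('k \<Rightarrow> 'k \<Rightarrow> complex) \<Rightarrow> ('k \<Rightarrow>\<^sub>0 complex) \<Rightarrow> ('k \<Rightarrow>\<^sub>0 complex) \<Rightarrow> complex" where
  "kernel_form \<kappa> x y = (\<Sum>k\<in>keys x. \<Sum>l\<in>keys y. lookup x k * cnj (lookup y l) * \<kappa> k l)"

lemma kernel_form_superset:
  assumes "finite X" "keys x \<subseteq> X" "finite Y" "keys y \<subseteq> Y"
  shows "kernel_form \<kappa> x y = (\<Sum>k\<in>X. \<Sum>l\<in>Y. lookup x k * cnj (lookup y l) * \<kappa> k l)"
proof -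
  have "(\<Sum>k\<in>X. \<Sum>l\<in>Y. lookup x k * cnj (lookup y l) * \<kappa> k l) = (\<Sum>k\<in>X. \<Sum>l\<in>keys y. lookup x k * cnj
      (lookup y l) * \<kappa> k l)"
    using assms by (intro sum.cong refl sum.mono_neutral_right) (auto simp: in_keys_iff)
  also have "\<dots> = kernel_form \<kappa> x y"
    unfolding kernel_form_def using assms by (intro sum.mono_neutral_right) (auto simp: in_keys_iff)
  finally show ?thesis ..
qed

lemma kernel_form_add_left: "kernel_form \<kappa> (x + x') y = kernel_form \<kappa> x y + kernel_form \<kappa> x' y"
proof -
  have fin: "finite (keys x \<union> keys x')" by simp
  show ?thesis
    unfolding kernel_form_superset[OF fin keys_add finite_keys order_refl]
      kernel_form_superset[OF fin Un_upper1 finite_keys order_refl]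
      kernel_form_superset[OF fin Un_upper2 finite_keys order_refl]
    by (simp add: lookup_add sum.distrib algebra_simps)
qed

lemma kernel_form_scal_left: "kernel_form \<kappa> (scal c x) y = c * kernel_form \<kappa> x y"
  unfolding kernel_form_superset[OF finite_keys keys_scal finite_keys order_refl]
  by (simp add: kernel_form_def sum_distrib_left mult.assoc)

lemma kernel_form_zero [simp]: "kernel_form \<kappa> 0 y = 0" "kernel_form \<kappa> x 0 = 0"
  by (simp_all add: kernel_form_def)

lemma kernel_form_cnj:
  assumes "\<And>k l. \<kappa> l k = cnj (\<kappa> k l)"
  shows "kernel_form \<kappa> y x = cnj (kernel_form \<kappa> x y)"
  unfolding kernel_form_def
  by (subst sum.swap) (simp add: assms[symmetric] mult_ac)

lemma kernel_form_basis [simp]: "kernel_form \<kappa> (basis k) (basis l) = \<kappa> k l"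
  by (simp add: kernel_form_def)

section \<open>Positive semidefinite kernels\<close>

definition psd_kernel :: "'k set \<Rightarrow> ('k \<Rightarrow> 'k \<Rightarrow> complex) \<Rightarrow> bool" where
  "psd_kernel X \<kappa> \<longleftrightarrow> (\<forall>c. (\<Sum>x\<in>X. \<Sum>y\<in>X. c x * cnj (c y) * \<kappa> x y) \<in> \<real>\<^sub>\<ge>\<^sub>0)"

lemma psd_kernel_cong:
  assumes "\<And>x y. x \<in> X \<Longrightarrow> y \<in> X \<Longrightarrow> \<kappa> x y = \<kappa>' x y"
  shows "psd_kernel X \<kappa> \<longleftrightarrow> psd_kernel X \<kappa>'"
  unfolding psd_kernel_def using assms by (auto intro!: arg_cong2[of _ _ _ _ "(\<in>)"] cong: sum.cong)

text \<open>The coefficients of all points with the same image add up.\<close>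

lemma psd_kernel_pullback:
  fixes f :: "'a \<Rightarrow> 'b"
  assumes X: "finite X" and \<kappa>: "psd_kernel (f ` X) \<kappa>"
  shows "psd_kernel X (\<lambda>x y. \<kappa> (f x) (f y))"
  unfolding psd_kernel_def
proof
  fix c :: "'a \<Rightarrow> complex"
  define d where "d u = (\<Sum>x | x \<in> X \<and> f x = u. c x)" for u
  have "(\<Sum>x\<in>X. \<Sum>y\<in>X. c x * cnj (c y) * \<kappa> (f x) (f y))
      = (\<Sum>u\<in>f ` X. \<Sum>x | x \<in> X \<and> f x = u. \<Sum>v\<in>f ` X. \<Sum>y | y \<in> X \<and> f y = v. c x * cnj (c y) * \<kappa> (f x)
          (f y))"
    by (simp only: sum.image_gen[OF X, of _ f])
  also have "\<dots> = (\<Sum>u\<in>f ` X. \<Sum>v\<in>f ` X. d u * cnj (d v) * \<kappa> u v)"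
  proof (intro sum.cong refl)
    fix u
    have "(\<Sum>x | x \<in> X \<and> f x = u. \<Sum>v\<in>f ` X. \<Sum>y | y \<in> X \<and> f y = v. c x * cnj (c y) * \<kappa> (f x) (f y))
       = (\<Sum>v\<in>f ` X. \<Sum>x | x \<in> X \<and> f x = u. \<Sum>y | y \<in> X \<and> f y = v. c x * cnj (c y) * \<kappa> u v)"
      by (subst sum.swap) (intro sum.cong refl, auto)
    also have "\<dots> = (\<Sum>v\<in>f ` X. d u * cnj (d v) * \<kappa> u v)"
      by (simp add: d_def sum_product) (simp add: sum_distrib_right)
    finally show "(\<Sum>x | x \<in> X \<and> f x = u. \<Sum>v\<in>f ` X. \<Sum>y | y \<in> X \<and> f y = v. c x * cnj (c y) * \<kappa> (f x)
        (f y))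
       = (\<Sum>v\<in>f ` X. d u * cnj (d v) * \<kappa> u v)" .
  qed
  also have "\<dots> \<in> \<real>\<^sub>\<ge>\<^sub>0" using \<kappa> by (auto simp: psd_kernel_def)
  finally show "(\<Sum>x\<in>X. \<Sum>y\<in>X. c x * cnj (c y) * \<kappa> (f x) (f y)) \<in> \<real>\<^sub>\<ge>\<^sub>0" .
qed

lemma psd_kernel_scale:
  fixes X :: "'a set"
  assumes "psd_kernel X \<kappa>"
  shows "psd_kernel X (\<lambda>x y. g x * cnj (g y) * \<kappa> x y)"
  unfolding psd_kernel_def
proof
  fix c :: "'a \<Rightarrow> complex"
  have "(\<Sum>x\<in>X. \<Sum>y\<in>X. (c x * g x) * cnj (c y * g y) * \<kappa> x y) \<in> \<real>\<^sub>\<ge>\<^sub>0"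
    using assms unfolding psd_kernel_def by (rule spec)
  thus "(\<Sum>x\<in>X. \<Sum>y\<in>X. c x * cnj (c y) * (g x * cnj (g y) * \<kappa> x y)) \<in> \<real>\<^sub>\<ge>\<^sub>0"
    by (simp add: mult_ac)
qed

lemma psd_kernel_add:
  assumes "psd_kernel X \<kappa>" "psd_kernel X \<kappa>'"
  shows "psd_kernel X (\<lambda>x y. \<kappa> x y + \<kappa>' x y)"
  using assms unfolding psd_kernel_def
  by (auto simp: distrib_left sum.distrib intro!: nonneg_Reals_add_I)

lemma psd_kernel_sum:
  assumes "finite I" "\<And>i. i \<in> I \<Longrightarrow> psd_kernel X (\<kappa> i)"
  shows "psd_kernel X (\<lambda>x y. \<Sum>i\<in>I. \<kappa> i x y)"
  using assms
proof (induction I)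
  case empty
  thus ?case by (simp add: psd_kernel_def)
next
  case (insert i I)
  thus ?case by (simp add: psd_kernel_add)
qed

lemma psd_kernel_integral:
  fixes X :: "'a set"
  assumes int: "\<And>x y. integrable M (\<lambda>\<zeta>. \<kappa> \<zeta> x y)" and psd: "\<And>\<zeta>. psd_kernel X (\<kappa> \<zeta>)"
  shows "psd_kernel X (\<lambda>x y. \<integral>\<zeta>. \<kappa> \<zeta> x y \<partial>M)"
  unfolding psd_kernel_def
proof
  fix c :: "'a \<Rightarrow> complex"
  let ?S = "\<lambda>\<zeta>. \<Sum>x\<in>X. \<Sum>y\<in>X. c x * cnj (c y) * \<kappa> \<zeta> x y"
  have "(\<Sum>x\<in>X. \<Sum>y\<in>X. c x * cnj (c y) * (\<integral>\<zeta>. \<kappa> \<zeta> x y \<partial>M)) = (\<integral>\<zeta>. ?S \<zeta> \<partial>M)"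
    by (simp add: int)
  also have "\<dots> = (\<integral>\<zeta>. of_real (Re (?S \<zeta>)) \<partial>M)"
  proof (intro Bochner_Integration.integral_cong refl)
    fix \<zeta>
    have "?S \<zeta> \<in> \<real>\<^sub>\<ge>\<^sub>0" using psd by (simp add: psd_kernel_def)
    then obtain r where "?S \<zeta> = of_real r" by (auto simp: nonneg_Reals_def)
    thus "?S \<zeta> = of_real (Re (?S \<zeta>))" by (simp only: Re_complex_of_real)
  qed
  also have "\<dots> = of_real (\<integral>\<zeta>. Re (?S \<zeta>) \<partial>M)" by (rule integral_complex_of_real)
  also have "\<dots> \<in> \<real>\<^sub>\<ge>\<^sub>0"
  proof -
    have "Re (?S \<zeta>) \<ge> 0" for \<zeta>
    proof -
      have "?S \<zeta> \<in> \<real>\<^sub>\<ge>\<^sub>0" using psd by (simp add: psd_kernel_def)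
      then obtain r where "?S \<zeta> = of_real r" "r \<ge> 0" by (auto simp: nonneg_Reals_def)
      thus ?thesis by (simp only: Re_complex_of_real)
    qed
    thus ?thesis by (simp add: nonneg_Reals_of_real_iff)
  qed
  finally show "(\<Sum>x\<in>X. \<Sum>y\<in>X. c x * cnj (c y) * (\<integral>\<zeta>. \<kappa> \<zeta> x y \<partial>M)) \<in> \<real>\<^sub>\<ge>\<^sub>0" .
qed

section \<open>The free product form\<close>

text \<open>The word \<open>(i\<^sub>1,k\<^sub>1) \<dots> (i\<^sub>n,k\<^sub>n)\<close> stands for the product of the centered powers
  \<open>u\<^sub>i\<^sup>k - p i k\<close>, where \<open>u\<^sub>i\<close> is the unitary with distribution \<open>m i\<close>. In a free product these
  vectors have inner products that factorize over the letters, with a factor zero wherever the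
  indices differ; this is the kernel \<open>gram\<close> below. It is defined on all lists, also on those that
  are not alternating or contain an exponent zero.\<close>

type_synonym word = "(nat \<times> int) list"

locale free_product =
  fixes m :: "nat \<Rightarrow> complex measure"
  assumes m: "\<And>i. m i \<in> circle_prob"
begin

definition p :: "nat \<Rightarrow> int \<Rightarrow> complex" where "p i k = circle_moment (m i) k"

lemma p_0 [simp]: "p i 0 = 1" by (simp add: p_def circle_moment_0 m)

lemma p_uminus: "p i (- k) = cnj (p i k)" by (simp add: p_def circle_moment_uminus m)

fun gram :: "word \<Rightarrow> word \<Rightarrow> complex" where
  "gram [] [] = 1"
| "gram ((i, k) # w) ((j, l) # w') = (if i = j then (p i (k - l) - p i k * cnj (p i l)) * gram w w'
    else 0)"
| "gram _ _ = 0"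

lemma gram_Nil_Cons [simp]: "gram [] (x # w) = 0" "gram (x # w) [] = 0"
  by (cases x; simp)+

lemma gram_cnj: "gram w' w = cnj (gram w w')"
proof (induction w w' rule: gram.induct)
  case (2 i k w j l w')
  have "p i (l - k) = cnj (p i (k - l))" using p_uminus[of i "k - l"] by simp
  thus ?case using 2 by auto
qed auto

lemma gram_moment:
  "(\<integral>\<zeta>. (\<zeta> powi k - p i k) * cnj (\<zeta> powi l - p i l) \<partial>m i) = p i (k - l) - p i k * cnj (p i l)"
  and integrable_gram: "integrable (m i) (\<lambda>\<zeta>. (\<zeta> powi k - p i k) * cnj (\<zeta> powi l - p i l))"
proof -
  show "integrable (m i) (\<lambda>\<zeta>. (\<zeta> powi k - p i k) * cnj (\<zeta> powi l - p i l))"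
    by (intro integrable_circle_prob m continuous_intros)
  interpret prob_space "m i" using m by (rule prob_space_circle_prob)
  note i = integrable_powi[OF m]
  have "(\<integral>\<zeta>. (\<zeta> powi k - p i k) * cnj (\<zeta> powi l - p i l) \<partial>m i)
     = (\<integral>\<zeta>. \<zeta> powi (k - l) - p i k * \<zeta> powi (- l) - cnj (p i l) * \<zeta> powi k + p i k * cnj (p i l) \<partial>m i)"
  proof (intro Bochner_Integration.integral_cong refl)
    fix \<zeta> assume "\<zeta> \<in> space (m i)"
    hence \<zeta>: "\<zeta> \<in> unit_circle" "\<zeta> \<noteq> 0" by (auto simp: space_circle_prob[OF m])
    have "cnj (\<zeta> powi l) = \<zeta> powi (- l)"
      using cnj_unit_circle[OF \<zeta>(1)] by (simp add: power_int_minus power_int_inverse)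
    moreover have "\<zeta> powi (k - l) = \<zeta> powi k * \<zeta> powi (- l)"
      using \<zeta>(2) power_int_add[of \<zeta> k "- l"] by simp
    ultimately show "(\<zeta> powi k - p i k) * cnj (\<zeta> powi l - p i l)
      = \<zeta> powi (k - l) - p i k * \<zeta> powi (- l) - cnj (p i l) * \<zeta> powi k + p i k * cnj (p i l)"
      by (simp add: algebra_simps)
  qed
  also have "\<dots> = p i (k - l) - p i k * p i (- l) - cnj (p i l) * p i k + p i k * cnj (p i l)"
    by (simp only: Bochner_Integration.integral_add Bochner_Integration.integral_diff
        integrable_mult_right i
        Bochner_Integration.integrable_diff integrable_const integral_mult_right_zero p_def
            circle_moment_def lebesgue_integral_const prob_space scaleR_one)
  finally show "(\<integral>\<zeta>. (\<zeta> powi k - p i k) * cnj (\<zeta> powi l - p i l) \<partial>m i) = p i (k - l) - p i k * cnj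
      (p i l)"
    by (simp add: p_uminus)
qed

text \<open>Peeling off the first letter writes the kernel as a sum over the index of that letter of
  integrals of rank one multiples of the kernel of the tails, so that positivity is inherited from
  shorter words.\<close>

lemma psd_gram:
  assumes "finite X"
  shows "psd_kernel X gram"
proof -
  have "psd_kernel X gram" if "finite X" "\<And>w. w \<in> X \<Longrightarrow> length w \<le> N" for N X
    using that
  proof (induction N arbitrary: X)
    case 0
    hence "psd_kernel X gram \<longleftrightarrow> psd_kernel X (\<lambda>x y. 1 * cnj 1 * 1)"
      by (intro psd_kernel_cong) (use "0.prems"(2) in fastforce)
    moreover have "psd_kernel X (\<lambda>x y. 1)"
      unfolding psd_kernel_def
    proof
      fix c
      have "(\<Sum>x\<in>X. \<Sum>y\<in>X. c x * cnj (c y) * 1) = sum c X * cnj (sum c X)"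
        by (simp add: sum_product)
      also have "\<dots> = of_real ((norm (sum c X))\<^sup>2)" by (rule complex_norm_square[symmetric])
      finally show "(\<Sum>x\<in>X. \<Sum>y\<in>X. c x * cnj (c y) * 1) \<in> \<real>\<^sub>\<ge>\<^sub>0" by simp
    qed
    ultimately show ?case by simp
  next
    case (Suc N)
    define I where "I = (fst \<circ> hd) ` X"
    \<comment> \<open>\<open>g i\<close> selects the words with first index \<open>i\<close>, and \<open>e\<close> below the empty word\<close>
    define g where "g i \<zeta> w = (if w \<noteq> [] \<and> fst (hd w) = i then \<zeta> powi snd (hd w) - p i (snd (hd w))
        else 0)" for i \<zeta> and w :: word
    define e where "e w = (if w = [] then 1 else 0 :: complex)" for w :: word
    have tails: "psd_kernel X (\<lambda>x y. gram (tl x) (tl y))"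
    proof (rule psd_kernel_pullback[OF Suc.prems(1)], rule Suc.IH)
      show "finite (tl ` X)" using Suc.prems(1) by simp
      show "length w \<le> N" if w: "w \<in> tl ` X" for w
      proof -
        obtain u where "u \<in> X" "w = tl u" using w by blast
        thus ?thesis using Suc.prems(2)[of u] by simp
      qed
    qed
    have int: "integrable (m i) (\<lambda>\<zeta>. g i \<zeta> x * cnj (g i \<zeta> y) * gram (tl x) (tl y))" for i x y
    proof (rule integrable_mult_left)
      show "integrable (m i) (\<lambda>\<zeta>. g i \<zeta> x * cnj (g i \<zeta> y))"
        using integrable_gram[of i "snd (hd x)" "snd (hd y)"]
        by (cases "x \<noteq> [] \<and> fst (hd x) = i"; cases "y \<noteq> [] \<and> fst (hd y) = i") (simp_all only: g_def
            if_True if_False mult_zero_left mult_zero_right complex_cnj_zero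
              Bochner_Integration.integrable_zero simp_thms)
    qed
    have "psd_kernel X (\<lambda>x y. \<Sum>i\<in>I. \<integral>\<zeta>. g i \<zeta> x * cnj (g i \<zeta> y) * gram (tl x) (tl y) \<partial>m i)"
    proof (rule psd_kernel_sum)
      show "finite I" by (simp add: I_def Suc.prems)
      show "psd_kernel X (\<lambda>x y. \<integral>\<zeta>. g i \<zeta> x * cnj (g i \<zeta> y) * gram (tl x) (tl y) \<partial>m i)" for i
        by (rule psd_kernel_integral[OF int psd_kernel_scale[OF tails]])
    qed
    note psd_kernel_add[OF psd_kernel_scale[OF tails, of e] this]
    moreover have "e x * cnj (e y) * gram (tl x) (tl y) + (\<Sum>i\<in>I. \<integral>\<zeta>. g i \<zeta> x * cnj (g i \<zeta> y) * gram
        (tl x) (tl y) \<partial>m i) = gram x y"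
      if xy: "x \<in> X" "y \<in> X" for x y
    proof (cases "x = [] \<or> y = []")
      case True
      hence "(\<Sum>i\<in>I. \<integral>\<zeta>. g i \<zeta> x * cnj (g i \<zeta> y) * gram (tl x) (tl y) \<partial>m i) = 0"
        by (intro sum.neutral ballI) (auto simp: g_def)
      thus ?thesis using True by (cases x; cases y) (auto simp: e_def)
    next
      case False
      then obtain i k w j l w' where x: "x = (i, k) # w" and y: "y = (j, l) # w'"
        by (metis list.exhaust surj_pair)
      have "i \<in> I" using xy(1) x by (force simp: I_def)
      have "(\<Sum>i'\<in>I. \<integral>\<zeta>. g i' \<zeta> x * cnj (g i' \<zeta> y) * gram (tl x) (tl y) \<partial>m i')
        = (\<Sum>i'\<in>I. if i' = i then gram x y else 0)"
      proof (intro sum.cong refl)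
        fix i'
        show "(\<integral>\<zeta>. g i' \<zeta> x * cnj (g i' \<zeta> y) * gram (tl x) (tl y) \<partial>m i') = (if i' = i then gram x y
            else 0)"
          using gram_moment[where i = i and k = k and l = l] by (auto simp: g_def x y)
      qed
      also have "\<dots> = gram x y" using \<open>i \<in> I\<close> Suc.prems(1) by (simp add: I_def)
      finally show ?thesis by (simp add: e_def x)
    qed
    ultimately show ?case
      using psd_kernel_cong[of X "\<lambda>x y. e x * cnj (e y) * gram (tl x) (tl y) + (\<Sum>i\<in>I. \<integral>\<zeta>. g i \<zeta> x *
          cnj (g i \<zeta> y) * gram (tl x) (tl y) \<partial>m i)" gram] by blast
  qed
  moreover have "length w \<le> Max (length ` X)" if "w \<in> X" for w using that assms by simp
  ultimately show ?thesis using assms by blast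
qed

definition form :: "(word \<Rightarrow>\<^sub>0 complex) \<Rightarrow> (word \<Rightarrow>\<^sub>0 complex) \<Rightarrow> complex" where
  "form = kernel_form gram"

lemma form_add_left: "form (x + x') y = form x y + form x' y"
  unfolding form_def by (rule kernel_form_add_left)

lemma form_scal_left: "form (scal c x) y = c * form x y"
  unfolding form_def by (rule kernel_form_scal_left)

lemma form_cnj: "form y x = cnj (form x y)"
  unfolding form_def by (rule kernel_form_cnj[OF gram_cnj])

lemma form_zero [simp]: "form 0 y = 0" "form x 0 = 0"
  and form_basis [simp]: "form (basis w) (basis w') = gram w w'"
  by (simp_all add: form_def)

lemma form_add_right: "form x (y + y') = form x y + form x y'"
  by (metis form_add_left form_cnj complex_cnj_add)

lemma form_scal_right: "form x (scal c y) = cnj c * form x y"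
  by (metis form_scal_left form_cnj complex_cnj_mult)

lemma form_diff_left: "form (x - x') y = form x y - form x' y"
  using form_add_left[of "x - x'" x' y] by simp

lemma form_diff_right: "form x (y - y') = form x y - form x y'"
  using form_add_right[of x "y - y'" y'] by simp

lemmas form_sesquilinear = form_add_left form_add_right form_scal_left form_scal_right
    form_diff_left form_diff_right

lemma form_nonneg: "form x x \<in> \<real>\<^sub>\<ge>\<^sub>0"
  using psd_gram[of "keys x"] unfolding form_def kernel_form_def psd_kernel_def by simp

lemma form_vacuum: "form x (basis []) = lookup x []"
proof (induction x rule: basis_induct)
  case (basis k)
  thus ?case by (cases k) (auto simp: lookup_single when_def)
qed (auto simp: form_sesquilinear lookup_add)

end

context free_product
begin

section \<open>The unitary operators of the model\<close>

definition head_free :: "nat \<Rightarrow> word \<Rightarrow> bool" where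
  "head_free i w \<longleftrightarrow> w = [] \<or> fst (hd w) \<noteq> i"

lemma head_free_simps [simp]: "head_free i []" "head_free i ((j, k) # w) \<longleftrightarrow> j \<noteq> i"
  by (auto simp: head_free_def)

text \<open>The vector of \<open>u\<^sub>i\<^sup>k\<close>, not centered, in front of \<open>w\<close>. The centered power with exponent \<open>0\<close>
  is the zero vector, whence the case distinction.\<close>

definition prepend :: "nat \<Rightarrow> int \<Rightarrow> word \<Rightarrow> word \<Rightarrow>\<^sub>0 complex" where
  "prepend i k w = (if k = 0 then 0 else basis ((i, k) # w)) + scal (p i k) (basis w)"

lemma prepend_0 [simp]: "prepend i 0 w = basis w"
  by (simp add: prepend_def)

lemma basis_Cons_eq: "k \<noteq> 0 \<Longrightarrow> basis ((i, k) # w) = prepend i k w - scal (p i k) (prepend i 0 w)"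
  by (simp add: prepend_def)

text \<open>Left multiplication by \<open>u\<^sub>i\<^sup>n\<close>: in terms of the vectors \<open>prepend i k w\<close> it is \<open>k \<mapsto> n + k\<close>.
  Words that start with an exponent \<open>0\<close> at \<open>i\<close>, or with the index \<open>i\<close> twice, have no meaning in
  the free product. They are fixed, which keeps the maps bijective on the whole space.\<close>

definition shift_basis :: "nat \<Rightarrow> int \<Rightarrow> word \<Rightarrow> word \<Rightarrow>\<^sub>0 complex" where
  "shift_basis i n w =
     (if head_free i w then prepend i n w
      else if snd (hd w) \<noteq> 0 \<and> head_free i (tl w)
        then prepend i (n + snd (hd w)) (tl w) - scal (p i (snd (hd w))) (prepend i n (tl w))
      else basis w)"

definition shift :: "nat \<Rightarrow> int \<Rightarrow> (word \<Rightarrow>\<^sub>0 complex) \<Rightarrow> (word \<Rightarrow>\<^sub>0 complex)" where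
  "shift i n = lin_ext (shift_basis i n)"

lemma vec_linear_shift: "vec_linear (shift i n)"
  unfolding shift_def by (rule vec_linear_lin_ext)

lemmas shift_linear =
  vec_linear_shift[unfolded vec_linear_def, THEN conjunct1, rule_format]
  vec_linear_shift[unfolded vec_linear_def, THEN conjunct2, rule_format]
  vec_linear_diff[OF vec_linear_shift] vec_linear_zero[OF vec_linear_shift]

lemma shift_basis_eq: "shift i n (basis w) = shift_basis i n w"
  by (simp add: shift_def)

lemma shift_prepend:
  assumes "head_free i w"
  shows "shift i n (prepend i k w) = prepend i (n + k) w"
proof (cases "k = 0")
  case True
  thus ?thesis using assms by (simp add: shift_basis_eq shift_basis_def)
next
  case False
  have "shift i n (prepend i k w) = (prepend i (n + k) w - scal (p i k) (prepend i n w)) + scal (p i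
      k) (prepend i n w)"
    using False assms by (subst (1) prepend_def) (simp add: shift_linear shift_basis_eq shift_basis_def)
  thus ?thesis by simp
qed

lemma word_cases [case_names free extended degenerate]:
  assumes "head_free i w \<Longrightarrow> thesis"
    and "\<And>k w'. w = (i, k) # w' \<Longrightarrow> k \<noteq> 0 \<Longrightarrow> head_free i w' \<Longrightarrow> thesis"
    and "\<not> head_free i w \<Longrightarrow> (\<And>k w'. w = (i, k) # w' \<Longrightarrow> k = 0 \<or> \<not> head_free i w') \<Longrightarrow> thesis"
  shows thesis
proof (cases w)
  case Nil
  thus ?thesis using assms(1) by simp
next
  case (Cons a w')
  thus ?thesis using assms by (cases a) (force)
qed

lemma shift_degenerate:
  assumes "\<not> head_free i w" "\<And>k w'. w = (i, k) # w' \<Longrightarrow> k = 0 \<or> \<not> head_free i w'"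
  shows "shift i n (basis w) = basis w"
proof -
  obtain k w' where "w = (i, k) # w'" using assms(1) by (cases w) (auto simp: head_free_def)
  thus ?thesis using assms by (auto simp: shift_basis_eq shift_basis_def)
qed

lemma shift_shift: "shift i n (shift i l x) = shift i (n + l) x"
proof (rule vec_linear_eqI[of "\<lambda>x. shift i n (shift i l x)"])
  show "vec_linear (\<lambda>x. shift i n (shift i l x))" by (simp add: vec_linear_def shift_linear)
  show "vec_linear (shift i (n + l))" by (rule vec_linear_shift)
  show "shift i n (shift i l (basis w)) = shift i (n + l) (basis w)" for w
  proof (cases i w rule: word_cases)
    case free
    thus ?thesis using shift_prepend[OF free, of _ 0] by (simp add: shift_prepend)
  next
    case (extended k w')
    show ?thesis
      unfolding extended(1) basis_Cons_eq[OF extended(2)] shift_linear shift_prepend[OF extended(3)]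
      by (simp add: add.assoc)
  next
    case degenerate
    show ?thesis by (simp add: shift_degenerate[OF degenerate])
  qed
qed

lemma shift_0 [simp]: "shift i 0 x = x"
proof (rule vec_linear_eqI[of "shift i 0" "\<lambda>x. x"])
  show "shift i 0 (basis w) = basis w" for w
  proof (cases i w rule: word_cases)
    case free
    thus ?thesis using shift_prepend[OF free, of 0 0] by simp
  next
    case (extended k w')
    show ?thesis
      unfolding extended(1) basis_Cons_eq[OF extended(2)] shift_linear shift_prepend[OF extended(3)]
          by simp
  next
    case degenerate
    show ?thesis by (simp add: shift_degenerate[OF degenerate])
  qed
qed (simp_all add: vec_linear_shift, simp add: vec_linear_def)

lemma gram_head_mismatch: "head_free i w \<Longrightarrow> gram w ((i, k) # w') = 0" "head_free i w \<Longrightarrow> gram ((i, k) #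
    w') w = 0"
  by (cases w; auto simp: head_free_def split: prod.splits)+

lemma form_prepend_prepend:
  assumes "head_free i w" "head_free i w'"
  shows "form (prepend i k w) (prepend i l w') = p i (k - l) * gram w w'"
proof -
  have K: "form (if k = 0 then 0 else basis ((i, k) # w)) (if l = 0 then 0 else basis ((i, l) # w'))
    = (p i (k - l) - p i k * cnj (p i l)) * gram w w'"
    using p_uminus[of i l] by auto
  have "form (if k = 0 then 0 else basis ((i, k) # w)) (basis w') = 0"
       "form (basis w) (if l = 0 then 0 else basis ((i, l) # w')) = 0"
    using gram_head_mismatch[OF assms(1)] gram_head_mismatch[OF assms(2)] by auto
  thus ?thesis unfolding prepend_def form_sesquilinear K by (simp add: algebra_simps)
qed

lemma form_prepend_degenerate:
  assumes w: "head_free i w" and w': "\<not> head_free i w'" "\<And>k v. w' = (i, k) # v \<Longrightarrow> k = 0 \<or> \<not> head_free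
      i v"
  shows "form (prepend i n w) (basis w') = 0"
proof -
  obtain k v where v: "w' = (i, k) # v" using w'(1) by (cases w') (auto simp: head_free_def)
  have "k = 0 \<or> \<not> head_free i v" using w'(2) v by blast
  hence "gram ((i, n) # w) w' = 0"
  proof
    assume "\<not> head_free i v"
    then obtain k' v' where "v = (i, k') # v'" by (cases v) (auto simp: head_free_def)
    thus ?thesis using gram_head_mismatch(1)[OF w] by (simp add: v)
  qed (simp add: v)
  moreover have "gram w w' = 0" using gram_head_mismatch(1)[OF w] by (simp add: v)
  ultimately show ?thesis by (simp add: prepend_def form_sesquilinear)
qed

text \<open>On the span of \<open>prepend i k w\<close>, \<open>k \<in> \<int>\<close>, the form is \<open>p i (k - l)\<close> times a constant, and the
  shift is \<open>k \<mapsto> n + k\<close>; the remaining basis vectors are fixed and orthogonal to these spans.\<close>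

lemma shift_adjoint: "form (shift i n x) y = form x (shift i (- n) y)"
proof -
  define deg where "deg w \<longleftrightarrow> \<not> head_free i w \<and> (\<forall>k v. w = (i, k) # v \<longrightarrow> k = 0 \<or> \<not> head_free i v)" for w
  define D where "D = {prepend i k v |k v. head_free i v} \<union> {basis w |w. deg w}"
  have deg: "shift i n (basis w) = basis w" if "deg w" for n w
    using that by (intro shift_degenerate) (auto simp: deg_def)
  have orth: "form (prepend i k v) (basis w) = 0" "form (basis w) (prepend i k v) = 0"
    if "head_free i v" "deg w" for k v w
  proof -
    show "form (prepend i k v) (basis w) = 0"
      using that by (intro form_prepend_degenerate) (auto simp: deg_def)
    thus "form (basis w) (prepend i k v) = 0" by (subst form_cnj) simp
  qed
  have D: "form (shift i n x) y = form x (shift i (- n) y)" if "x \<in> D" "y \<in> D" for x y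
    using that by (auto simp: D_def deg orth shift_prepend form_prepend_prepend algebra_simps)
  have decomp: "\<exists>x\<in>D. \<exists>x'\<in>D. \<exists>c. basis w = x - scal c x'" for w
  proof (cases i w rule: word_cases)
    case free
    hence "prepend i 0 w \<in> D" unfolding D_def by blast
    hence "basis w \<in> D" by simp
    thus ?thesis by (intro bexI[of _ "basis w"] exI[of _ 0]) simp_all
  next
    case (extended k v)
    hence "prepend i k v \<in> D" "prepend i 0 v \<in> D" unfolding D_def by blast+
    thus ?thesis using extended basis_Cons_eq by blast
  next
    case degenerate
    hence "basis w \<in> D" unfolding D_def deg_def by blast
    thus ?thesis by (intro bexI[of _ "basis w"] exI[of _ 0]) simp_all
  qed
  have basis: "form (shift i n (basis w)) (basis w') = form (basis w) (shift i (- n) (basis w'))"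
      for w w'
  proof -
    obtain x x' c where x: "x \<in> D" "x' \<in> D" "basis w = x - scal c x'" using decomp by blast
    obtain y y' d where y: "y \<in> D" "y' \<in> D" "basis w' = y - scal d y'" using decomp by blast
    show ?thesis
      by (simp only: x(3) y(3) shift_linear form_sesquilinear D[OF x(1) y(1)] D[OF x(1) y(2)]
          D[OF x(2) y(1)] D[OF x(2) y(2)])
  qed
  have "form (shift i n (basis w)) y = form (basis w) (shift i (- n) y)" for w
    by (induction y rule: basis_induct) (simp_all only: shift_linear form_sesquilinear form_zero basis)
  thus ?thesis
    by (induction x rule: basis_induct) (simp_all only: shift_linear form_sesquilinear form_zero)
qed

lemma shift_vacuum: "lookup (shift i n (basis [])) [] = p i n"
  by (simp add: shift_basis_eq shift_basis_def prepend_def lookup_add lookup_single)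

section \<open>Operators that act on the front of a word\<close>

definition append_ext :: "word \<Rightarrow> (word \<Rightarrow>\<^sub>0 complex) \<Rightarrow> word \<Rightarrow>\<^sub>0 complex" where
  "append_ext w = lin_ext (\<lambda>c. basis (c @ w))"

lemma vec_linear_append_ext: "vec_linear (append_ext w)"
  unfolding append_ext_def by (rule vec_linear_lin_ext)

lemmas append_ext_linear =
  vec_linear_append_ext[unfolded vec_linear_def, THEN conjunct1, rule_format]
  vec_linear_append_ext[unfolded vec_linear_def, THEN conjunct2, rule_format]
  vec_linear_diff[OF vec_linear_append_ext] vec_linear_zero[OF vec_linear_append_ext]

lemma append_ext_basis [simp]: "append_ext w (basis c) = basis (c @ w)"
  by (simp add: append_ext_def)

definition span_over :: "nat set \<Rightarrow> (word \<Rightarrow>\<^sub>0 complex) set" where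
  "span_over I = {x. \<forall>c\<in>keys x. fst ` set c \<subseteq> I}"

text \<open>On the tensor product of the words over \<open>I\<close> with the words that do not start in \<open>I\<close>, such a
  map is \<open>T \<otimes> id\<close>.\<close>

definition acts_on_front :: "nat set \<Rightarrow> ((word \<Rightarrow>\<^sub>0 complex) \<Rightarrow> (word \<Rightarrow>\<^sub>0 complex)) \<Rightarrow> bool" where
  "acts_on_front I T \<longleftrightarrow> (\<forall>x\<in>span_over I. T x \<in> span_over I \<and>
     (\<forall>w. (\<forall>i\<in>I. head_free i w) \<longrightarrow> T (append_ext w x) = append_ext w (T x)))"

lemma span_over_add: "x \<in> span_over I \<Longrightarrow> y \<in> span_over I \<Longrightarrow> x + y \<in> span_over I"
  using keys_add[of x y] by (auto simp: span_over_def)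

lemma span_over_scal: "x \<in> span_over I \<Longrightarrow> scal c x \<in> span_over I"
  using keys_scal[of c x] by (auto simp: span_over_def)

lemma span_over_diff: "x \<in> span_over I \<Longrightarrow> y \<in> span_over I \<Longrightarrow> x - y \<in> span_over I"
proof -
  assume *: "x \<in> span_over I" "y \<in> span_over I"
  have "keys (x - y) \<subseteq> keys x \<union> keys y" by (auto simp: in_keys_iff lookup_minus)
  thus ?thesis using * unfolding span_over_def by blast
qed

lemma span_over_basis: "basis w \<in> span_over I \<longleftrightarrow> fst ` set w \<subseteq> I"
  by (simp add: span_over_def)

lemma span_over_zero: "0 \<in> span_over I"
  by (simp add: span_over_def)

lemma acts_on_front_id: "acts_on_front I (\<lambda>x. x)"
  by (simp add: acts_on_front_def)

lemma acts_on_front_add: "acts_on_front I S \<Longrightarrow> acts_on_front I T \<Longrightarrow> acts_on_front I (\<lambda>x. S x + T x)"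
  by (simp add: acts_on_front_def append_ext_linear span_over_add)

lemma acts_on_front_scal: "acts_on_front I S \<Longrightarrow> acts_on_front I (\<lambda>x. scal c (S x))"
  by (simp add: acts_on_front_def append_ext_linear span_over_scal)

lemma acts_on_front_comp: "acts_on_front I S \<Longrightarrow> acts_on_front I T \<Longrightarrow> acts_on_front I (\<lambda>x. S (T x))"
  by (simp add: acts_on_front_def)

lemma append_ext_prepend: "append_ext w (prepend i k c) = prepend i k (c @ w)"
  by (simp add: prepend_def append_ext_linear)

lemma head_free_append: "head_free i w \<Longrightarrow> head_free i (c @ w) \<longleftrightarrow> head_free i c"
  by (cases c) (auto simp: head_free_def)

lemma prepend_in_span_over: "i \<in> I \<Longrightarrow> fst ` set w \<subseteq> I \<Longrightarrow> prepend i k w \<in> span_over I"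
  unfolding prepend_def by (intro span_over_add span_over_scal) (auto simp: span_over_basis
      span_over_zero)

lemma acts_on_front_shift:
  assumes i: "i \<in> I"
  shows "acts_on_front I (shift i n)"
proof -
  have "shift i n x \<in> span_over I \<and> (\<forall>w. (\<forall>i\<in>I. head_free i w) \<longrightarrow> shift i n (append_ext w x) =
      append_ext w (shift i n x))"
    if "x \<in> span_over I" for x
  proof -
    have "keys x \<subseteq> {c. fst ` set c \<subseteq> I}" using that by (auto simp: span_over_def)
    thus ?thesis
    proof (induction x rule: span_induct)
      case (basis c)
      hence basis: "fst ` set c \<subseteq> I" by simp
      show ?case
      proof (intro conjI allI impI)
        show "shift i n (basis c) \<in> span_over I"
        proof (cases i c rule: word_cases)
          case free
          thus ?thesis using i basis by (simp add: shift_basis_eq shift_basis_def prepend_in_span_over)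
        next
          case (extended k w')
          show ?thesis
            using i basis extended unfolding extended(1) basis_Cons_eq[OF extended(2)] shift_linear
                shift_prepend[OF extended(3)]
            by (intro span_over_diff span_over_scal prepend_in_span_over) auto
        next
          case degenerate
          show ?thesis using basis by (simp add: shift_degenerate[OF degenerate] span_over_basis)
        qed
        fix w assume "\<forall>i\<in>I. head_free i w"
        hence w: "head_free i w" using i by blast
        show "shift i n (append_ext w (basis c)) = append_ext w (shift i n (basis c))"
        proof (cases i c rule: word_cases)
          case free
          thus ?thesis using head_free_append[OF w, of c]
            by (simp add: shift_basis_eq shift_basis_def append_ext_prepend)
        next
          case (extended k c')
          thus ?thesis using head_free_append[OF w, of c']
            by (simp add: shift_basis_eq shift_basis_def append_ext_prepend append_ext_linear)
        next
          case degenerate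
          obtain k c' where c: "c = (i, k) # c'" using degenerate(1) by (cases c) (auto simp:
              head_free_def)
          have "shift i n (basis (c @ w)) = basis (c @ w)"
            using degenerate(2)[OF c] head_free_append[OF w, of c'] by (intro shift_degenerate)
                (auto simp: c)
          thus ?thesis by (simp add: shift_degenerate[OF degenerate])
        qed
      qed
    next
      case (scal c x)
      thus ?case by (simp add: append_ext_linear shift_linear span_over_scal)
    next
      case (add x y)
      thus ?case by (simp add: append_ext_linear shift_linear span_over_add)
    qed (simp add: span_over_zero append_ext_linear shift_linear)
  qed
  thus ?thesis by (simp add: acts_on_front_def)
qed

text \<open>An operator over \<open>I\<close> without vacuum expectation puts a nonempty word over \<open>I\<close> in front of
  any word that does not start in \<open>I\<close>.\<close>

lemma acts_on_front_centered:
  assumes T: "acts_on_front I T" "vec_linear T" and centered: "lookup (T (basis [])) [] = 0"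
    and y: "\<And>w. w \<in> keys y \<Longrightarrow> w = [] \<or> fst (hd w) \<in> J" and disj: "I \<inter> J = {}"
    and v: "v \<in> keys (T y)"
  shows "v \<noteq> [] \<and> fst (hd v) \<in> I"
proof -
  have base: "v \<noteq> [] \<and> fst (hd v) \<in> I" if w: "w \<in> keys y" and v: "v \<in> keys (T (basis w))" for w v
  proof -
    have "basis [] \<in> span_over I" by (simp add: span_over_basis)
    moreover have "\<forall>i\<in>I. head_free i w" using y[OF w] disj by (auto simp: head_free_def)
    ultimately have "T (append_ext w (basis [])) = append_ext w (T (basis []))" and sp: "T (basis
        []) \<in> span_over I"
      using T(1) unfolding acts_on_front_def by blast+
    hence TE: "T (basis w) = append_ext w (T (basis []))" by simp
    have "v \<in> (\<Union>c\<in>keys (T (basis [])). keys (scal (lookup (T (basis [])) c) (basis (c @ w))))"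
      using v unfolding TE append_ext_def lin_ext_def by (rule subsetD[OF keys_sum])
    then obtain c where c: "c \<in> keys (T (basis []))" "v \<in> keys (scal (lookup (T (basis [])) c)
        (basis (c @ w)))"
      by (rule UN_E)
    have "v \<in> keys (basis (c @ w))" using subsetD[OF keys_scal c(2)] .
    with c(1) have c: "c \<in> keys (T (basis []))" "v = c @ w" by simp_all
    have "c \<noteq> []" using c(1) centered by (auto simp: in_keys_iff)
    thus ?thesis using c sp by (cases c) (auto simp: span_over_def)
  qed
  have "T y = lin_ext (\<lambda>w. T (basis w)) y"
    by (rule vec_linear_eqI[OF T(2) vec_linear_lin_ext[of "\<lambda>w. T (basis w)"]]) (simp only:
        lin_ext_basis)
  hence "v \<in> keys (\<Sum>w\<in>keys y. scal (lookup y w) (T (basis w)))" using v unfolding lin_ext_def by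
      (simp only:)
  from subsetD[OF keys_sum this]
  obtain w where w: "w \<in> keys y" "v \<in> keys (scal (lookup y w) (T (basis w)))" by (rule UN_E)
  from w(1) subsetD[OF keys_scal w(2)] show ?thesis by (rule base)
qed

end

lemma cring_complex_ring: "cring complex_ring"
proof -
  have "abelian_group complex_ring"
    by (rule abelian_groupI) (auto simp: complex_ring_def intro: exI[of _ "- _"])
  moreover have "comm_monoid complex_ring"
    by (rule comm_monoidI) (auto simp: complex_ring_def)
  ultimately show ?thesis
    by (rule cringI) (auto simp: complex_ring_def distrib_right)
qed

context free_product
begin

section \<open>The *-algebra of adjoint pairs\<close>

type_synonym op = "((word \<Rightarrow>\<^sub>0 complex) \<Rightarrow> (word \<Rightarrow>\<^sub>0 complex)) \<times> ((word \<Rightarrow>\<^sub>0 complex) \<Rightarrow> (word \<Rightarrow>\<^sub>0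
    complex))"

text \<open>The form may be degenerate, and then an operator can have several adjoints. An element of
  the algebra therefore carries an adjoint with it, and the star operation swaps the two
  components.\<close>

definition adjoint_pairs :: "op set" where
  "adjoint_pairs = {a. vec_linear (fst a) \<and> vec_linear (snd a) \<and> (\<forall>x y. form (fst a x) y = form x
      (snd a y))}"

definition op_mult :: "op \<Rightarrow> op \<Rightarrow> op" where
  "op_mult a b = (\<lambda>x. fst a (fst b x), \<lambda>x. snd b (snd a x))"

definition op_add :: "op \<Rightarrow> op \<Rightarrow> op" where
  "op_add a b = (\<lambda>x. fst a x + fst b x, \<lambda>x. snd a x + snd b x)"

definition op_scal :: "complex \<Rightarrow> op \<Rightarrow> op" where
  "op_scal c a = (\<lambda>x. scal c (fst a x), \<lambda>x. scal (cnj c) (snd a x))"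

definition op_one :: op where "op_one = (\<lambda>x. x, \<lambda>x. x)"

definition op_zero :: op where "op_zero = (\<lambda>x. 0, \<lambda>x. 0)"

lemmas op_defs = op_mult_def op_add_def op_scal_def op_one_def op_zero_def

lemma adjoint_pairs_swap: "a \<in> adjoint_pairs \<Longrightarrow> prod.swap a \<in> adjoint_pairs"
  unfolding adjoint_pairs_def by (auto intro: form_cnj[THEN trans]) (metis form_cnj)

lemma adjoint_pairs_swap_pair: "(S, T) \<in> adjoint_pairs \<Longrightarrow> (T, S) \<in> adjoint_pairs"
  using adjoint_pairs_swap[of "(S, T)"] by simp

lemma adjoint_pairs_closed:
  "a \<in> adjoint_pairs \<Longrightarrow> b \<in> adjoint_pairs \<Longrightarrow> op_mult a b \<in> adjoint_pairs"
  "a \<in> adjoint_pairs \<Longrightarrow> b \<in> adjoint_pairs \<Longrightarrow> op_add a b \<in> adjoint_pairs"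
  "a \<in> adjoint_pairs \<Longrightarrow> op_scal c a \<in> adjoint_pairs"
  "op_one \<in> adjoint_pairs" "op_zero \<in> adjoint_pairs"
  by (auto simp: adjoint_pairs_def op_defs vec_linear_def form_sesquilinear scal_add_right mult.commute
      algebra_simps)

text \<open>A pair is determined by the matrix entries of its two operators, and there are countably
  many of them.\<close>

definition encode :: "op \<Rightarrow> nat \<Rightarrow> complex" where
  "encode a n = (case from_nat n of (b, w, w') \<Rightarrow> lookup ((if b then fst a else snd a) (basis w)) w')"

lemma inj_on_encode: "inj_on encode adjoint_pairs"
proof (rule inj_onI)
  fix a b assume a: "a \<in> adjoint_pairs" and b: "b \<in> adjoint_pairs" and eq: "encode a = encode b"
  have "lookup ((if c then fst a else snd a) (basis w)) w' = lookup ((if c then fst b else snd b)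
      (basis w)) w'"
    for c :: bool and w w'
    using fun_cong[OF eq, of "to_nat (c, w, w')"] by (simp add: encode_def)
  from this[of True] this[of False]
  have "fst a (basis w) = fst b (basis w)" "snd a (basis w) = snd b (basis w)" for w
    by (auto intro: poly_mapping_eqI)
  hence "fst a x = fst b x" "snd a x = snd b x" for x
    using a b unfolding adjoint_pairs_def by (blast intro: vec_linear_eqI)+
  thus "a = b" by (simp add: prod_eq_iff fun_eq_iff)
qed

definition decode :: "(nat \<Rightarrow> complex) \<Rightarrow> op" where
  "decode = inv_into adjoint_pairs encode"

lemma decode_encode [simp]: "a \<in> adjoint_pairs \<Longrightarrow> decode (encode a) = a"
  by (simp add: decode_def inv_into_f_f[OF inj_on_encode])

definition alg :: "(complex, nat \<Rightarrow> complex) module" where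
  "alg = \<lparr>carrier = encode ` adjoint_pairs, mult = (\<lambda>x y. encode (op_mult (decode x) (decode y))),
     one = encode op_one, zero = encode op_zero, add = (\<lambda>x y. encode (op_add (decode x) (decode y))),
     smult = (\<lambda>c x. encode (op_scal c (decode x)))\<rparr>"

definition alg_star :: "(nat \<Rightarrow> complex) \<Rightarrow> (nat \<Rightarrow> complex)" where
  "alg_star x = encode (prod.swap (decode x))"

definition alg_state :: "(nat \<Rightarrow> complex) \<Rightarrow> complex" where
  "alg_state x = lookup (fst (decode x) (basis [])) []"

lemma alg_simps:
  "carrier alg = encode ` adjoint_pairs" "x \<otimes>\<^bsub>alg\<^esub> y = encode (op_mult (decode x) (decode y))"
  "\<one>\<^bsub>alg\<^esub> = encode op_one" "\<zero>\<^bsub>alg\<^esub> = encode op_zero" "x \<oplus>\<^bsub>alg\<^esub> y = encode (op_add (decode x) (decode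
      y))"
  "c \<odot>\<^bsub>alg\<^esub> x = encode (op_scal c (decode x))"
  by (simp_all add: alg_def)

lemma op_linear:
  assumes "a \<in> adjoint_pairs"
  shows "fst a (x + y) = fst a x + fst a y" "snd a (x + y) = snd a x + snd a y"
    "fst a (scal c x) = scal c (fst a x)" "snd a (scal c x) = scal c (snd a x)"
    "fst a 0 = 0" "snd a 0 = 0"
  using assms vec_linear_zero by (auto simp: adjoint_pairs_def vec_linear_def)

lemmas op_linear_pair = op_linear[of "(S, T)" for S T, simplified]

lemma abelian_group_alg: "abelian_group alg"
proof (rule abelian_groupI)
  fix x assume "x \<in> carrier alg"
  then obtain a where a: "a \<in> adjoint_pairs" "x = encode a" by (auto simp: alg_simps)
  have "op_add (op_scal (-1) a) a = op_zero"
    by (auto simp: op_defs fun_eq_iff intro!: poly_mapping_eqI simp: lookup_add)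
  thus "\<exists>y\<in>carrier alg. y \<oplus>\<^bsub>alg\<^esub> x = \<zero>\<^bsub>alg\<^esub>"
    using a adjoint_pairs_closed(3)[OF a(1), of "-1"]
    by (intro bexI[of _ "encode (op_scal (-1) a)"]) (simp_all add: alg_simps)
qed (auto simp: alg_simps adjoint_pairs_closed, simp_all add: op_defs add_ac)

lemma ring_alg: "ring alg"
proof (rule ringI[OF abelian_group_alg])
  show "monoid alg"
    by (rule monoidI) (auto simp: alg_simps adjoint_pairs_closed, simp_all add: op_defs)
qed (auto simp: alg_simps adjoint_pairs_closed, simp_all add: op_defs op_linear_pair)

lemma star_probability_space_alg: "star_probability_space alg alg_star alg_state"
proof -
  have module: "module complex_ring alg"
  proof (rule module.intro[OF cring_complex_ring abelian_group_alg], rule module_axioms.intro)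
  qed (auto simp: alg_simps adjoint_pairs_closed complex_ring_def,
      simp_all add: op_defs scal_add_left scal_add_right mult.commute)
  show ?thesis
  proof (rule star_probability_space.intro[OF module ring_alg], rule
      star_probability_space_axioms.intro)
    fix x assume "x \<in> carrier alg"
    then obtain a where a: "a \<in> adjoint_pairs" "x = encode a" by (auto simp: alg_simps)
    have b: "op_mult (prod.swap a) a \<in> adjoint_pairs" by (intro adjoint_pairs_closed
        adjoint_pairs_swap a)
    have "alg_state (alg_star x \<otimes>\<^bsub>alg\<^esub> x) = lookup (snd a (fst a (basis []))) []"
      using a b adjoint_pairs_swap[OF a(1)] by (simp add: alg_state_def alg_star_def alg_simps)
          (simp add: op_mult_def)
    also have "\<dots> = form (snd a (fst a (basis []))) (basis [])" by (simp add: form_vacuum)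
    also have "\<dots> = form (fst a (basis [])) (fst a (basis []))"
      using adjoint_pairs_swap[OF a(1)] by (simp add: adjoint_pairs_def)
    finally show "alg_state (alg_star x \<otimes>\<^bsub>alg\<^esub> x) \<in> \<real>\<^sub>\<ge>\<^sub>0" by (simp add: form_nonneg)
  qed (auto simp: alg_simps alg_star_def alg_state_def adjoint_pairs_closed adjoint_pairs_swap,
       simp_all add: op_defs op_linear_pair adjoint_pairs_swap_pair lookup_add lookup_single
           prod_eq_iff)
qed

sublocale A: star_probability_space alg alg_star alg_state
  by (rule star_probability_space_alg)

section \<open>Freeness of the model\<close>

definition front_algebra :: "nat set \<Rightarrow> (nat \<Rightarrow> complex) set" where
  "front_algebra I =
     {x \<in> carrier alg. acts_on_front I (fst (decode x)) \<and> acts_on_front I (snd (decode x))}"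

lemma generated_front_algebra:
  assumes "x \<in> generated_star_subalgebra alg alg_star S" "S \<subseteq> front_algebra I"
  shows "x \<in> front_algebra I"
  using assms
  by (induction rule: generated_star_subalgebra.induct)
     (auto simp: front_algebra_def alg_simps alg_star_def adjoint_pairs_closed adjoint_pairs_swap
        adjoint_pairs_swap_pair,
      simp_all add: op_defs acts_on_front_id acts_on_front_add acts_on_front_scal acts_on_front_comp)

text \<open>A product of centered elements with alternating index sets maps the vacuum to a combination
  of nonempty words, which are orthogonal to the vacuum.\<close>

lemma free_front_algebras:
  assumes B: "\<And>j. B j \<subseteq> front_algebra (I j)" and disj: "\<And>j k. j \<noteq> k \<Longrightarrow> I j \<inter> I k = {}"
  shows "free_subalgebras alg alg_state B"
  unfolding free_subalgebras_def
proof (intro allI impI)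
  fix js xs assume xs: "xs \<noteq> []" and all: "list_all2 (\<lambda>j x. x \<in> B j \<and> alg_state x = 0) js xs" and
      adj: "distinct_adj js"
  let ?P = "\<lambda>xs. foldr (\<otimes>\<^bsub>alg\<^esub>) xs \<one>\<^bsub>alg\<^esub>"
  have "\<exists>a\<in>adjoint_pairs. ?P xs = encode a \<and>
     (\<forall>v\<in>keys (fst a (basis [])). if js = [] then v = [] else v \<noteq> [] \<and> fst (hd v) \<in> I (hd js))"
    using all adj
  proof (induction js xs rule: list_all2_induct)
    case Nil
    have "keys (fst op_one (basis [])) = {[]}" by (simp add: op_one_def)
    thus ?case by (intro bexI[of _ op_one]) (auto simp: alg_simps adjoint_pairs_closed)
  next
    case (Cons j js x xs)
    have "distinct_adj js" using Cons.prems by (cases js) (auto simp: distinct_adj_Cons)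
    then obtain b where b: "b \<in> adjoint_pairs" "?P xs = encode b"
      "\<And>v. v \<in> keys (fst b (basis [])) \<Longrightarrow> if js = [] then v = [] else v \<noteq> [] \<and> fst (hd v) \<in> I (hd js)"
      using Cons.IH by blast
    obtain a where a: "a \<in> adjoint_pairs" "acts_on_front (I j) (fst a)" "x = encode a"
      using Cons.hyps B[of j] by (force simp: front_algebra_def alg_simps)
    have "alg_state x = 0" using Cons.hyps by simp
    hence a0: "lookup (fst a (basis [])) [] = 0" using a by (simp add: alg_state_def)
    define J where "J = (if js = [] then {} else I (hd js))"
    have "j \<noteq> hd js" if "js \<noteq> []" using Cons.prems that by (cases js) (auto simp: distinct_adj_Cons)
    hence IJ: "I j \<inter> J = {}" using disj by (auto simp: J_def)
    have "v \<noteq> [] \<and> fst (hd v) \<in> I j" if "v \<in> keys (fst (op_mult a b) (basis []))" for v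
    proof (rule acts_on_front_centered[OF a(2) _ a0 _ IJ])
      show "vec_linear (fst a)" using a(1) by (simp add: adjoint_pairs_def)
      show "w = [] \<or> fst (hd w) \<in> J" if "w \<in> keys (fst b (basis []))" for w
        using b(3)[OF that] by (auto simp: J_def split: if_splits)
      show "v \<in> keys (fst a (fst b (basis [])))" using that by (simp add: op_mult_def)
    qed
    moreover have "?P (x # xs) = encode (op_mult a b)"
      by (simp only: foldr_Cons comp_apply b(2) a(3) alg_simps(2) decode_encode a(1) b(1))
    ultimately show ?case
      using adjoint_pairs_closed(1)[OF a(1) b(1)] by (intro bexI[of _ "op_mult a b"]) simp_all
  qed
  then obtain a where a: "a \<in> adjoint_pairs" "?P xs = encode a"
    "\<And>v. v \<in> keys (fst a (basis [])) \<Longrightarrow> if js = [] then v = [] else v \<noteq> [] \<and> fst (hd v) \<in> I (hd js)"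
        by blast
  have "js \<noteq> []" using all xs by auto
  hence "[] \<notin> keys (fst a (basis []))" using a(3)[of "[]"] by auto
  thus "alg_state (?P xs) = 0" using a(1,2) by (simp add: alg_state_def in_keys_iff)
qed

definition shift_element :: "nat \<Rightarrow> int \<Rightarrow> nat \<Rightarrow> complex" where
  "shift_element i n = encode (shift i n, shift i (- n))"

lemma shift_pair: "(shift i n, shift i (- n)) \<in> adjoint_pairs"
  by (simp add: adjoint_pairs_def vec_linear_shift shift_adjoint)

lemma shift_element_mult: "shift_element i n \<otimes>\<^bsub>alg\<^esub> shift_element i l = shift_element i (n + l)"
  by (simp add: shift_element_def alg_simps shift_pair op_mult_def shift_shift algebra_simps fun_eq_iff)

lemma shift_element_0: "shift_element i 0 = \<one>\<^bsub>alg\<^esub>"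
proof -
  have "shift i 0 = (\<lambda>x. x)" by (rule ext) simp
  thus ?thesis by (simp add: shift_element_def alg_simps op_one_def)
qed

lemma star_shift_element: "alg_star (shift_element i n) = shift_element i (- n)"
  by (simp add: shift_element_def alg_star_def shift_pair)

lemma shift_element_unitary: "shift_element i n \<in> unitary_elements alg alg_star"
  by (simp add: unitary_elements_def star_shift_element shift_element_mult shift_element_0) (simp
      add: shift_element_def alg_simps shift_pair)

lemma shift_element_nat_pow: "shift_element i n [^]\<^bsub>alg\<^esub> k = shift_element i (int k * n)"
  by (induction k) (simp_all add: shift_element_0 shift_element_mult algebra_simps)

lemma shift_element_int_pow: "shift_element i 1 [^]\<^bsub>alg\<^esub> (k::int) = shift_element i k"
  by (cases k rule: int_cases2)
     (simp_all add: A.unitary_int_pow shift_element_unitary star_shift_element int_pow_int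
         shift_element_nat_pow)

lemma shift_element_distribution: "has_unitary_distribution alg alg_state (shift_element i 1) (m i)"
  unfolding has_unitary_distribution_def shift_element_int_pow
  using shift_vacuum[of i] by (simp add: m shift_element_def alg_state_def shift_pair p_def
      circle_moment_def)

lemma shift_element_front: "i \<in> I \<Longrightarrow> shift_element i n \<in> front_algebra I"
  by (simp add: shift_element_def front_algebra_def alg_simps shift_pair acts_on_front_shift)

definition gens :: "nat list \<Rightarrow> nat \<Rightarrow> complex" where
  "gens is = foldr (\<otimes>\<^bsub>alg\<^esub>) (map (\<lambda>i. shift_element i 1) is) \<one>\<^bsub>alg\<^esub>"

lemma gens_unitary: "gens is \<in> unitary_elements alg alg_star"
  unfolding gens_def by (induction "is") (simp_all add: A.unitary_one A.unitary_mult
      shift_element_unitary)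

lemma gens_append: "gens (is @ js) = gens is \<otimes>\<^bsub>alg\<^esub> gens js"
proof (induction "is")
  case Nil
  show ?case using A.unitary_closed[OF gens_unitary[of js]] by (simp add: gens_def)
next
  case (Cons i "is")
  show ?case
    using Cons A.unitary_closed[OF gens_unitary[of js]] A.unitary_closed[OF gens_unitary[of "is"]]
      A.unitary_closed[OF shift_element_unitary[of i 1]]
    by (simp add: gens_def A.m_assoc)
qed

lemma gens_single: "gens [i] = shift_element i 1"
  using A.unitary_closed[OF shift_element_unitary] by (simp add: gens_def)

lemma gens_front: "gens is \<in> front_algebra (set is)"
proof -
  have "gens js \<in> generated_star_subalgebra alg alg_star ((\<lambda>i. shift_element i 1) ` set is)" if "set
      js \<subseteq> set is" for js
    using that unfolding gens_def
    by (induction js) (auto intro: generated_star_subalgebra.intros)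
  thus ?thesis
    by (rule generated_front_algebra[OF _ image_subsetI]) (auto simp: shift_element_front)
qed

lemma gens_free:
  assumes "set is \<inter> set js = {}"
  shows "free_subalgebras alg alg_state (\<lambda>b::bool. generated_star_subalgebra alg alg_star {if b then
      gens is else gens js})"
proof (rule free_front_algebras)
  show "generated_star_subalgebra alg alg_star {if b then gens is else gens js} \<subseteq> front_algebra (if
      b then set is else set js)" for b
    using generated_front_algebra[of _ "{if b then gens is else gens js}"] gens_front by auto
  show "(if b then set is else set js) \<inter> (if c then set is else set js) = {}" if "b \<noteq> c" for b c
    using that assms by auto
qed

lemma state_gens_append:
  assumes "set is \<inter> set js = {}"
  shows "alg_state (gens (is @ js)) = alg_state (gens is) * alg_state (gens js)"
  using A.state_mult_free[OF _ gens_free[OF assms]] by (simp add: gens_unitary gens_append)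

lemma state_gens:
  assumes "distinct is"
  shows "alg_state (gens is) = (\<Prod>i\<leftarrow>is. circle_moment (m i) 1)"
  using assms
proof (induction "is" rule: rev_induct)
  case Nil
  show ?case by (simp add: gens_def A.state_one)
next
  case (snoc i "is")
  have "alg_state (shift_element i 1) = circle_moment (m i) 1"
    using shift_vacuum[of i 1] by (simp add: shift_element_def alg_state_def shift_pair p_def)
  thus ?case using snoc by (simp add: state_gens_append gens_single)
qed

definition row_distribution :: "nat \<Rightarrow> complex measure" where
  "row_distribution j = (if j = 0 then m 0 else SOME \<rho>. has_unitary_distribution alg alg_state (gens
      [0..<Suc j]) \<rho>)"

lemma row_distribution:
  "has_unitary_distribution alg alg_state (gens [0..<Suc j]) (row_distribution j)"
proof (cases "j = 0")
  case True
  thus ?thesis by (simp add: row_distribution_def gens_single shift_element_distribution)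
next
  case False
  thus ?thesis
    using someI_ex[OF A.unitary_has_distribution[OF gens_unitary]] by (simp add: row_distribution_def)
qed

text \<open>The products over \<open>{0..j}\<close> and over \<open>{Suc j}\<close> are free, because freeness in the model holds
  for arbitrary disjoint index sets.\<close>

lemma row_distribution_free:
  "row_distribution j \<boxtimes> m (Suc j) = row_distribution (Suc j)"
proof (rule free_mconv_eqI)
  let ?u = "gens [0..<Suc j]" and ?v = "gens [Suc j]"
  have "freely_independent alg alg_star alg_state ?u ?v"
    unfolding freely_independent_def by (rule gens_free) auto
  moreover have "has_unitary_distribution alg alg_state ?v (m (Suc j))"
    unfolding gens_single by (rule shift_element_distribution)
  moreover have "has_unitary_distribution alg alg_state (?u \<otimes>\<^bsub>alg\<^esub> ?v) (row_distribution (Suc j))"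
    using row_distribution[of "Suc j"] by (simp add: gens_append[symmetric] del: upt_Suc) (simp add:
        upt_Suc)
  ultimately show "is_free_mconv (row_distribution j) (m (Suc j)) (row_distribution (Suc j))"
    unfolding is_free_mconv_def using star_probability_space_alg gens_unitary row_distribution by blast
qed

lemma foldl_free_mconv:
  "foldl (\<boxtimes>) (m 0) (map m [1..<Suc j]) = row_distribution j"
proof (induction j)
  case 0
  show ?case by (simp add: row_distribution_def)
next
  case (Suc j)
  thus ?case by (simp add: row_distribution_free)
qed

lemma circle_moment_row_distribution:
  "row_distribution j \<in> circle_prob"
  "circle_moment (row_distribution j) (int k) = alg_state (gens [0..<Suc j] [^]\<^bsub>alg\<^esub> k)"
  using row_distribution[of j] by (auto simp: has_unitary_distribution_def circle_moment_def
      int_pow_int[symmetric] simp del: upt_Suc)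

lemma row_distribution_mean:
  "circle_moment (row_distribution j) 1 = (\<Prod>i\<le>j. circle_moment (m i) 1)"
proof -
  have "circle_moment (row_distribution j) 1 = alg_state (gens [0..<Suc j])"
    using circle_moment_row_distribution(2)[of j 1] A.unitary_closed[OF gens_unitary[of "[0..<Suc
        j]"]] by (simp del: upt_Suc)
  also have "\<dots> = (\<Prod>i\<le>j. circle_moment (m i) 1)"
    by (simp add: state_gens prod.list_conv_set_nth del: upt_Suc) (simp add:
        prod.distinct_set_conv_list[symmetric] atMost_upto lessThan_Suc_atMost[symmetric]
        atLeast0LessThan)
  finally show ?thesis .
qed

text \<open>The row is cut after the index \<open>j\<close>; the products over the two parts are free.\<close>

lemma norm_moment_row_distribution_le:
  assumes j: "j \<le> K" and e: "norm (\<Prod>i\<le>j. circle_moment (m i) 1) \<le> e" "norm (\<Prod>i\<in>{j<..K}.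
      circle_moment (m i) 1) \<le> e" "e \<le> 1"
    and k: "k > 0"
  shows "norm (circle_moment (row_distribution K) (int k)) \<le> e * 4 ^ k"
proof -
  let ?is = "[0..<Suc j]" and ?js = "[Suc j..<Suc K]"
  define U where "U b = (if b then gens ?is else gens ?js)" for b
  have "alg_state (gens ?is) = (\<Prod>i\<in>set ?is. circle_moment (m i) 1)" "alg_state (gens ?js) = (\<Prod>i\<in>set
      ?js. circle_moment (m i) 1)"
    by (simp_all only: state_gens distinct_upt prod.distinct_set_conv_list)
  moreover have "set ?is = {..j}" "set ?js = {j<..K}" by auto
  ultimately have "alg_state (gens ?is) = (\<Prod>i\<le>j. circle_moment (m i) 1)"
      "alg_state (gens ?js) = (\<Prod>i\<in>{j<..K}. circle_moment (m i) 1)" by (simp_all only:)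
  hence le: "norm (alg_state (U b)) \<le> e" for b using e by (cases b) (simp_all only: U_def if_True
      if_False)
  have U: "U b \<in> unitary_elements alg alg_star" for b by (simp add: U_def gens_unitary)
  have "free_subalgebras alg alg_state (\<lambda>b. generated_star_subalgebra alg alg_star {U b})"
    unfolding U_def by (rule gens_free) auto
  from A.norm_state_power_free_le[OF U this le e(3) k]
  have "norm (alg_state ((U True \<otimes>\<^bsub>alg\<^esub> U False) [^]\<^bsub>alg\<^esub> k)) \<le> e * 4 ^ k" .
  moreover have "U True \<otimes>\<^bsub>alg\<^esub> U False = gens [0..<Suc K]"
    using upt_add_eq_append[of 0 "Suc j" "K - j"] j by (simp add: U_def gens_append[symmetric] del:
        upt_Suc)
  ultimately show ?thesis by (simp add: circle_moment_row_distribution del: upt_Suc)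
qed

end

section \<open>Haar measure\<close>

lemma uniform_measure_2pi_eq_density:
  "uniform_measure lborel {0..2 * pi} = density lborel (\<lambda>x. ennreal (indicator {0..2 * pi} x / (2 *
      pi)))"
  unfolding uniform_measure_def
  by (intro density_cong AE_I2) (auto simp: indicator_def divide_ennreal[symmetric] simp flip:
      ennreal_1)

lemma circle_haar: "circle_haar \<in> circle_prob"
  and circle_moment_haar: "circle_moment circle_haar k = (if k = 0 then 1 else 0)"
proof -
  have P: "prob_space (uniform_measure lborel {0..2 * pi})"
    by (rule prob_space_uniform_measure) auto
  have m: "cis \<in> measurable (uniform_measure lborel {0..2 * pi}) circle_borel"
    by (simp add: measurable_def[symmetric]) measurable
  show "circle_haar \<in> circle_prob"
    unfolding circle_haar_def by (rule distr_circle_borel_circle_prob[OF P m])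
  have c: "continuous_on {0..2 * pi} (\<lambda>x. cis (of_int k * x))" by (intro continuous_intros)
  have "circle_moment circle_haar k = (\<integral>x. cis (of_int k * x) \<partial>uniform_measure lborel {0..2 * pi})"
    unfolding circle_haar_def by (subst circle_moment_distr[OF m]) (simp only: cis_powi)
  also have "\<dots> = (\<integral>x. (indicator {0..2 * pi} x / (2 * pi)) *\<^sub>R cis (of_int k * x) \<partial>lborel)"
    unfolding uniform_measure_2pi_eq_density
    by (intro integral_density) (auto intro!: borel_measurable_continuous_onI continuous_intros)
  also have "\<dots> = (\<integral>x. (indicator {0..2 * pi} x *\<^sub>R cis (of_int k * x)) / (2 * pi) \<partial>lborel)"
    by (intro Bochner_Integration.integral_cong refl) (auto simp: indicator_def scaleR_conv_of_real)
  also have "\<dots> = (LINT x:{0..2*pi}|lborel. cis (of_int k * x)) / (2 * pi)"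
    by (simp add: set_lebesgue_integral_def)
  also have "\<dots> = (if k = 0 then 1 else 0)"
    using set_borel_integral_eq_integral(2)[OF borel_integrable_atLeastAtMost'[OF c]]
      integral_unique[OF has_integral_cis_int[of k]] by simp
  finally show "circle_moment circle_haar k = (if k = 0 then 1 else 0)" .
qed

lemma circle_weak_conv_haar_if:
  assumes \<nu>: "\<forall>\<^sub>F n in sequentially. \<nu> n \<in> circle_prob"
    and lim: "\<And>k. k > 0 \<Longrightarrow> (\<lambda>n. circle_moment (\<nu> n) (int k)) \<longlonglongrightarrow> 0"
  shows "circle_weak_conv \<nu> circle_haar"
proof (rule circle_weak_conv_if_moments[OF \<nu> circle_haar])
  fix k :: int
  consider "k = 0" | n where "n > 0" "k = int n" | n where "n > 0" "k = - int n"
    by (cases k rule: int_cases3) auto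
  thus "(\<lambda>n. circle_moment (\<nu> n) k) \<longlonglongrightarrow> circle_moment circle_haar k"
  proof cases
    case 1
    have "\<forall>\<^sub>F n in sequentially. circle_moment (\<nu> n) k = 1"
      using \<nu> by eventually_elim (simp add: 1 circle_moment_0)
    thus ?thesis using 1 by (simp add: circle_moment_haar tendsto_eventually)
  next
    case (2 n)
    thus ?thesis using lim[of n] by (simp add: circle_moment_haar)
  next
    case (3 j)
    have "\<forall>\<^sub>F n in sequentially. cnj (circle_moment (\<nu> n) (int j)) = circle_moment (\<nu> n) k"
      using \<nu> by eventually_elim (simp add: 3 circle_moment_uminus)
    moreover have "(\<lambda>n. cnj (circle_moment (\<nu> n) (int j))) \<longlonglongrightarrow> cnj 0"
      by (intro tendsto_cnj lim 3)
    ultimately have "(\<lambda>n. circle_moment (\<nu> n) k) \<longlonglongrightarrow> cnj 0" by (rule Lim_transform_eventually[rotated])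
    thus ?thesis using 3 by (simp add: circle_moment_haar)
  qed
qed

section \<open>Centering\<close>

text \<open>\<open>1 - cos x = 2 (sin y)\<^sup>2\<close> with \<open>y = \<bar>x\<bar> / 2 \<le> 2\<close>, and there \<open>sin y \<ge> y - y\<^sup>3 / 6 \<ge> y / 3\<close>.\<close>

lemma one_minus_cos_ge:
  assumes "\<bar>x\<bar> \<le> pi"
  shows "x\<^sup>2 \<le> 18 * (1 - cos x)"
proof -
  define y where "y = \<bar>x\<bar> / 2"
  have y: "0 \<le> y" "y \<le> 2" using assms pi_less_4 by (auto simp: y_def)
  have "\<bar>sin y - (\<Sum>m<3. sin_coeff m * y ^ m)\<bar> \<le> inverse (fact 3) * \<bar>y\<bar> ^ 3"
    by (rule Maclaurin_sin_bound)
  hence "\<bar>sin y - y\<bar> \<le> y ^ 3 / 6" using y by (simp add: eval_nat_numeral sin_coeff_def)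
  hence "sin y \<ge> y - y ^ 3 / 6" by linarith
  also have "y - y ^ 3 / 6 = y * (1 - y\<^sup>2 / 6)" by (simp add: eval_nat_numeral algebra_simps)
  finally have "sin y \<ge> y * (1 - y\<^sup>2 / 6)" .
  moreover have "y\<^sup>2 \<le> 4" using power_mono[OF y(2) y(1), of 2] by simp
  hence "y * (1 / 3) \<le> y * (1 - y\<^sup>2 / 6)" using y by (intro mult_left_mono) auto
  ultimately have "y / 3 \<le> sin y" by simp
  hence "(y / 3)\<^sup>2 \<le> (sin y)\<^sup>2" using y by (intro power_mono) auto
  moreover have "cos x = 1 - 2 * (sin y)\<^sup>2"
    using cos_double_sin[of y] by (simp add: y_def)
  ultimately show ?thesis by (simp add: y_def power2_eq_square)
qed

lemma abs_sin_minus_le: "\<bar>sin x - x\<bar> \<le> x\<^sup>2 / (2::real)"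
  using Maclaurin_sin_bound[of x 2] by (simp add: eval_nat_numeral sin_coeff_def)

lemma cis_Arg_circle: "\<zeta> \<in> unit_circle \<Longrightarrow> cis (Arg \<zeta>) = \<zeta>"
  using cis_Arg[of \<zeta>] by (cases "\<zeta> = 0") (auto simp: sgn_eq)

lemma abs_Arg_le_pi: "\<bar>Arg \<zeta>\<bar> \<le> pi"
  using Arg_bounded[of \<zeta>] by auto

lemma abs_Arg_le:
  assumes "\<zeta> \<in> unit_circle"
  shows "\<bar>Arg \<zeta>\<bar> \<le> 3 * norm (\<zeta> - 1)"
proof -
  have \<zeta>: "\<zeta> = cis (Arg \<zeta>)" using cis_Arg_circle[OF assms] ..
  have "(norm (\<zeta> - 1))\<^sup>2 = (cos (Arg \<zeta>) - 1)\<^sup>2 + (sin (Arg \<zeta>))\<^sup>2"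
    by (subst \<zeta>) (simp add: cmod_power2)
  also have "\<dots> = 2 * (1 - cos (Arg \<zeta>))"
    using sin_cos_squared_add[of "Arg \<zeta>"] by (simp add: power2_eq_square algebra_simps)
  finally have "(Arg \<zeta>)\<^sup>2 \<le> (3 * norm (\<zeta> - 1))\<^sup>2"
    using one_minus_cos_ge[of "Arg \<zeta>"] abs_le_iff[of "Arg \<zeta>" pi] Arg_bounded[of \<zeta>]
    by (simp add: power_mult_distrib)
  thus ?thesis using abs_le_square_iff[of "Arg \<zeta>" "3 * norm (\<zeta> - 1)"] by simp
qed

definition centering_angle :: "real \<Rightarrow> complex measure \<Rightarrow> real" where
  "centering_angle \<tau> \<mu> = (LINT \<zeta>:{\<zeta>. \<bar>Arg \<zeta>\<bar> < \<tau>}|\<mu>. Arg \<zeta>)"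

definition dispersion :: "real \<Rightarrow> complex measure \<Rightarrow> real" where
  "dispersion \<tau> \<mu> = (\<integral>\<zeta>. (1 - Re \<zeta>) \<partial>centered \<tau> \<mu>)"

lemma centering_const_eq: "centering_const \<tau> \<mu> = cis (centering_angle \<tau> \<mu>)"
  by (simp add: centering_const_def centering_angle_def cis_conv_exp)

lemma integral_centered:
  fixes f :: "complex \<Rightarrow> 'b::{banach, second_countable_topology}"
  assumes \<mu>: "\<mu> \<in> circle_prob" and f: "continuous_on unit_circle f"
  shows "(\<integral>\<zeta>. f \<zeta> \<partial>centered \<tau> \<mu>) = (\<integral>\<zeta>. f (\<zeta> / centering_const \<tau> \<mu>) \<partial>\<mu>)"
proof -
  have "(\<lambda>\<zeta>. \<zeta> / centering_const \<tau> \<mu>) \<in> measurable \<mu> circle_borel"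
    unfolding measurable_circle_borel_iff
    by (auto simp: space_circle_prob[OF \<mu>] centering_const_eq norm_divide intro!:
        borel_measurable_circle_prob[OF \<mu>])
  moreover have "f \<in> borel_measurable circle_borel"
    unfolding circle_borel_def by (rule borel_measurable_continuous_on_restrict[OF f])
  ultimately show ?thesis unfolding centered_def by (rule integral_distr)
qed

lemma dispersion_eq:
  assumes \<mu>: "\<mu> \<in> circle_prob"
  shows "dispersion \<tau> \<mu> = 1 - Re (circle_moment \<mu> 1 / centering_const \<tau> \<mu>)"
proof -
  interpret prob_space \<mu> using \<mu> by (rule prob_space_circle_prob)
  have i: "integrable \<mu> (\<lambda>\<zeta>. \<zeta> / centering_const \<tau> \<mu>)"
    by (intro integrable_divide integrable_circle_prob[OF \<mu>] continuous_intros)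
  have "dispersion \<tau> \<mu> = (\<integral>\<zeta>. 1 - Re (\<zeta> / centering_const \<tau> \<mu>) \<partial>\<mu>)"
    unfolding dispersion_def by (intro integral_centered \<mu> continuous_intros)
  also have "\<dots> = 1 - Re (\<integral>\<zeta>. \<zeta> / centering_const \<tau> \<mu> \<partial>\<mu>)"
    by (subst Bochner_Integration.integral_diff) (simp_all only: integrable_const integrable_Re[OF i]
        Bochner_Integration.integral_Re[OF i] lebesgue_integral_const prob_space scaleR_one)
  also have "(\<integral>\<zeta>. \<zeta> / centering_const \<tau> \<mu> \<partial>\<mu>) = circle_moment \<mu> 1 / centering_const \<tau> \<mu>"
    by (simp add: circle_moment_def)
  finally show ?thesis .
qed

lemma dispersion_ge:
  assumes \<mu>: "\<mu> \<in> circle_prob"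
  shows "1 - norm (circle_moment \<mu> 1) \<le> dispersion \<tau> \<mu>"
proof -
  have "norm (circle_moment \<mu> 1 / centering_const \<tau> \<mu>) = norm (circle_moment \<mu> 1)"
    by (simp add: norm_divide centering_const_eq)
  thus ?thesis using complex_Re_le_cmod[of "circle_moment \<mu> 1 / centering_const \<tau> \<mu>"]
    by (simp add: dispersion_eq[OF \<mu>])
qed

text \<open>Let \<open>a\<close> be the centering angle and \<open>x = Arg \<zeta> - a\<close>. The imaginary part is the integral of
  \<open>sin x\<close>, the dispersion that of \<open>1 - cos x\<close>. On \<open>\<bar>Arg \<zeta>\<bar> < \<tau>\<close> we have
  \<open>sin x = x + O(1 - cos x)\<close>, and by the choice of \<open>a\<close> the integral of \<open>x\<close> over this set is \<open>a\<close>
  times the mass of its complement. On the complement \<open>1 - cos x\<close> is bounded below, so that this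
  mass is \<open>O(\<integral> (1 - cos x))\<close> as well.\<close>

lemma centered_imaginary_part_le:
  assumes \<mu>: "\<mu> \<in> circle_prob" and \<tau>: "0 < \<tau>" "\<tau> < pi"
    and a: "\<bar>centering_angle \<tau> \<mu>\<bar> \<le> \<tau> / 2" "\<bar>centering_angle \<tau> \<mu>\<bar> \<le> pi - \<tau>"
  shows "\<bar>Im (circle_moment \<mu> 1 / centering_const \<tau> \<mu>)\<bar> \<le> (9 + 3 / (1 - cos (\<tau> / 2))) * dispersion \<tau> \<mu>"
proof -
  interpret prob_space \<mu> using \<mu> by (rule prob_space_circle_prob)
  define \<alpha> where "\<alpha> = centering_angle \<tau> \<mu>"
  define c0 where "c0 = 1 - cos (\<tau> / 2)"
  define S where "S = {\<zeta>. \<bar>Arg \<zeta>\<bar> < \<tau>}"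
  have S[measurable]: "S \<in> sets borel" unfolding S_def by measurable
  have "cos (\<tau> / 2) < cos 0" using \<tau> by (intro cos_monotone_0_pi) auto
  hence c0: "c0 > 0" by (simp add: c0_def)
  note Arg_le = abs_Arg_le_pi
  define d where "d \<zeta> = 1 - cos (Arg \<zeta> - \<alpha>)" for \<zeta>
  define h where "h \<zeta> = sin (Arg \<zeta> - \<alpha>) - indicator S \<zeta> * (Arg \<zeta> - \<alpha>)" for \<zeta>
  have polar: "\<zeta> / centering_const \<tau> \<mu> = cis (Arg \<zeta> - \<alpha>)" if "\<zeta> \<in> unit_circle" for \<zeta>
  proof -
    have "\<zeta> = cis (Arg \<zeta>)" using cis_Arg_circle[OF that] ..
    thus ?thesis by (metis centering_const_eq cis_divide \<alpha>_def)
  qed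
  have far: "c0 \<le> d \<zeta>" if "\<zeta> \<notin> S" for \<zeta>
  proof -
    define x where "x = \<bar>Arg \<zeta> - \<alpha>\<bar>"
    have "\<tau> \<le> \<bar>Arg \<zeta>\<bar>" using that by (simp add: S_def)
    hence x: "\<tau> / 2 \<le> x" "x \<le> pi + \<tau> / 2" using a Arg_le[of \<zeta>] unfolding x_def \<alpha>_def by linarith+
    have "cos x \<le> cos (\<tau> / 2)"
    proof (cases "x \<le> pi")
      case True
      thus ?thesis using x \<tau> by (intro cos_monotone_0_pi_le) auto
    next
      case False
      have "cos (2 * pi - x) \<le> cos (\<tau> / 2)" using False x \<tau> by (intro cos_monotone_0_pi_le) auto
      thus ?thesis by (simp add: cos_diff)
    qed
    thus ?thesis by (simp add: d_def c0_def x_def abs_if split: if_splits)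
       (metis cos_minus minus_diff_eq)
  qed
  have d0: "d \<zeta> \<ge> 0" for \<zeta> by (simp add: d_def)
  have h_le: "\<bar>h \<zeta>\<bar> \<le> (9 + 1 / c0) * d \<zeta>" for \<zeta>
  proof (cases "\<zeta> \<in> S")
    case True
    have "\<bar>Arg \<zeta> - \<alpha>\<bar> \<le> pi" using True a by (auto simp: S_def \<alpha>_def)
    hence "\<bar>h \<zeta>\<bar> \<le> 9 * d \<zeta>"
      using abs_sin_minus_le[of "Arg \<zeta> - \<alpha>"] one_minus_cos_ge[of "Arg \<zeta> - \<alpha>"] True by (simp add:
          h_def d_def)
    also have "\<dots> \<le> (9 + 1 / c0) * d \<zeta>" using c0 d0 by (intro mult_right_mono) auto
    finally show ?thesis .
  next
    case False
    have "\<bar>h \<zeta>\<bar> \<le> 1" using False by (simp add: h_def)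
    also have "1 \<le> 1 / c0 * d \<zeta>" using far[OF False] c0 by (simp add: field_simps)
    also have "\<dots> \<le> (9 + 1 / c0) * d \<zeta>" using c0 d0 by (intro mult_right_mono) auto
    finally show ?thesis .
  qed
  have int_d: "integrable \<mu> d" unfolding d_def
  proof (rule integrable_circle_prob_bounded[OF \<mu>, where B = 2])
    show "norm (1 - cos (Arg \<zeta> - \<alpha>)) \<le> 2" for \<zeta>
      using cos_ge_minus_one[of "Arg \<zeta> - \<alpha>"] cos_le_one[of "Arg \<zeta> - \<alpha>"] unfolding real_norm_def by
          linarith
  qed measurable
  have int_ind: "integrable \<mu> (\<lambda>\<zeta>. indicator S \<zeta> * Arg \<zeta> :: real)"
    by (rule integrable_circle_prob_bounded[OF \<mu>, where B = pi]) (auto simp: Arg_le indicator_def)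
  have int_indc: "integrable \<mu> (\<lambda>\<zeta>. indicator S \<zeta> :: real)"
    by (rule integrable_circle_prob_bounded[OF \<mu>, where B = 1]) (auto simp: indicator_def)
  have int_sin: "integrable \<mu> (\<lambda>\<zeta>. sin (Arg \<zeta> - \<alpha>))"
    by (rule integrable_circle_prob_bounded[OF \<mu>, where B = 1]) auto
  have int_h: "integrable \<mu> h"
    unfolding h_def using int_ind int_indc int_sin by (auto simp: algebra_simps intro!:
        Bochner_Integration.integrable_diff)
  define q :: real where "q = (\<integral>\<zeta>. 1 - indicator S \<zeta> \<partial>\<mu>)"
  have disp: "dispersion \<tau> \<mu> = (\<integral>\<zeta>. d \<zeta> \<partial>\<mu>)"
  proof -
    have "dispersion \<tau> \<mu> = (\<integral>\<zeta>. 1 - Re (\<zeta> / centering_const \<tau> \<mu>) \<partial>\<mu>)"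
      unfolding dispersion_def by (intro integral_centered \<mu> continuous_intros)
    also have "\<dots> = (\<integral>\<zeta>. d \<zeta> \<partial>\<mu>)"
      by (intro Bochner_Integration.integral_cong refl) (auto simp: space_circle_prob[OF \<mu>] polar d_def)
    finally show ?thesis .
  qed
  have q_le: "q \<le> 1 / c0 * dispersion \<tau> \<mu>"
  proof -
    have "q \<le> (\<integral>\<zeta>. 1 / c0 * d \<zeta> \<partial>\<mu>)" unfolding q_def
    proof (rule integral_mono)
      show "integrable \<mu> (\<lambda>\<zeta>. 1 - indicator S \<zeta> :: real)" using int_indc by auto
      show "integrable \<mu> (\<lambda>\<zeta>. 1 / c0 * d \<zeta>)" using int_d by auto
      show "1 - indicator S \<zeta> \<le> 1 / c0 * d \<zeta>" for \<zeta>
        using far[of \<zeta>] d0[of \<zeta>] c0 by (auto simp: indicator_def field_simps)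
    qed
    thus ?thesis by (simp add: disp)
  qed
  have q0: "q \<ge> 0" unfolding q_def by (rule integral_nonneg_AE) (auto simp: indicator_def)
  have \<alpha>: "\<alpha> = (\<integral>\<zeta>. indicator S \<zeta> * Arg \<zeta> \<partial>\<mu>)"
    by (simp add: \<alpha>_def centering_angle_def set_lebesgue_integral_def S_def)
  have "Im (circle_moment \<mu> 1 / centering_const \<tau> \<mu>) = (\<integral>\<zeta>. sin (Arg \<zeta> - \<alpha>) \<partial>\<mu>)"
  proof -
    have i: "integrable \<mu> (\<lambda>\<zeta>. \<zeta> / centering_const \<tau> \<mu>)"
      by (intro integrable_divide integrable_circle_prob[OF \<mu>] continuous_intros)
    have "Im (circle_moment \<mu> 1 / centering_const \<tau> \<mu>) = Im (\<integral>\<zeta>. \<zeta> / centering_const \<tau> \<mu> \<partial>\<mu>)"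
      by (simp add: circle_moment_def)
    also have "\<dots> = (\<integral>\<zeta>. Im (\<zeta> / centering_const \<tau> \<mu>) \<partial>\<mu>)"
      by (rule Bochner_Integration.integral_Im[OF i, symmetric])
    also have "\<dots> = (\<integral>\<zeta>. sin (Arg \<zeta> - \<alpha>) \<partial>\<mu>)"
      by (intro Bochner_Integration.integral_cong refl) (auto simp: space_circle_prob[OF \<mu>] polar)
    finally show ?thesis .
  qed
  also have "\<dots> = (\<integral>\<zeta>. h \<zeta> + indicator S \<zeta> * Arg \<zeta> - \<alpha> * indicator S \<zeta> \<partial>\<mu>)"
    by (intro Bochner_Integration.integral_cong refl) (simp add: h_def algebra_simps)
  also have "\<dots> = (\<integral>\<zeta>. h \<zeta> \<partial>\<mu>) + \<alpha> - \<alpha> * (\<integral>\<zeta>. indicator S \<zeta> \<partial>\<mu>)"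
    using int_h int_ind int_indc by (subst Bochner_Integration.integral_diff) (auto simp: \<alpha>[symmetric])
  also have "\<dots> = (\<integral>\<zeta>. h \<zeta> \<partial>\<mu>) + \<alpha> * q"
    using int_indc by (simp add: q_def prob_space algebra_simps)
  finally have "\<bar>Im (circle_moment \<mu> 1 / centering_const \<tau> \<mu>)\<bar> \<le> \<bar>\<integral>\<zeta>. h \<zeta> \<partial>\<mu>\<bar> + \<bar>\<alpha>\<bar> * q"
    using q0 by (simp add: abs_mult[symmetric]) (metis abs_mult abs_of_nonneg abs_triangle_ineq)
  also have "\<bar>\<integral>\<zeta>. h \<zeta> \<partial>\<mu>\<bar> \<le> (9 + 1 / c0) * dispersion \<tau> \<mu>"
  proof -
    have "\<bar>\<integral>\<zeta>. h \<zeta> \<partial>\<mu>\<bar> \<le> (\<integral>\<zeta>. \<bar>h \<zeta>\<bar> \<partial>\<mu>)" by (rule integral_abs_bound)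
    also have "\<dots> \<le> (\<integral>\<zeta>. (9 + 1 / c0) * d \<zeta> \<partial>\<mu>)"
      using int_h int_d h_le by (intro integral_mono) auto
    finally show ?thesis by (simp add: disp)
  qed
  also have "\<bar>\<alpha>\<bar> * q \<le> 2 * (1 / c0 * dispersion \<tau> \<mu>)"
  proof (rule mult_mono)
    show "\<bar>\<alpha>\<bar> \<le> 2" using a(1) \<tau>(2) pi_less_4 by (simp add: \<alpha>_def)
  qed (use q_le q0 in auto)
  finally show ?thesis by (simp add: c0_def[symmetric] algebra_simps)
qed


text \<open>With \<open>s\<close> the dispersion and \<open>y\<close> the imaginary part of the centered mean,
  \<open>\<bar>m\<bar>\<^sup>2 = (1 - s)\<^sup>2 + y\<^sup>2\<close> and \<open>y = O(s)\<close>, so that \<open>1 - \<bar>m\<bar>\<^sup>2 \<ge> s\<close> for small \<open>s\<close>.\<close>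

lemma dispersion_le:
  assumes \<mu>: "\<mu> \<in> circle_prob" and \<tau>: "0 < \<tau>" "\<tau> < pi"
    and a: "\<bar>centering_angle \<tau> \<mu>\<bar> \<le> \<tau> / 2" "\<bar>centering_angle \<tau> \<mu>\<bar> \<le> pi - \<tau>"
    and s: "dispersion \<tau> \<mu> * (1 + (9 + 3 / (1 - cos (\<tau> / 2)))\<^sup>2) \<le> 1"
  shows "dispersion \<tau> \<mu> \<le> 2 * (1 - norm (circle_moment \<mu> 1))"
proof -
  define C where "C = 9 + 3 / (1 - cos (\<tau> / 2))"
  define s where "s = dispersion \<tau> \<mu>"
  define r where "r = norm (circle_moment \<mu> 1)"
  define y where "y = Im (circle_moment \<mu> 1 / centering_const \<tau> \<mu>)"
  have r: "r \<le> 1" unfolding r_def by (rule norm_circle_moment_le_1[OF \<mu>])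
  have s0: "s \<ge> 0" using dispersion_ge[OF \<mu>, of \<tau>] r by (simp add: s_def r_def)
  have "\<bar>y\<bar> \<le> C * s"
    unfolding y_def C_def s_def by (rule centered_imaginary_part_le[OF \<mu> \<tau> a])
  hence "y\<^sup>2 \<le> (C * s)\<^sup>2" using abs_le_square_iff[of y "C * s"] by simp
  hence y: "y\<^sup>2 \<le> C\<^sup>2 * s\<^sup>2" by (simp add: power_mult_distrib)
  have "r = norm (circle_moment \<mu> 1 / centering_const \<tau> \<mu>)"
    by (simp add: r_def norm_divide centering_const_eq)
  hence "r\<^sup>2 = (1 - s)\<^sup>2 + y\<^sup>2"
    by (simp only: cmod_power2 y_def s_def dispersion_eq[OF \<mu>]) simp
  also have "\<dots> = 1 - 2 * s + s\<^sup>2 + y\<^sup>2" by (simp add: power2_eq_square algebra_simps)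
  also have "\<dots> \<le> 1 - 2 * s + s * (s * (1 + C\<^sup>2))" using y by (simp add: power2_eq_square algebra_simps)
  also have "\<dots> \<le> 1 - 2 * s + s * 1"
    using s s0 by (intro add_left_mono mult_left_mono) (auto simp: s_def C_def)
  finally have "s \<le> (1 - r) * (1 + r)" by (simp add: power2_eq_square algebra_simps)
  also have "\<dots> \<le> (1 - r) * 2" using r by (intro mult_left_mono) auto
  finally show ?thesis by (simp add: s_def r_def)
qed

section \<open>Infinitesimal arrays\<close>

text \<open>An array is infinitesimal if and only if the largest of these numbers in a row tends to \<open>0\<close>.
  They bound the centering angle, the distance of the mean from \<open>1\<close> and the dispersion.\<close>

definition mean_distance :: "complex measure \<Rightarrow> real" where
  "mean_distance \<mu> = (\<integral>\<zeta>. norm (\<zeta> - 1) \<partial>\<mu>)"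

lemma mean_distance_le:
  assumes \<mu>: "\<mu> \<in> circle_prob" and e: "e > 0"
  shows "mean_distance \<mu> \<le> e + 2 * measure \<mu> {\<zeta> \<in> unit_circle. norm (\<zeta> - 1) \<ge> e}"
proof -
  interpret prob_space \<mu> using \<mu> by (rule prob_space_circle_prob)
  let ?A = "{\<zeta> \<in> unit_circle. norm (\<zeta> - 1) \<ge> e}"
  have "{\<zeta>. norm (\<zeta> - 1) \<ge> e} \<in> sets borel"
    by (intro borel_closed closed_Collect_le continuous_intros)
  hence A: "?A \<in> sets \<mu>"
    by (auto simp: sets_circle_prob[OF \<mu>] circle_borel_def sets_restrict_space intro!: image_eqI[of
        _ _ "{\<zeta>. norm (\<zeta> - 1) \<ge> e}"])
  have i: "integrable \<mu> (\<lambda>\<zeta>. indicator ?A \<zeta> :: real)"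
    using A by (intro integrable_real_indicator) (auto simp: emeasure_eq_measure)
  have "mean_distance \<mu> \<le> (\<integral>\<zeta>. e + 2 * indicator ?A \<zeta> \<partial>\<mu>)"
    unfolding mean_distance_def
  proof (rule integral_mono_AE)
    show "integrable \<mu> (\<lambda>\<zeta>. norm (\<zeta> - 1))" by (intro integrable_circle_prob[OF \<mu>] continuous_intros)
    show "integrable \<mu> (\<lambda>\<zeta>. e + 2 * indicator ?A \<zeta>)" using i by auto
    show "AE \<zeta> in \<mu>. norm (\<zeta> - 1) \<le> e + 2 * indicator ?A \<zeta>"
    proof (rule AE_I2)
      fix \<zeta> assume "\<zeta> \<in> space \<mu>"
      hence "norm \<zeta> = 1" by (simp add: space_circle_prob[OF \<mu>])
      thus "norm (\<zeta> - 1) \<le> e + 2 * indicator ?A \<zeta>"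
        using norm_triangle_ineq4[of \<zeta> 1] e by (auto simp: indicator_def)
    qed
  qed
  also have "\<dots> = e + 2 * measure \<mu> ?A"
    using i A by (simp add: prob_space)
  finally show ?thesis .
qed

lemma norm_one_minus_mean_le:
  assumes \<mu>: "\<mu> \<in> circle_prob"
  shows "norm (1 - circle_moment \<mu> 1) \<le> mean_distance \<mu>"
proof -
  interpret prob_space \<mu> using \<mu> by (rule prob_space_circle_prob)
  have "1 - circle_moment \<mu> 1 = (\<integral>\<zeta>. 1 - \<zeta> \<partial>\<mu>)"
    using integrable_powi[OF \<mu>, of 1] by (simp add: circle_moment_def prob_space)
  also have "norm \<dots> \<le> (\<integral>\<zeta>. norm (1 - \<zeta>) \<partial>\<mu>)" by (rule integral_norm_bound)
  finally show ?thesis by (simp add: mean_distance_def norm_minus_commute)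
qed

lemma abs_centering_angle_le:
  assumes \<mu>: "\<mu> \<in> circle_prob"
  shows "\<bar>centering_angle \<tau> \<mu>\<bar> \<le> 3 * mean_distance \<mu>"
proof -
  let ?S = "{\<zeta>. \<bar>Arg \<zeta>\<bar> < \<tau>}"
  have S: "?S \<in> sets borel" by measurable
  have i: "integrable \<mu> (\<lambda>\<zeta>. indicator ?S \<zeta> * Arg \<zeta>)"
    using S by (intro integrable_circle_prob_bounded[OF \<mu>, where B = pi]) (auto simp: indicator_def
        abs_Arg_le_pi)
  have "\<bar>centering_angle \<tau> \<mu>\<bar> = \<bar>\<integral>\<zeta>. indicator ?S \<zeta> * Arg \<zeta> \<partial>\<mu>\<bar>"
    by (simp add: centering_angle_def set_lebesgue_integral_def)
  also have "\<dots> \<le> (\<integral>\<zeta>. \<bar>indicator ?S \<zeta> * Arg \<zeta>\<bar> \<partial>\<mu>)" by (rule integral_abs_bound)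
  also have "\<dots> \<le> (\<integral>\<zeta>. 3 * norm (\<zeta> - 1) \<partial>\<mu>)"
  proof (rule integral_mono_AE)
    show "integrable \<mu> (\<lambda>\<zeta>. \<bar>indicator ?S \<zeta> * Arg \<zeta>\<bar>)" using i by (rule integrable_abs)
    show "integrable \<mu> (\<lambda>\<zeta>. 3 * norm (\<zeta> - 1))" by (intro integrable_circle_prob[OF \<mu>] continuous_intros)
    show "AE \<zeta> in \<mu>. \<bar>indicator ?S \<zeta> * Arg \<zeta>\<bar> \<le> 3 * norm (\<zeta> - 1)"
      using abs_Arg_le by (intro AE_I2) (auto simp: space_circle_prob[OF \<mu>] indicator_def)
  qed
  finally show ?thesis by (simp add: mean_distance_def)
qed

lemma norm_cis_minus_one_le: "norm (cis a - 1) \<le> \<bar>a\<bar>"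
  using iexp_approx1[of a 0] by (simp add: cis_conv_exp)

lemma dispersion_le_mean_distance:
  assumes \<mu>: "\<mu> \<in> circle_prob"
  shows "dispersion \<tau> \<mu> \<le> 4 * mean_distance \<mu>"
proof -
  let ?c = "centering_const \<tau> \<mu>"
  have c: "norm ?c = 1" "?c \<noteq> 0" by (auto simp: centering_const_eq)
  have "dispersion \<tau> \<mu> = Re ((?c - circle_moment \<mu> 1) / ?c)"
    using c by (simp add: dispersion_eq[OF \<mu>] diff_divide_distrib)
  also have "\<dots> \<le> norm ((?c - circle_moment \<mu> 1) / ?c)" by (rule complex_Re_le_cmod)
  also have "\<dots> = norm ((?c - 1) + (1 - circle_moment \<mu> 1))" using c by (simp add: norm_divide)
  also have "\<dots> \<le> norm (?c - 1) + norm (1 - circle_moment \<mu> 1)" by (rule norm_triangle_ineq)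
  also have "\<dots> \<le> 3 * mean_distance \<mu> + mean_distance \<mu>"
    using norm_cis_minus_one_le[of "centering_angle \<tau> \<mu>"] abs_centering_angle_le[OF \<mu>, of \<tau>]
        norm_one_minus_mean_le[OF \<mu>]
    by (simp add: centering_const_eq)
  finally show ?thesis by simp
qed

lemma infinitesimal_array_mean_distance:
  assumes inf: "infinitesimal_array K \<mu>" and K: "\<And>n. n \<ge> 1 \<Longrightarrow> K n \<ge> 1"
    and \<mu>: "\<And>n k. n \<ge> 1 \<Longrightarrow> 1 \<le> k \<Longrightarrow> k \<le> K n \<Longrightarrow> \<mu> n k \<in> circle_prob" and e: "e > 0"
  shows "\<forall>\<^sub>F n in sequentially. n \<ge> 1 \<and> (\<forall>k\<in>{1..K n}. mean_distance (\<mu> n k) \<le> e)"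
proof -
  let ?f = "\<lambda>n k. measure (\<mu> n k) {\<zeta> \<in> unit_circle. norm (\<zeta> - 1) \<ge> e / 2}"
  have "(\<lambda>n. Max (?f n ` {1..K n})) \<longlonglongrightarrow> 0"
    by (rule inf[unfolded infinitesimal_array_def, rule_format]) (use e in simp)
  hence "\<forall>\<^sub>F n in sequentially. Max (?f n ` {1..K n}) < e / 4"
    using e by (intro order_tendstoD(2)) auto
  thus ?thesis using eventually_ge_at_top[of 1]
  proof eventually_elim
    case (elim n)
    have "mean_distance (\<mu> n k) \<le> e" if k: "k \<in> {1..K n}" for k
    proof -
      have "?f n k \<le> Max (?f n ` {1..K n})" using k by (intro Max_ge) auto
      moreover have "mean_distance (\<mu> n k) \<le> e / 2 + 2 * ?f n k"
        using elim(2) k e by (intro mean_distance_le \<mu>) auto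
      ultimately show ?thesis using elim(1) by linarith
    qed
    thus ?case using elim by blast
  qed
qed

section \<open>Products of numbers close to one\<close>

lemma prod_le_exp_sum:
  fixes f :: "'a \<Rightarrow> real"
  assumes "\<And>k. k \<in> A \<Longrightarrow> 0 \<le> f k" "c \<ge> 0" "\<And>k. k \<in> A \<Longrightarrow> f k \<le> 1 - c * x k"
  shows "(\<Prod>k\<in>A. f k) \<le> exp (- c * (\<Sum>k\<in>A. x k))"
proof -
  have "(\<Prod>k\<in>A. f k) \<le> (\<Prod>k\<in>A. exp (- c * x k))"
    using assms exp_ge_add_one_self[of "- c * x _"] by (intro prod_mono) (force intro: order_trans)
  also have "\<dots> = exp (- c * (\<Sum>k\<in>A. x k))"
    by (cases "finite A") (simp_all add: exp_sum sum_distrib_left)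
  finally show ?thesis .
qed

lemma prod_ge_exp_sum:
  fixes f :: "'a \<Rightarrow> real"
  assumes "\<And>k. k \<in> A \<Longrightarrow> 1 / 2 \<le> f k \<and> f k \<le> 1"
  shows "exp (- 2 * (\<Sum>k\<in>A. 1 - f k)) \<le> (\<Prod>k\<in>A. f k)"
proof -
  have "exp (- 2 * (\<Sum>k\<in>A. 1 - f k)) = (\<Prod>k\<in>A. exp (- 2 * (1 - f k)))"
    by (cases "finite A") (simp_all add: exp_sum[symmetric] sum_distrib_left)
  also have "\<dots> \<le> (\<Prod>k\<in>A. f k)"
  proof (intro prod_mono conjI)
    fix k assume "k \<in> A"
    define x where "x = 1 - f k"
    have x: "0 \<le> x" "x \<le> 1 / 2" using assms[OF \<open>k \<in> A\<close>] by (auto simp: x_def)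
    have "x * x \<le> 1 / 2 * x" using x by (intro mult_right_mono) auto
    hence "- 2 * x \<le> ln (1 - x)"
      using ln_one_minus_pos_lower_bound[OF x] by (simp add: power2_eq_square)
    hence "exp (- 2 * x) \<le> 1 - x" using x by (simp add: ln_ge_iff)
    thus "exp (- 2 * (1 - f k)) \<le> f k" by (simp add: x_def)
  qed simp
  finally show ?thesis .
qed

text \<open>The first partial product below \<open>sqrt P\<close> is still at least \<open>sqrt P / 2\<close>, which leaves a
  remainder of at most \<open>2 sqrt P\<close>.\<close>

lemma split_product:
  fixes t :: "nat \<Rightarrow> real"
  assumes t: "\<And>i. i \<le> K \<Longrightarrow> 1 / 2 \<le> t i \<and> t i \<le> 1"
  defines "P \<equiv> (\<Prod>i\<le>K. t i)"
  shows "\<exists>j\<le>K. (\<Prod>i\<le>j. t i) \<le> 2 * sqrt P \<and> (\<Prod>i\<in>{j<..K}. t i) \<le> 2 * sqrt P"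
proof -
  have pos: "(\<Prod>i\<in>A. t i) > 0" if "A \<subseteq> {..K}" for A using t that by (intro prod_pos) force
  have P: "0 < P" "P \<le> 1" using pos[of "{..K}"] t by (auto simp: P_def intro!: prod_le_1) force
  have sq: "sqrt P * sqrt P = P" "0 < sqrt P" "sqrt P \<le> 1" using P by auto
  have PK: "(\<Prod>i\<le>K. t i) \<le> sqrt P"
    using mult_right_mono[OF sq(3), of "sqrt P"] sq by (simp add: P_def[symmetric])
  \<comment> \<open>cut at the first partial product that is at most \<open>sqrt P\<close>\<close>
  define j where "j = (LEAST j. (\<Prod>i\<le>j. t i) \<le> sqrt P)"
  have j: "(\<Prod>i\<le>j. t i) \<le> sqrt P" unfolding j_def by (rule LeastI[of _ K]) (rule PK)
  have jK: "j \<le> K" unfolding j_def by (rule Least_le) (rule PK)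
  have ge: "sqrt P / 2 \<le> (\<Prod>i\<le>j. t i)"
  proof (cases j)
    case 0
    have "sqrt P / 2 \<le> t 0" using t[of 0, OF le0] sq(3) by linarith
    thus ?thesis by (simp add: 0)
  next
    case (Suc i)
    have "\<not> (\<Prod>i\<le>i. t i) \<le> sqrt P" using not_less_Least[of i "\<lambda>j. (\<Prod>i\<le>j. t i) \<le> sqrt P"] Suc by (simp
        add: j_def)
    hence "sqrt P * (1 / 2) \<le> (\<Prod>i\<le>i. t i) * t j" using t[of j] jK sq(2) pos[of "{..i}"] Suc
      by (intro mult_mono) (auto intro: less_imp_le)
    thus ?thesis using Suc by simp
  qed
  have "{..K} = {..j} \<union> {j<..K}" using jK by auto
  hence "P = (\<Prod>i\<le>j. t i) * (\<Prod>i\<in>{j<..K}. t i)"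
    unfolding P_def by (simp only:) (rule prod.union_disjoint, auto)
  also have "\<dots> \<ge> sqrt P / 2 * (\<Prod>i\<in>{j<..K}. t i)"
  proof (rule mult_right_mono[OF ge])
    have "(\<Prod>i\<in>{j<..K}. t i) > 0" by (rule pos) auto
    thus "(\<Prod>i\<in>{j<..K}. t i) \<ge> 0" by simp
  qed
  finally have "sqrt P / 2 * (\<Prod>i\<in>{j<..K}. t i) \<le> sqrt P / 2 * (2 * sqrt P)" using sq(1) by simp
  hence "(\<Prod>i\<in>{j<..K}. t i) \<le> 2 * sqrt P" by (rule mult_left_le_imp_le) (use sq(2) in simp)
  moreover have "(\<Prod>i\<le>j. t i) \<le> 2 * sqrt P" using j sq(2) by linarith
  ultimately show ?thesis using jK by blast
qed

section \<open>Boolean and free products of a row\<close>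

lemma foldl_bool_mconv_row:
  assumes l: "l \<in> unit_circle" and \<mu>: "\<And>k. 1 \<le> k \<Longrightarrow> k \<le> K \<Longrightarrow> \<mu> k \<in> circle_prob"
  defines "\<rho> \<equiv> foldl (\<uplus>\<^sub>\<times>) (circle_dirac l) (map \<mu> [1..<Suc K])"
  shows "\<rho> \<in> circle_prob"
    and "norm z < 1 \<Longrightarrow> norm (B_transform \<rho> z) = (\<Prod>k=1..K. norm (B_transform (\<mu> k) z))"
proof -
  have "set (map \<mu> [1..<Suc K]) \<subseteq> circle_prob" using \<mu> by auto
  note * = bool_mconv_foldl[OF circle_dirac(1)[OF l] this, folded \<rho>_def]
  show "\<rho> \<in> circle_prob" using * by blast
  assume z: "norm z < 1"
  have "B_transform \<rho> z = l * (\<Prod>k\<leftarrow>[1..<Suc K]. B_transform (\<mu> k) z)"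
    using * z circle_dirac(3)[OF l z] by (simp add: comp_def del: upt_Suc)
  also have "(\<Prod>k\<leftarrow>[1..<Suc K]. B_transform (\<mu> k) z) = (\<Prod>k=1..K. B_transform (\<mu> k) z)"
    by (subst prod.distinct_set_conv_list[symmetric]) (auto simp: atLeastLessThanSuc_atLeastAtMost
        simp del: upt_Suc)
  finally show "norm (B_transform \<rho> z) = (\<Prod>k=1..K. norm (B_transform (\<mu> k) z))"
    using l by (simp add: norm_mult flip: prod_norm)
qed

lemma norm_moment_foldl_bool_le:
  assumes l: "l \<in> unit_circle" and \<mu>: "\<And>k. 1 \<le> k \<Longrightarrow> k \<le> K \<Longrightarrow> \<mu> k \<in> circle_prob"
  defines "\<rho> \<equiv> foldl (\<uplus>\<^sub>\<times>) (circle_dirac l) (map \<mu> [1..<Suc K])"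
  shows "norm (circle_moment \<rho> (int (Suc j))) \<le> 2 ^ Suc j * exp (- (1 / 3) * (\<Sum>k=1..K. 1 - norm
      (circle_moment (\<mu> k) 1)))"
proof (rule norm_circle_moment_le_B_bound)
  note row = foldl_bool_mconv_row[where l = l and K = K and \<mu> = \<mu>, folded \<rho>_def]
  show "\<rho> \<in> circle_prob" by (rule row(1)) (use l \<mu> in auto)
  fix z :: complex assume z: "norm z = 1 / 2"
  have "norm (B_transform \<rho> z) = (\<Prod>k=1..K. norm (B_transform (\<mu> k) z))"
    by (rule row(2)) (use l \<mu> z in auto)
  also have "\<dots> \<le> exp (- (1 / 3) * (\<Sum>k=1..K. 1 - norm (circle_moment (\<mu> k) 1)))"
  proof (rule prod_le_exp_sum)
    fix k assume "k \<in> {1..K}"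
    hence k: "\<mu> k \<in> circle_prob" using \<mu> by auto
    have "(1 - norm z) / (1 + norm z) * (1 - norm (B_transform (\<mu> k) 0)) \<le> 1 - norm (B_transform (\<mu>
        k) z)"
      using z by (intro one_minus_norm_schur_ge B_transform_holomorphic norm_B_transform_le_1 k) auto
    thus "norm (B_transform (\<mu> k) z) \<le> 1 - 1 / 3 * (1 - norm (circle_moment (\<mu> k) 1))"
      by (simp add: z B_transform_0[OF k] field_simps)
  qed auto
  finally show "norm (B_transform \<rho> z) \<le> exp (- (1 / 3) * (\<Sum>k=1..K. 1 - norm (circle_moment (\<mu>
      k) 1)))" .
qed

lemma norm_mean_foldl_bool:
  assumes l: "l \<in> unit_circle" and \<mu>: "\<And>k. 1 \<le> k \<Longrightarrow> k \<le> K \<Longrightarrow> \<mu> k \<in> circle_prob"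
  shows "norm (circle_moment (foldl (\<uplus>\<^sub>\<times>) (circle_dirac l) (map \<mu> [1..<Suc K])) 1) = (\<Prod>k=1..K. norm
      (circle_moment (\<mu> k) 1))"
proof -
  let ?\<rho> = "foldl (\<uplus>\<^sub>\<times>) (circle_dirac l) (map \<mu> [1..<Suc K])"
  note row = foldl_bool_mconv_row[where l = l and K = K and \<mu> = \<mu>]
  have \<rho>: "?\<rho> \<in> circle_prob" by (rule row(1)) (use l \<mu> in auto)
  have "norm (B_transform ?\<rho> 0) = (\<Prod>k=1..K. norm (B_transform (\<mu> k) 0))" by (rule row(2)) (use l \<mu>
      in auto)
  also have "\<dots> = (\<Prod>k=1..K. norm (circle_moment (\<mu> k) 1))"
    using \<mu> by (intro prod.cong refl) (simp add: B_transform_0)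
  finally show ?thesis unfolding B_transform_0[OF \<rho>] .
qed

lemma foldl_free_mconv_row:
  assumes l: "l \<in> unit_circle" and \<mu>: "\<And>k. 1 \<le> k \<Longrightarrow> k \<le> K \<Longrightarrow> \<mu> k \<in> circle_prob"
  defines "\<rho> \<equiv> foldl (\<boxtimes>) (circle_dirac l) (map \<mu> [1..<Suc K])"
    and "P \<equiv> (\<Prod>k=1..K. norm (circle_moment (\<mu> k) 1))"
  shows "\<rho> \<in> circle_prob" and "norm (circle_moment \<rho> 1) = P"
    and "\<lbrakk>\<And>k. 1 \<le> k \<Longrightarrow> k \<le> K \<Longrightarrow> norm (circle_moment (\<mu> k) 1) \<ge> 1 / 2; 2 * sqrt P \<le> 1; j > 0\<rbrakk>
       \<Longrightarrow> norm (circle_moment \<rho> (int j)) \<le> 2 * sqrt P * 4 ^ j"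
proof -
  \<comment> \<open>the point mass has index 0, and the row is padded with point masses at 1\<close>
  define m where "m i = (if i = 0 then circle_dirac l else if i \<le> K then \<mu> i else circle_dirac 1)" for i
  have m: "m i \<in> circle_prob" for i using l \<mu> by (auto simp: m_def intro!: circle_dirac)
  interpret free_product m by unfold_locales (rule m)
  have \<rho>: "\<rho> = row_distribution K"
  proof -
    have "map \<mu> [1..<Suc K] = map m [1..<Suc K]" by (intro map_cong refl) (auto simp: m_def)
    moreover have "circle_dirac l = m 0" by (simp add: m_def)
    ultimately show ?thesis unfolding \<rho>_def by (simp only: foldl_free_mconv)
  qed
  have m0: "norm (circle_moment (m 0) 1) = 1" using l by (simp add: m_def circle_dirac)
  have prod: "(\<Prod>i\<le>K. norm (circle_moment (m i) 1)) = P"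
  proof -
    have "(\<Prod>i=1..K. norm (circle_moment (m i) 1)) = P"
      unfolding P_def by (intro prod.cong refl) (auto simp: m_def)
    moreover have "{..K} = insert 0 {1..K}" by auto
    ultimately show ?thesis using m0 by simp
  qed
  show "\<rho> \<in> circle_prob" unfolding \<rho> by (rule circle_moment_row_distribution(1))
  show "norm (circle_moment \<rho> 1) = P" unfolding \<rho> row_distribution_mean prod[symmetric] by (rule
      prod_norm[symmetric])
  assume half: "\<And>k. 1 \<le> k \<Longrightarrow> k \<le> K \<Longrightarrow> norm (circle_moment (\<mu> k) 1) \<ge> 1 / 2" and P: "2 * sqrt P \<le> 1"
      and j: "j > 0"
  have "1 / 2 \<le> norm (circle_moment (m i) 1) \<and> norm (circle_moment (m i) 1) \<le> 1" if "i \<le> K" for i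
    using that half[of i] m0 norm_circle_moment_le_1[OF m[of i], of 1] by (cases "i = 0") (auto
        simp: m_def[of i])
  then obtain i where "i \<le> K" "(\<Prod>k\<le>i. norm (circle_moment (m k) 1)) \<le> 2 * sqrt P"
    "(\<Prod>k\<in>{i<..K}. norm (circle_moment (m k) 1)) \<le> 2 * sqrt P"
    using split_product[of K "\<lambda>i. norm (circle_moment (m i) 1)"] unfolding prod by blast
  thus "norm (circle_moment \<rho> (int j)) \<le> 2 * sqrt P * 4 ^ j"
    unfolding \<rho> using P j by (intro norm_moment_row_distribution_le[of i]) (auto simp flip: prod_norm)
qed

section \<open>The equivalence\<close>

lemma filterlim_sum_at_top_iff_comparable:
  fixes s x :: "nat \<Rightarrow> nat \<Rightarrow> real"
  assumes "\<forall>\<^sub>F n in sequentially. \<forall>k\<in>{1..K n}. x n k \<le> s n k \<and> s n k \<le> 2 * x n k"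
  shows "filterlim (\<lambda>n. \<Sum>k=1..K n. s n k) at_top sequentially \<longleftrightarrow> filterlim (\<lambda>n. \<Sum>k=1..K n. x n k)
      at_top sequentially"
proof
  assume "filterlim (\<lambda>n. \<Sum>k=1..K n. s n k) at_top sequentially"
  moreover have "\<forall>\<^sub>F n in sequentially. (\<Sum>k=1..K n. s n k) \<le> 2 * (\<Sum>k=1..K n. x n k)"
    using assms by eventually_elim (auto simp: sum_distrib_left intro!: sum_mono)
  ultimately have "filterlim (\<lambda>n. 2 * (\<Sum>k=1..K n. x n k)) at_top sequentially"
    by (rule filterlim_at_top_mono)
  from filterlim_tendsto_pos_mult_at_top[OF tendsto_const[of "1 / 2"] _ this]
  show "filterlim (\<lambda>n. \<Sum>k=1..K n. x n k) at_top sequentially" by simp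
next
  assume "filterlim (\<lambda>n. \<Sum>k=1..K n. x n k) at_top sequentially"
  moreover have "\<forall>\<^sub>F n in sequentially. (\<Sum>k=1..K n. x n k) \<le> (\<Sum>k=1..K n. s n k)"
    using assms by eventually_elim (auto intro!: sum_mono)
  ultimately show "filterlim (\<lambda>n. \<Sum>k=1..K n. s n k) at_top sequentially"
    by (rule filterlim_at_top_mono)
qed

lemma prod_tendsto_0_iff:
  fixes t :: "nat \<Rightarrow> nat \<Rightarrow> real"
  assumes t: "\<forall>\<^sub>F n in sequentially. \<forall>k\<in>{1..K n}. 1 / 2 \<le> t n k \<and> t n k \<le> 1"
  shows "(\<lambda>n. \<Prod>k=1..K n. t n k) \<longlonglongrightarrow> 0 \<longleftrightarrow> filterlim (\<lambda>n. \<Sum>k=1..K n. 1 - t n k) at_top sequentially"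
proof
  assume lim: "(\<lambda>n. \<Prod>k=1..K n. t n k) \<longlonglongrightarrow> 0"
  show "filterlim (\<lambda>n. \<Sum>k=1..K n. 1 - t n k) at_top sequentially"
    unfolding filterlim_at_top
  proof
    fix Z :: real
    have "\<forall>\<^sub>F n in sequentially. (\<Prod>k=1..K n. t n k) < exp (- 2 * Z)"
      using lim by (rule order_tendstoD) simp
    thus "\<forall>\<^sub>F n in sequentially. Z \<le> (\<Sum>k=1..K n. 1 - t n k)"
      using t
    proof eventually_elim
      case (elim n)
      have "exp (- 2 * (\<Sum>k=1..K n. 1 - t n k)) \<le> (\<Prod>k=1..K n. t n k)"
        using elim(2) by (intro prod_ge_exp_sum) auto
      hence "exp (- 2 * (\<Sum>k=1..K n. 1 - t n k)) < exp (- 2 * Z)" using elim(1) by linarith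
      thus ?case by simp
    qed
  qed
next
  assume lim: "filterlim (\<lambda>n. \<Sum>k=1..K n. 1 - t n k) at_top sequentially"
  have "(\<lambda>n. exp (- 1 * (\<Sum>k=1..K n. 1 - t n k))) \<longlonglongrightarrow> 0"
    using lim by (auto intro!: filterlim_compose[OF exp_at_bot] simp: filterlim_uminus_at_top)
  moreover have "\<forall>\<^sub>F n in sequentially. norm (\<Prod>k=1..K n. t n k) \<le> exp (- 1 * (\<Sum>k=1..K n. 1 - t n k))"
    using t
  proof eventually_elim
    case (elim n)
    have nn: "0 \<le> t n k" if "k \<in> {1..K n}" for k using bspec[OF elim that] by linarith
    have "(\<Prod>k=1..K n. t n k) \<ge> 0" using nn by (intro prod_nonneg) auto
    moreover have "(\<Prod>k=1..K n. t n k) \<le> exp (- 1 * (\<Sum>k=1..K n. 1 - t n k))"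
      using nn by (intro prod_le_exp_sum) auto
    ultimately show ?case by simp
  qed
  ultimately show "(\<lambda>n. \<Prod>k=1..K n. t n k) \<longlonglongrightarrow> 0" by (rule Lim_null_comparison[rotated])
qed

theorem theorem3p6:
  fixes \<mu> :: "nat \<Rightarrow> nat \<Rightarrow> complex measure"
    and K :: "nat \<Rightarrow> nat"
    and l :: "nat \<Rightarrow> complex"
    and \<tau> :: real
  assumes "0 < \<tau>" and "\<tau> < pi"
    and "\<And>n. n \<ge> 1 \<Longrightarrow> K n \<ge> 1"
    and "\<And>n k. \<lbrakk>n \<ge> 1; 1 \<le> k; k \<le> K n\<rbrakk> \<Longrightarrow> \<mu> n k \<in> circle_prob_nz"
    and "infinitesimal_array K \<mu>"
    and "\<And>n. n \<ge> 1 \<Longrightarrow> l n \<in> unit_circle"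
  shows
    "(circle_weak_conv
        (\<lambda>n. foldl (\<uplus>\<^sub>\<times>) (circle_dirac (l n)) (map (\<mu> n) [1..<Suc (K n)])) circle_haar
      \<longleftrightarrow>
      circle_weak_conv
        (\<lambda>n. foldl (\<boxtimes>) (circle_dirac (l n)) (map (\<mu> n) [1..<Suc (K n)])) circle_haar)
     \<and>
     (circle_weak_conv
        (\<lambda>n. foldl (\<boxtimes>) (circle_dirac (l n)) (map (\<mu> n) [1..<Suc (K n)])) circle_haar
      \<longleftrightarrow>
      filterlim
        (\<lambda>n. \<Sum>k = 1..K n. \<integral>\<zeta>. (1 - Re \<zeta>) \<partial>centered \<tau> (\<mu> n k)) at_top sequentially)"
proof -
  have \<mu>: "\<mu> n k \<in> circle_prob" if "n \<ge> 1" "1 \<le> k" "k \<le> K n" for n k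
    using assms(4)[OF that] by (simp add: circle_prob_nz_def)
  define bo where "bo n = foldl (\<uplus>\<^sub>\<times>) (circle_dirac (l n)) (map (\<mu> n) [1..<Suc (K n)])" for n
  define fr where "fr n = foldl (\<boxtimes>) (circle_dirac (l n)) (map (\<mu> n) [1..<Suc (K n)])" for n
  define t where "t n k = norm (circle_moment (\<mu> n k) 1)" for n k
  define P where "P n = (\<Prod>k=1..K n. t n k)" for n
  define S where "S n = (\<Sum>k=1..K n. 1 - t n k)" for n
  define C where "C = 1 + (9 + 3 / (1 - cos (\<tau> / 2)))\<^sup>2"
  have C: "C > 0" unfolding C_def by (rule add_pos_nonneg) auto
  \<comment> \<open>bounds on the mean distance from 1 under which the estimates for the centering apply\<close>
  define e where "e = Min {1 / 2, \<tau> / 6, (pi - \<tau>) / 3, 1 / (4 * C)}"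
  have e_le: "e \<le> x" if "x \<in> {1 / 2, \<tau> / 6, (pi - \<tau>) / 3, 1 / (4 * C)}" for x
    unfolding e_def by (rule Min_le) (use that in auto)
  have e: "e > 0" "e \<le> 1 / 2" "e \<le> \<tau> / 6" "e \<le> (pi - \<tau>) / 3" "e \<le> 1 / (4 * C)"
    using assms(1,2) C by (simp add: e_def, (intro e_le, simp)+)
  have small: "\<forall>\<^sub>F n in sequentially. n \<ge> 1 \<and> (\<forall>k\<in>{1..K n}. mean_distance (\<mu> n k) \<le> e)"
    by (rule infinitesimal_array_mean_distance[OF assms(5) assms(3) \<mu> e(1)])
  have t: "\<forall>\<^sub>F n in sequentially. \<forall>k\<in>{1..K n}. 1 / 2 \<le> t n k \<and> t n k \<le> 1"
    using small
  proof eventually_elim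
    case (elim n)
    show ?case
    proof
      fix k assume k: "k \<in> {1..K n}"
      hence m: "\<mu> n k \<in> circle_prob" using \<mu> elim by auto
      have "norm (1 - circle_moment (\<mu> n k) 1) \<le> 1 / 2"
        using norm_one_minus_mean_le[OF m] elim k e(2) by force
      thus "1 / 2 \<le> t n k \<and> t n k \<le> 1"
        using norm_triangle_ineq2[of 1 "1 - circle_moment (\<mu> n k) 1"] norm_circle_moment_le_1[OF m]
            by (simp add: t_def)
    qed
  qed
  have disp: "\<forall>\<^sub>F n in sequentially. \<forall>k\<in>{1..K n}. 1 - t n k \<le> dispersion \<tau> (\<mu> n k) \<and> dispersion \<tau> (\<mu>
      n k) \<le> 2 * (1 - t n k)"
    using small
  proof eventually_elim
    case (elim n)
    show ?case
    proof
      fix k assume k: "k \<in> {1..K n}"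
      hence m: "\<mu> n k \<in> circle_prob" using \<mu> elim by auto
      have d: "mean_distance (\<mu> n k) \<le> e" using elim k by blast
      have "4 * e \<le> 1 / C" using e(5) C by (simp add: field_simps)
      hence "dispersion \<tau> (\<mu> n k) \<le> 1 / C"
        using dispersion_le_mean_distance[OF m, of \<tau>] d by linarith
      hence "dispersion \<tau> (\<mu> n k) * C \<le> 1" using C by (simp add: field_simps)
      moreover have "\<bar>centering_angle \<tau> (\<mu> n k)\<bar> \<le> \<tau> / 2" "\<bar>centering_angle \<tau> (\<mu> n k)\<bar> \<le> pi - \<tau>"
      proof -
        have "3 * e \<le> \<tau> / 2" "3 * e \<le> pi - \<tau>" using e(3,4) by (simp_all add: field_simps)
        thus "\<bar>centering_angle \<tau> (\<mu> n k)\<bar> \<le> \<tau> / 2" "\<bar>centering_angle \<tau> (\<mu> n k)\<bar> \<le> pi - \<tau>"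
          using abs_centering_angle_le[OF m, of \<tau>] d by linarith+
      qed
      ultimately show "1 - t n k \<le> dispersion \<tau> (\<mu> n k) \<and> dispersion \<tau> (\<mu> n k) \<le> 2 * (1 - t n k)"
        using dispersion_ge[OF m, of \<tau>] dispersion_le[OF m assms(1,2)] by (simp add: t_def C_def)
    qed
  qed
  have 3: "filterlim (\<lambda>n. \<Sum>k = 1..K n. \<integral>\<zeta>. (1 - Re \<zeta>) \<partial>centered \<tau> (\<mu> n k)) at_top sequentially \<longleftrightarrow>
      filterlim S at_top sequentially"
    unfolding dispersion_def[symmetric] S_def by (rule filterlim_sum_at_top_iff_comparable[OF disp])
  have PS: "P \<longlonglongrightarrow> 0 \<longleftrightarrow> filterlim S at_top sequentially"
    unfolding P_def S_def by (rule prod_tendsto_0_iff[OF t])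
  have ge1: "\<forall>\<^sub>F n in sequentially. n \<ge> (1::nat)" by (rule eventually_ge_at_top)
  have "bo n \<in> circle_prob" "norm (circle_moment (bo n) 1) = P n" if "n \<ge> 1" for n
    unfolding bo_def P_def t_def
    by (rule foldl_bool_mconv_row(1) norm_mean_foldl_bool; use that assms(6) \<mu> in auto)+
  hence bo: "\<forall>\<^sub>F n in sequentially. bo n \<in> circle_prob" "\<forall>\<^sub>F n in sequentially. norm (circle_moment
      (bo n) 1) = P n"
    by (auto intro: eventually_mono[OF ge1])
  have "fr n \<in> circle_prob" "norm (circle_moment (fr n) 1) = P n" if "n \<ge> 1" for n
    unfolding fr_def P_def t_def
    by (rule foldl_free_mconv_row(1,2); use that assms(6) \<mu> in auto)+
  hence fr: "\<forall>\<^sub>F n in sequentially. fr n \<in> circle_prob" "\<forall>\<^sub>F n in sequentially. norm (circle_moment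
      (fr n) 1) = P n"
    by (auto intro: eventually_mono[OF ge1])
  have mean: "P \<longlonglongrightarrow> 0" if "\<forall>\<^sub>F n in sequentially. \<nu> n \<in> circle_prob" "\<forall>\<^sub>F n in sequentially. norm
      (circle_moment (\<nu> n) 1) = P n"
     "circle_weak_conv \<nu> circle_haar" for \<nu>
  proof -
    have "(\<lambda>n. norm (circle_moment (\<nu> n) 1)) \<longlonglongrightarrow> 0"
      using circle_weak_conv_imp_moments[OF that(1) circle_haar that(3), of 1]
      by (simp add: circle_moment_haar tendsto_norm_zero)
    thus ?thesis using that(2) by (rule Lim_transform_eventually)
  qed
  have 1: "circle_weak_conv bo circle_haar \<longleftrightarrow> P \<longlonglongrightarrow> 0"
  proof
    assume "P \<longlonglongrightarrow> 0"
    hence S: "filterlim S at_top sequentially" using PS by blast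
    show "circle_weak_conv bo circle_haar"
    proof (rule circle_weak_conv_haar_if[OF bo(1)])
      fix k :: nat assume "k > 0"
      then obtain j where j: "k = Suc j" by (cases k) auto
      have "filterlim (\<lambda>n. - (1 / 3) * S n) at_bot sequentially"
        using filterlim_tendsto_pos_mult_at_top[OF tendsto_const[of "1 / 3"] _ S] by (simp add:
            filterlim_uminus_at_top)
      hence lim: "(\<lambda>n. 2 ^ Suc j * exp (- (1 / 3) * S n)) \<longlonglongrightarrow> 2 ^ Suc j * 0"
        by (intro tendsto_mult tendsto_const filterlim_compose[OF exp_at_bot])
      have bound: "\<forall>\<^sub>F n in sequentially. norm (circle_moment (bo n) (int k)) \<le> 2 ^ Suc j * exp (-
          (1 / 3) * S n)"
        using ge1
      proof eventually_elim
        case (elim n)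
        show ?case unfolding bo_def S_def t_def j
          by (rule norm_moment_foldl_bool_le) (use elim assms(6) \<mu> in auto)
      qed
      show "(\<lambda>n. circle_moment (bo n) (int k)) \<longlonglongrightarrow> 0"
        by (rule Lim_null_comparison[OF bound lim[unfolded mult_zero_right]])
    qed
  qed (rule mean[OF bo])
  have 2: "circle_weak_conv fr circle_haar \<longleftrightarrow> P \<longlonglongrightarrow> 0"
  proof
    assume P: "P \<longlonglongrightarrow> 0"
    have sqrt_lim: "(\<lambda>n. 2 * sqrt (P n)) \<longlonglongrightarrow> 0"
      using tendsto_mult[OF tendsto_const[of 2] tendsto_real_sqrt[OF P]] by simp
    show "circle_weak_conv fr circle_haar"
    proof (rule circle_weak_conv_haar_if[OF fr(1)])
      fix k :: nat assume k: "k > 0"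
      have lim: "(\<lambda>n. 2 * sqrt (P n) * 4 ^ k) \<longlonglongrightarrow> 0 * 4 ^ k"
        by (intro tendsto_mult sqrt_lim tendsto_const)
      have "\<forall>\<^sub>F n in sequentially. 2 * sqrt (P n) < 1"
        using sqrt_lim by (rule order_tendstoD) simp
      hence bound: "\<forall>\<^sub>F n in sequentially. norm (circle_moment (fr n) (int k)) \<le> 2 * sqrt (P n) * 4 ^ k"
        using ge1 t
      proof eventually_elim
        case (elim n)
        show ?case unfolding fr_def P_def t_def
          by (rule foldl_free_mconv_row(3)) (use elim assms(6) \<mu> k in \<open>auto simp: P_def t_def\<close>)
      qed
      show "(\<lambda>n. circle_moment (fr n) (int k)) \<longlonglongrightarrow> 0"
        by (rule Lim_null_comparison[OF bound lim[unfolded mult_zero_left]])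
    qed
  qed (rule mean[OF fr])
  show ?thesis
    unfolding bo_def[symmetric] fr_def[symmetric] 1 2 3 PS by simp
qed

end
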